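(* Let $\mu\in\mathfrak M^b_+(\Omega)$ be a bounded good measure. Then $\mu(E)=0$ for every Borel subset $E\subset\Omega$ with zero $C_{\Delta^{L\ln L}}$-capacity.
   Context: $\Omega$ is a bounded domain in $\mathbb R^N$ with smooth boundary; $\mathfrak M^b_+(\Omega)$ is the set of nonnegative bounded Radon measures in $\Omega$. A measure $\mu\in\mathfrak M^b_+(\Omega)$ is good if the problem $-\Delta u+e^u-1=\mu$ in $\Omega$, $u=0$ on $\partial\Omega$, has a weak solution, i.e. there is $u\in L^1(\Omega)$ with $e^u\in L^1(\Omega)$ such that $$\int_\Omega\left(-u\Delta\zeta+(e^u-1)\zeta\right)dx=\int_\Omega\zeta\,d\mu\qquad\forall\zeta\in W^{1,\infty}_0(\Omega)\cap W^{2,\infty}(\Omega).$$ Let $Q_0$ be a fixed cube containing $\overline\Omega$ with sides parallel to the axes. For $f\in L^1(\Omega)$, extended by $0$ to $Q_0\setminus\Omega$, the Hardy–Littlewood maximal function is $M[f](x)=\sup\frac1{|Q|}\int_Q|f(y)|\,dy$, the supremum being over all cubes $Q\subset Q_0$ containing $x$ with sides parallel to the axes. For compact $K\subset\Omega$, $$C_{\Delta^{L\ln L}}(K)=\inf\{\|M[\Delta\eta]\|_{L^1(Q_0)}:\eta\in C^2_0(\Omega),\ 0\le\eta\le1,\ \eta=1\text{ in a neighborhood of }K\},$$ where $C^2_0(\Omega)$ is the space of compactly supported $C^2$ functions in $\Omega$. A Borel set $E\subset\Omega$ is said to have zero capacity if every compact subset of $E$ has zero capacity. *)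

theory Defs
  imports "HOL-Analysis.Analysis"
begin

text \<open>Classical differentiability classes. The set \<open>S\<close> is meant to be open, so that
  derivatives may be taken with respect to the full neighbourhood filter.\<close>

definition partial_deriv :: "'a::euclidean_space \<Rightarrow> ('a \<Rightarrow> real) \<Rightarrow> 'a \<Rightarrow> real" where
  "partial_deriv i f x = frechet_derivative f (at x) i"

primrec Ck_on :: "nat \<Rightarrow> 'a::euclidean_space set \<Rightarrow> ('a \<Rightarrow> real) \<Rightarrow> bool" where
  "Ck_on 0 S f \<longleftrightarrow> continuous_on S f"
| "Ck_on (Suc k) S f \<longleftrightarrow>
     (\<forall>x\<in>S. f differentiable (at x)) \<and> (\<forall>i\<in>Basis. Ck_on k S (partial_deriv i f))"

definition smooth_on :: "'a::euclidean_space set \<Rightarrow> ('a \<Rightarrow> real) \<Rightarrow> bool" where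
  "smooth_on S f \<longleftrightarrow> (\<forall>k. Ck_on k S f)"

definition laplacian :: "('a::euclidean_space \<Rightarrow> real) \<Rightarrow> 'a \<Rightarrow> real" where
  "laplacian f x = (\<Sum>i\<in>Basis. partial_deriv i (partial_deriv i f) x)"

text \<open>Compactly supported functions on \<open>\<Omega>\<close> are represented by their extension by zero to the
  whole space.\<close>

definition compactly_supported_in :: "'a::euclidean_space set \<Rightarrow> ('a \<Rightarrow> real) \<Rightarrow> bool" where
  "compactly_supported_in \<Omega> f \<longleftrightarrow>
     compact (closure {x. f x \<noteq> 0}) \<and> closure {x. f x \<noteq> 0} \<subseteq> \<Omega>"

definition C2_0 :: "'a::euclidean_space set \<Rightarrow> ('a \<Rightarrow> real) set" where
  "C2_0 \<Omega> = {f. Ck_on 2 \<Omega> f \<and> compactly_supported_in \<Omega> f}"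

definition Cinf_0 :: "'a::euclidean_space set \<Rightarrow> ('a \<Rightarrow> real) set" where
  "Cinf_0 \<Omega> = {f. smooth_on \<Omega> f \<and> compactly_supported_in \<Omega> f}"

text \<open>Smoothness of the boundary is expressed through local \<open>C\<^sup>\<infinity>\<close> defining functions with
  nonvanishing gradient; thus \<open>\<Omega>\<close> lies locally on one side of its boundary.\<close>

definition smooth_boundary :: "'a::euclidean_space set \<Rightarrow> bool" where
  "smooth_boundary \<Omega> \<longleftrightarrow>
     (\<forall>p\<in>frontier \<Omega>. \<exists>U \<phi>. open U \<and> p \<in> U \<and> smooth_on U \<phi> \<and>
        (\<forall>x\<in>U. \<exists>i\<in>Basis. partial_deriv i \<phi> x \<noteq> 0) \<and> \<Omega> \<inter> U = {x\<in>U. \<phi> x < 0})"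

definition bounded_smooth_domain :: "'a::euclidean_space set \<Rightarrow> bool" where
  "bounded_smooth_domain \<Omega> \<longleftrightarrow>
     \<Omega> \<noteq> {} \<and> open \<Omega> \<and> connected \<Omega> \<and> bounded \<Omega> \<and> smooth_boundary \<Omega>"

text \<open>On an open subset of a Euclidean space every finite Borel measure is regular, hence Radon.\<close>

definition bounded_radon_measures :: "'a::euclidean_space set \<Rightarrow> 'a measure set" where
  "bounded_radon_measures \<Omega> = {\<mu>. sets \<mu> = sets (restrict_space borel \<Omega>) \<and> finite_measure \<mu>}"

definition locally_integrable_on :: "'a::euclidean_space set \<Rightarrow> ('a \<Rightarrow> real) \<Rightarrow> bool" where
  "locally_integrable_on \<Omega> f \<longleftrightarrow> (\<forall>K. compact K \<longrightarrow> K \<subseteq> \<Omega> \<longrightarrow> integrable (lebesgue_on K) f)"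

definition has_weak_partial ::
  "'a::euclidean_space set \<Rightarrow> 'a \<Rightarrow> ('a \<Rightarrow> real) \<Rightarrow> ('a \<Rightarrow> real) \<Rightarrow> bool" where
  "has_weak_partial \<Omega> i f g \<longleftrightarrow>
     locally_integrable_on \<Omega> f \<and> locally_integrable_on \<Omega> g \<and>
     (\<forall>\<phi>\<in>Cinf_0 \<Omega>. (\<integral>x. f x * partial_deriv i \<phi> x \<partial>lebesgue_on \<Omega>) =
                    - (\<integral>x. g x * \<phi> x \<partial>lebesgue_on \<Omega>))"

definition Linf :: "'a::euclidean_space set \<Rightarrow> ('a \<Rightarrow> real) set" where
  "Linf \<Omega> = {f \<in> borel_measurable (lebesgue_on \<Omega>). \<exists>B. AE x in lebesgue_on \<Omega>. \<bar>f x\<bar> \<le> B}"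

text \<open>\<open>W_inf k \<Omega>\<close> is the Sobolev space of functions with weak derivatives up to order \<open>k\<close> in
  \<open>L\<^sup>\<infinity>\<close>; its members are functions, not equivalence classes.\<close>

primrec W_inf :: "nat \<Rightarrow> 'a::euclidean_space set \<Rightarrow> ('a \<Rightarrow> real) set" where
  "W_inf 0 \<Omega> = Linf \<Omega>"
| "W_inf (Suc k) \<Omega> =
     {f \<in> Linf \<Omega>. \<forall>i\<in>Basis. \<exists>g\<in>W_inf k \<Omega>. has_weak_partial \<Omega> i f g}"

text \<open>As usual for exponent infinity, the subscript 0 means zero boundary trace (and not the norm
  closure of the test functions, which would force the gradient to vanish on the boundary too).
  Members are the representatives that are continuous up to the boundary; this choice matters when
  they are integrated against a measure that is singular with respect to Lebesgue measure.\<close>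

definition W1_inf_0 :: "'a::euclidean_space set \<Rightarrow> ('a \<Rightarrow> real) set" where
  "W1_inf_0 \<Omega> = {f \<in> W_inf 1 \<Omega>. continuous_on (closure \<Omega>) f \<and> (\<forall>x\<in>frontier \<Omega>. f x = 0)}"

definition has_weak_laplacian ::
  "'a::euclidean_space set \<Rightarrow> ('a \<Rightarrow> real) \<Rightarrow> ('a \<Rightarrow> real) \<Rightarrow> bool" where
  "has_weak_laplacian \<Omega> f w \<longleftrightarrow>
     (\<exists>g h. (\<forall>i\<in>Basis. has_weak_partial \<Omega> i f (g i) \<and> has_weak_partial \<Omega> i (g i) (h i)) \<and>
            w = (\<lambda>x. \<Sum>i\<in>Basis. h i x))"

text \<open>The weak Laplacian \<open>w\<close> below is unique up to a Lebesgue null set, so quantifying over all of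
  its representatives is harmless.\<close>

definition weak_solution :: "'a::euclidean_space set \<Rightarrow> 'a measure \<Rightarrow> ('a \<Rightarrow> real) \<Rightarrow> bool" where
  "weak_solution \<Omega> \<mu> u \<longleftrightarrow>
     integrable (lebesgue_on \<Omega>) u \<and> integrable (lebesgue_on \<Omega>) (\<lambda>x. exp (u x)) \<and>
     (\<forall>\<zeta> \<in> W1_inf_0 \<Omega> \<inter> W_inf 2 \<Omega>. \<forall>w. has_weak_laplacian \<Omega> \<zeta> w \<longrightarrow>
        (\<integral>x. - u x * w x + (exp (u x) - 1) * \<zeta> x \<partial>lebesgue_on \<Omega>) = (\<integral>x. \<zeta> x \<partial>\<mu>))"

definition good_measure :: "'a::euclidean_space set \<Rightarrow> 'a measure \<Rightarrow> bool" where
  "good_measure \<Omega> \<mu> \<longleftrightarrow> (\<exists>u. weak_solution \<Omega> \<mu> u)"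

definition is_cube :: "'a::euclidean_space set \<Rightarrow> bool" where
  "is_cube Q \<longleftrightarrow> (\<exists>a r. 0 < r \<and> Q = cbox a (a + r *\<^sub>R One))"

text \<open>The factor \<open>indicator \<Omega> y\<close> realises the extension of \<open>f\<close> by zero outside \<open>\<Omega>\<close>. Values are
  in \<open>ennreal\<close> because the supremum may be infinite.\<close>

definition maximal_function ::
  "'a::euclidean_space set \<Rightarrow> 'a set \<Rightarrow> ('a \<Rightarrow> real) \<Rightarrow> 'a \<Rightarrow> ennreal" where
  "maximal_function Q0 \<Omega> f x =
     (SUP Q \<in> {Q. is_cube Q \<and> Q \<subseteq> Q0 \<and> x \<in> Q}.
        (\<integral>\<^sup>+y. ennreal \<bar>indicator \<Omega> y * f y\<bar> \<partial>lebesgue_on Q) / emeasure lebesgue Q)"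

definition capacity_LlnL :: "'a::euclidean_space set \<Rightarrow> 'a set \<Rightarrow> 'a set \<Rightarrow> ennreal" where
  "capacity_LlnL Q0 \<Omega> K =
     (INF \<eta> \<in> {\<eta> \<in> C2_0 \<Omega>. (\<forall>x. 0 \<le> \<eta> x \<and> \<eta> x \<le> 1) \<and>
                  (\<exists>U. open U \<and> K \<subseteq> U \<and> (\<forall>x\<in>U. \<eta> x = 1))}.
        \<integral>\<^sup>+x. maximal_function Q0 \<Omega> (laplacian \<eta>) x \<partial>lebesgue_on Q0)"

definition zero_capacity_LlnL :: "'a::euclidean_space set \<Rightarrow> 'a set \<Rightarrow> 'a set \<Rightarrow> bool" where
  "zero_capacity_LlnL Q0 \<Omega> E \<longleftrightarrow>
     (\<forall>K. compact K \<longrightarrow> K \<subseteq> E \<longrightarrow> capacity_LlnL Q0 \<Omega> K = 0)"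

end

theory Submission
  imports Defs
begin

text \<open>Let \<open>u\<close> solve the problem with datum \<open>\<mu>\<close> and let \<open>K\<close> be a compact set of zero capacity. For an
  admissible \<open>\<eta>\<close>, equal to 1 near \<open>K\<close>, the weak formulation with test function \<open>\<eta>\<close> gives
  \<open>\<mu>(K) \<le> \<integral> \<eta> d\<mu> = \<integral> - u \<Delta>\<eta> + (e^u - 1) \<eta>\<close>, and one wants the right-hand side to vanish as the norm
  \<open>j\<close> of the maximal function of \<open>\<Delta>\<eta>\<close> tends to zero.

  Where \<open>u\<close> is positive this is the duality between exponential integrability and \<open>L ln L\<close>. By
  Stein's converse to the maximal theorem, \<open>\<integral> \<bar>\<Delta>\<eta>\<bar> ln\<^sup>+ \<bar>\<Delta>\<eta>\<bar>\<close> is bounded by a multiple of \<open>j\<close>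
  (\<open>LlogL_le_maximal\<close>, from a dyadic stopping argument in \<open>Calderon_Zygmund_cell\<close>), and Young's
  inequality \<open>Young_exp\<close> pairs it with \<open>e^u \<in> L^1\<close>.

  Where \<open>u\<close> is negative only \<open>u \<in> L^1\<close> is given, and a bound is needed. Since \<open>\<mu> \<ge> 0\<close>, \<open>v = - u\<close> satisfies
  \<open>\<Delta>v \<ge> 1 - e^(-v)\<close>, whose right-hand side is nonnegative where \<open>v \<ge> 0\<close>. Kato's inequality
  (\<open>Kato_inequality\<close>) makes a convex regularisation of the positive part of \<open>v\<close> weakly subharmonic,
  and a weakly subharmonic integrable function is locally bounded
  (\<open>subharmonic_locally_bounded\<close>). The bound is only local, so the test function is \<open>\<theta>\<eta>\<close> with one fixed
  admissible function \<open>\<theta>\<close> as cutoff: all the \<open>\<theta>\<eta>\<close> are supported in a common compact set.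

  The cutoff creates the terms \<open>\<nabla>\<theta> \<bullet> \<nabla>\<eta>\<close> and \<open>\<eta> \<Delta>\<theta>\<close>. Because \<open>0 \<le> \<eta> \<le> 1\<close>, Green's identity gives
  \<open>\<integral> \<bar>\<nabla>\<eta>\<bar>\<^sup>2 \<le> \<integral> \<bar>\<Delta>\<eta>\<bar> \<le> j\<close> (\<open>energy_le\<close>), and Poincare's inequality then makes \<open>\<eta>\<close> small in \<open>L^2\<close>;
  both are enough against \<open>u\<close>, whose positive part is square integrable. This yields
  \<open>\<mu>(K) = 0\<close> (\<open>capacity_zero_compact_null\<close>), and inner regularity extends it to Borel sets.\<close>

section \<open>Calculus of twice continuously differentiable functions\<close>

lemma partial_deriv_eq:
  assumes "(f has_derivative D) (at x)"
  shows "partial_deriv i f x = D i"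
  using frechet_derivative_at[OF assms] by (simp add: partial_deriv_def)

lemma has_derivative_partial:
  fixes f :: "'a::euclidean_space \<Rightarrow> real"
  assumes "f differentiable (at x)"
  shows "(f has_derivative (\<lambda>h. \<Sum>i\<in>Basis. (h \<bullet> i) * partial_deriv i f x)) (at x)"
proof -
  let ?D = "frechet_derivative f (at x)"
  have D: "(f has_derivative ?D) (at x)"
    using assms frechet_derivative_works by blast
  then have lin: "linear ?D"
    by (rule has_derivative_linear)
  have "?D h = (\<Sum>i\<in>Basis. (h \<bullet> i) * partial_deriv i f x)" for h
  proof -
    have "?D h = ?D (\<Sum>i\<in>Basis. (h \<bullet> i) *\<^sub>R i)"
      by (simp add: euclidean_representation)
    also have "\<dots> = (\<Sum>i\<in>Basis. (h \<bullet> i) * ?D i)"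
      by (simp add: linear_sum[OF lin] linear_cmul[OF lin])
    finally show ?thesis by (simp add: partial_deriv_def)
  qed
  then have "?D = (\<lambda>h. \<Sum>i\<in>Basis. (h \<bullet> i) * partial_deriv i f x)" by blast
  with D show ?thesis by simp
qed

lemma Ck_on_2_iff:
  "Ck_on 2 S f \<longleftrightarrow> (\<forall>x\<in>S. f differentiable (at x)) \<and> (\<forall>i\<in>Basis. Ck_on 1 S (partial_deriv i f))"
  by (simp add: numeral_2_eq_2)

lemma Ck_on_imp_continuous: "Ck_on k S f \<Longrightarrow> continuous_on S f"
  by (cases k) (auto intro!: continuous_at_imp_continuous_on dest: differentiable_imp_continuous_within)

lemma Ck_on_SucD: "Ck_on (Suc k) S f \<Longrightarrow> Ck_on k S f"
proof (induction k arbitrary: f)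
  case 0
  then show ?case using Ck_on_imp_continuous[OF 0] by simp
next
  case (Suc k)
  have "f differentiable (at x)" if "x \<in> S" for x
    using Suc.prems that by simp
  moreover have "Ck_on k S (partial_deriv i f)" if "i \<in> Basis" for i
    using Suc.prems that by (intro Suc.IH) (metis Ck_on.simps(2))
  ultimately show ?case by simp
qed

lemma Ck_on_2_1: "Ck_on 2 S f \<Longrightarrow> Ck_on 1 S f"
  using Ck_on_SucD[of 1 S f] by (simp add: numeral_2_eq_2)

lemma Ck_on_subset: "Ck_on k S f \<Longrightarrow> T \<subseteq> S \<Longrightarrow> Ck_on k T f"
  by (induction k arbitrary: f) (auto intro: continuous_on_subset)

lemma partial_deriv_add:
  assumes "f differentiable (at x)" "g differentiable (at x)"
  shows "partial_deriv i (\<lambda>x. f x + g x) x = partial_deriv i f x + partial_deriv i g x"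
  using partial_deriv_eq[OF has_derivative_add[OF
      assms[unfolded frechet_derivative_works]], of i]
  by (simp add: partial_deriv_def)

lemma partial_deriv_mult:
  fixes f g :: "'a::euclidean_space \<Rightarrow> real"
  assumes "f differentiable (at x)" "g differentiable (at x)"
  shows "partial_deriv i (\<lambda>x. f x * g x) x = f x * partial_deriv i g x + partial_deriv i f x * g x"
  using partial_deriv_eq[OF has_derivative_mult[OF
      assms[unfolded frechet_derivative_works]], of i]
  by (simp add: partial_deriv_def)

lemma partial_deriv_comp:
  assumes "f differentiable (at x)" "(\<phi> has_real_derivative d) (at (f x))"
  shows "partial_deriv i (\<lambda>x. \<phi> (f x)) x = d * partial_deriv i f x"
    "(\<lambda>x. \<phi> (f x)) differentiable (at x)"
proof -
  have f: "(f has_derivative frechet_derivative f (at x)) (at x)"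
    using assms frechet_derivative_works by blast
  have "((\<lambda>x. \<phi> (f x)) has_derivative (\<lambda>h. d * frechet_derivative f (at x) h)) (at x)"
    using has_derivative_compose[OF f, of \<phi> "(*) d"] assms(2)
    by (simp add: has_field_derivative_def)
  from partial_deriv_eq[OF this] this
  show "partial_deriv i (\<lambda>x. \<phi> (f x)) x = d * partial_deriv i f x"
    "(\<lambda>x. \<phi> (f x)) differentiable (at x)"
    by (auto simp: partial_deriv_def differentiable_def)
qed

lemma Ck_on_1_mult:
  assumes "Ck_on 1 UNIV f" "Ck_on 1 UNIV g"
  shows "Ck_on 1 UNIV (\<lambda>x. f x * g x)"
proof -
  have d: "f differentiable (at x)" "g differentiable (at x)" for x
    using assms by auto
  have c: "continuous_on UNIV f" "continuous_on UNIV g"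
    using assms Ck_on_imp_continuous by blast+
  have "partial_deriv i (\<lambda>x. f x * g x) = (\<lambda>x. f x * partial_deriv i g x + partial_deriv i f x * g x)" for i
    using partial_deriv_mult[OF d] by auto
  then show ?thesis
    using assms d c by (auto intro!: continuous_intros)
qed

lemma Ck_on_1_add:
  assumes "Ck_on 1 UNIV f" "Ck_on 1 UNIV g"
  shows "Ck_on 1 UNIV (\<lambda>x. f x + g x)"
proof -
  have d: "f differentiable (at x)" "g differentiable (at x)" for x
    using assms by auto
  have "partial_deriv i (\<lambda>x. f x + g x) = (\<lambda>x. partial_deriv i f x + partial_deriv i g x)" for i
    using partial_deriv_add[OF d] by auto
  then show ?thesis
    using assms d by (auto intro!: continuous_intros)
qed

lemma Ck_on_2_mult:
  assumes "Ck_on 2 UNIV f" "Ck_on 2 UNIV g"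
  shows "Ck_on 2 UNIV (\<lambda>x. f x * g x)"
proof -
  have d: "f differentiable (at x)" "g differentiable (at x)" for x
    using assms by (auto simp: Ck_on_2_iff)
  have "partial_deriv i (\<lambda>x. f x * g x) = (\<lambda>x. f x * partial_deriv i g x + partial_deriv i f x * g x)" for i
    using partial_deriv_mult[OF d] by auto
  moreover have "Ck_on 1 UNIV (\<lambda>x. f x * partial_deriv i g x + partial_deriv i f x * g x)"
    if "i \<in> Basis" for i
    using assms that
    by (intro Ck_on_1_add Ck_on_1_mult Ck_on_2_1[OF assms(1)] Ck_on_2_1[OF assms(2)])
      (simp_all add: Ck_on_2_iff)
  ultimately show ?thesis
    using d unfolding Ck_on_2_iff by simp
qed

lemma Ck_on_1_comp:
  assumes "Ck_on 1 UNIV f" "\<And>x. (\<phi> has_real_derivative \<phi>' (f x)) (at (f x))"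
    "continuous_on UNIV (\<lambda>x. \<phi>' (f x))"
  shows "Ck_on 1 UNIV (\<lambda>x. \<phi> (f x))"
proof -
  have d: "f differentiable (at x)" for x
    using assms by auto
  have "partial_deriv i (\<lambda>x. \<phi> (f x)) = (\<lambda>x. \<phi>' (f x) * partial_deriv i f x)" for i
    using partial_deriv_comp(1)[OF d assms(2)] by auto
  then show ?thesis
    using assms partial_deriv_comp(2)[OF d assms(2)] by (auto intro!: continuous_intros)
qed

text \<open>Derivatives of \<open>\<phi>\<close> are asked for only on the range of \<open>f\<close>: the profile of the barrier used below
  for subharmonic functions is smooth only on a half-line.\<close>

lemma Ck_on_2_comp:
  fixes \<phi> \<phi>' \<phi>'' :: "real \<Rightarrow> real"
  assumes f: "Ck_on 2 UNIV f"
    and 1: "\<And>x. (\<phi> has_real_derivative \<phi>' (f x)) (at (f x))"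
    and 2: "\<And>x. (\<phi>' has_real_derivative \<phi>'' (f x)) (at (f x))"
    and c: "continuous_on UNIV (\<lambda>x. \<phi>'' (f x))"
  shows "Ck_on 2 UNIV (\<lambda>x. \<phi> (f x))"
    and "laplacian (\<lambda>x. \<phi> (f x)) x =
       \<phi>' (f x) * laplacian f x + \<phi>'' (f x) * (\<Sum>i\<in>Basis. (partial_deriv i f x)\<^sup>2)"
proof -
  have d: "f differentiable (at x)" for x
    using f by (auto simp: Ck_on_2_iff)
  have p: "partial_deriv i (\<lambda>x. \<phi> (f x)) = (\<lambda>x. \<phi>' (f x) * partial_deriv i f x)" for i
    using partial_deriv_comp(1)[OF d 1] by auto
  have c1: "Ck_on 1 UNIV (\<lambda>x. \<phi>' (f x))"
    by (rule Ck_on_1_comp[OF Ck_on_2_1[OF f] 2 c])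
  show "Ck_on 2 UNIV (\<lambda>x. \<phi> (f x))"
    unfolding Ck_on_2_iff p using partial_deriv_comp(2)[OF d 1] Ck_on_1_mult[OF c1] f
    by (auto simp: Ck_on_2_iff simp del: One_nat_def Ck_on.simps)
  have "partial_deriv i (\<lambda>x. \<phi>' (f x) * partial_deriv i f x) x =
      \<phi>' (f x) * partial_deriv i (partial_deriv i f) x + \<phi>'' (f x) * (partial_deriv i f x)\<^sup>2"
    if "i \<in> Basis" for i
  proof -
    have "partial_deriv i f differentiable (at x)"
      using f that by (auto simp: Ck_on_2_iff)
    then show ?thesis
      using partial_deriv_mult[OF partial_deriv_comp(2)[OF d 2]] partial_deriv_comp(1)[OF d 2]
      by (simp add: power2_eq_square)
  qed
  then show "laplacian (\<lambda>x. \<phi> (f x)) x =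
       \<phi>' (f x) * laplacian f x + \<phi>'' (f x) * (\<Sum>i\<in>Basis. (partial_deriv i f x)\<^sup>2)"
    unfolding laplacian_def p by (simp add: sum_distrib_left sum.distrib)
qed

lemma laplacian_mult:
  assumes f: "Ck_on 2 UNIV f" and g: "Ck_on 2 UNIV g"
  shows "laplacian (\<lambda>x. f x * g x) x = f x * laplacian g x + g x * laplacian f x
     + 2 * (\<Sum>i\<in>Basis. partial_deriv i f x * partial_deriv i g x)"
proof -
  have d: "f differentiable (at x)" "g differentiable (at x)" for x
    using assms by (auto simp: Ck_on_2_iff)
  have p: "partial_deriv i (\<lambda>x. f x * g x) = (\<lambda>x. f x * partial_deriv i g x + partial_deriv i f x * g x)" for i
    using partial_deriv_mult[OF d] by auto
  have "partial_deriv i (\<lambda>x. f x * partial_deriv i g x + partial_deriv i f x * g x) x =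
     f x * partial_deriv i (partial_deriv i g) x + g x * partial_deriv i (partial_deriv i f) x
     + 2 * (partial_deriv i f x * partial_deriv i g x)" if i: "i \<in> Basis" for i
  proof -
    have "partial_deriv i f differentiable (at x)" "partial_deriv i g differentiable (at x)"
      using f g i by (auto simp: Ck_on_2_iff)
    then show ?thesis using d
      by (simp add: partial_deriv_add partial_deriv_mult)
  qed
  then show ?thesis
    unfolding laplacian_def p by (simp add: sum_distrib_left sum.distrib)
qed

lemma continuous_on_laplacian: "Ck_on 2 UNIV f \<Longrightarrow> continuous_on UNIV (laplacian f)"
  unfolding laplacian_def Ck_on_2_iff by (auto intro!: continuous_intros)

lemma continuous_on_partial: "Ck_on k UNIV f \<Longrightarrow> 0 < k \<Longrightarrow> i \<in> Basis \<Longrightarrow> continuous_on UNIV (partial_deriv i f)"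
  by (cases k) (auto intro: Ck_on_imp_continuous)

lemma partial_deriv_outside:
  assumes "closed K" "\<And>x. x \<notin> K \<Longrightarrow> f x = 0" "x \<notin> K"
  shows "partial_deriv i f x = 0" "f differentiable (at x)"
proof -
  have "((\<lambda>x. 0) has_derivative (\<lambda>h. 0)) (at x)" by simp
  then have "(f has_derivative (\<lambda>h. 0)) (at x)"
    by (rule has_derivative_transform_within_open[of _ _ _ _ "- K"]) (use assms in auto)
  then show "partial_deriv i f x = 0" "f differentiable (at x)"
    by (auto simp: partial_deriv_eq differentiable_def)
qed

lemma laplacian_outside:
  assumes "closed K" "\<And>x. x \<notin> K \<Longrightarrow> f x = 0" "x \<notin> K"
  shows "laplacian f x = 0"
proof -
  have "partial_deriv i f x = 0" if "x \<notin> K" for i x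
    using partial_deriv_outside(1)[OF assms(1,2) that] .
  then show ?thesis
    unfolding laplacian_def using partial_deriv_outside(1)[OF assms(1) _ assms(3)]
    by (simp add: sum.neutral)
qed

text \<open>Near a point outside \<open>K\<close> the function vanishes identically. Extension by zero thus turns all
  integrals over \<open>\<Omega>\<close> into integrals over the whole space, where translations and integration by
  parts have no boundary terms.\<close>

lemma Ck_on_extend:
  assumes "Ck_on k \<Omega> f" "open \<Omega>" "closed K" "K \<subseteq> \<Omega>" "\<And>x. x \<notin> K \<Longrightarrow> f x = 0"
  shows "Ck_on k UNIV f"
  using assms(1,5)
proof (induction k arbitrary: f)
  case 0
  have "continuous_on (\<Omega> \<union> - K) f"
    by (intro continuous_on_open_Un assms(2) open_Compl assms(3))
       (use 0 in \<open>auto intro: continuous_on_eq[of _ "\<lambda>x. 0"]\<close>)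
  moreover have "\<Omega> \<union> - K = UNIV" using assms(4) by auto
  ultimately show ?case by simp
next
  case (Suc k)
  have "f differentiable (at x)" for x
  proof (cases "x \<in> K")
    case True
    then show ?thesis using Suc.prems(1) assms(4) by auto
  next
    case False
    show ?thesis using partial_deriv_outside(2)[where f=f, OF assms(3) Suc.prems(2) False] by simp
  qed
  moreover have "Ck_on k UNIV (partial_deriv i f)" if "i \<in> Basis" for i
    using Suc.prems(1) that partial_deriv_outside(1)[where f=f, OF assms(3) Suc.prems(2)]
    by (intro Suc.IH) auto
  ultimately show ?case by simp
qed

lemma C2_0_D:
  assumes "f \<in> C2_0 \<Omega>" "open \<Omega>"
  shows "Ck_on 2 UNIV f" "\<exists>K. compact K \<and> K \<subseteq> \<Omega> \<and> (\<forall>x. x \<notin> K \<longrightarrow> f x = 0)"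
proof -
  have K: "compact (closure {x. f x \<noteq> 0})" "closure {x. f x \<noteq> 0} \<subseteq> \<Omega>" "Ck_on 2 \<Omega> f"
    using assms(1) unfolding C2_0_def compactly_supported_in_def by blast+
  have 0: "f x = 0" if "x \<notin> closure {x. f x \<noteq> 0}" for x
    using that closure_subset[of "{x. f x \<noteq> 0}"] by auto
  show "Ck_on 2 UNIV f"
    by (rule Ck_on_extend[OF K(3) assms(2) closed_closure K(2)]) (rule 0)
  show "\<exists>K. compact K \<and> K \<subseteq> \<Omega> \<and> (\<forall>x. x \<notin> K \<longrightarrow> f x = 0)"
    by (intro exI[of _ "closure {x. f x \<noteq> 0}"] conjI K allI impI 0)
qed

lemma C2_0_I:
  assumes "Ck_on 2 UNIV f" "compact K" "K \<subseteq> \<Omega>" "\<And>x. x \<notin> K \<Longrightarrow> f x = 0"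
  shows "f \<in> C2_0 \<Omega>"
proof -
  have *: "closure {x. f x \<noteq> 0} \<subseteq> K"
    using assms(2,4) by (intro closure_minimal) (auto intro: compact_imp_closed)
  then have "K \<inter> closure {x. f x \<noteq> 0} = closure {x. f x \<noteq> 0}" by blast
  then have "compact (closure {x. f x \<noteq> 0})"
    using compact_Int_closed[OF assms(2) closed_closure[of "{x. f x \<noteq> 0}"]] by simp
  then show ?thesis
    using assms(1,3) * Ck_on_subset[OF assms(1), of \<Omega>]
    unfolding C2_0_def compactly_supported_in_def by blast
qed

section \<open>Integration by parts, energy and Poincare estimates\<close>

lemma continuous_cc_bounded:
  fixes f :: "'a::euclidean_space \<Rightarrow> real"
  assumes "continuous_on UNIV f" "compact K" "\<And>x. x \<notin> K \<Longrightarrow> f x = 0"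
  shows "\<exists>B>0. \<forall>x. \<bar>f x\<bar> \<le> B"
proof -
  have "compact (f ` K)"
    using assms by (intro compact_continuous_image) (auto intro: continuous_on_subset)
  then have "bounded (f ` K)" by (rule compact_imp_bounded)
  then obtain B where B: "B > 0" "\<And>x. x \<in> K \<Longrightarrow> \<bar>f x\<bar> \<le> B"
    by (auto simp: bounded_pos)
  then have "\<bar>f x\<bar> \<le> B" for x using assms(3)[of x] by (cases "x \<in> K") auto
  with B(1) show ?thesis by blast
qed

lemma integrable_cc:
  fixes f :: "'a::euclidean_space \<Rightarrow> real"
  assumes "continuous_on UNIV f" "compact K" "\<And>x. x \<notin> K \<Longrightarrow> f x = 0"
  shows "integrable lborel f"
proof -
  have "integrable lborel (\<lambda>x. indicator K x *\<^sub>R f x)"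
    using assms by (intro borel_integrable_compact) (auto intro: continuous_on_subset)
  moreover have "(\<lambda>x. indicator K x *\<^sub>R f x) = f"
    using assms(3) by (intro ext) (auto simp: indicator_def)
  ultimately show ?thesis by simp
qed

lemma lborel_integral_translation:
  fixes f :: "'a::euclidean_space \<Rightarrow> real"
  assumes [measurable]: "f \<in> borel_measurable borel"
  shows "(LBINT x. f (x + a)) = (LBINT x. f x)"
proof -
  have "(LBINT x. f x) = (\<integral>x. f x \<partial>(distr lborel borel ((+) a)))"
    by (simp add: lborel_distr_plus)
  also have "\<dots> = (LBINT x. f (x + a))"
    by (subst integral_distr) (auto simp: add.commute)
  finally show ?thesis by simp
qed

text \<open>Difference quotients of \<open>F\<close> have integral zero by translation invariance, and they converge to the
  partial derivative while staying bounded on a common bounded set.\<close>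

lemma integral_partial_deriv_eq_0:
  fixes F :: "'a::euclidean_space \<Rightarrow> real"
  assumes F: "Ck_on 1 UNIV F" and K: "compact K" "\<And>x. x \<notin> K \<Longrightarrow> F x = 0" and i: "i \<in> Basis"
  shows "(LBINT x. partial_deriv i F x) = 0"
proof -
  have d: "F differentiable (at x)" for x using F by auto
  have cF: "continuous_on UNIV F" by (rule Ck_on_imp_continuous[OF F])
  have cD: "continuous_on UNIV (partial_deriv i F)" using F i by auto
  have D0: "partial_deriv i F x = 0" if "x \<notin> K" for x
    using partial_deriv_outside(1)[OF compact_imp_closed[OF K(1)] K(2) that] .
  obtain B where B: "B > 0" "\<And>x. \<bar>partial_deriv i F x\<bar> \<le> B"
    using continuous_cc_bounded[OF cD K(1) D0] by blast
  obtain R where R: "\<And>x. x \<in> K \<Longrightarrow> norm x \<le> R"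
    using compact_imp_bounded[OF K(1)] by (auto simp: bounded_iff)
  define D where "D n x = (F (x + (1 / Suc n) *\<^sub>R i) - F x) * Suc n" for n x
  have line: "((\<lambda>t. F (x + t *\<^sub>R i)) has_real_derivative partial_deriv i F (x + t *\<^sub>R i)) (at t)" for x t
  proof -
    have F': "(F has_derivative frechet_derivative F (at (x + t *\<^sub>R i))) (at (x + t *\<^sub>R i))"
      using d frechet_derivative_works by blast
    have "((\<lambda>t. F (x + t *\<^sub>R i)) has_derivative (\<lambda>h. frechet_derivative F (at (x + t *\<^sub>R i)) (h *\<^sub>R i))) (at t)"
      by (rule has_derivative_compose[where g=F and f="\<lambda>t. x + t *\<^sub>R i", OF _ F']) (auto intro!: derivative_eq_intros)
    then show ?thesis
      unfolding has_field_derivative_def partial_deriv_def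
      by (rule has_derivative_eq_rhs)
        (auto simp: linear_cmul[OF has_derivative_linear[OF F']])
  qed
  have mD: "D n \<in> borel_measurable borel" for n
    unfolding D_def by (intro borel_measurable_continuous_onI continuous_intros
        continuous_on_compose2[OF cF]) auto
  have bD: "\<bar>D n x\<bar> \<le> B" for n x
  proof -
    let ?t = "1 / real (Suc n)"
    have "\<exists>z. 0 < z \<and> z < ?t \<and> F (x + ?t *\<^sub>R i) - F (x + 0 *\<^sub>R i) = (?t - 0) * partial_deriv i F (x + z *\<^sub>R i)"
      by (rule MVT2) (use line in auto)
    then obtain z where "F (x + ?t *\<^sub>R i) - F x = ?t * partial_deriv i F (x + z *\<^sub>R i)" by auto
    then have "D n x = partial_deriv i F (x + z *\<^sub>R i)"
      unfolding D_def by simp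
    then show ?thesis using B(2) by simp
  qed
  have zD: "D n x = 0" if "x \<notin> cball 0 (R + 1)" for n x
  proof -
    have "x \<notin> K" using R[of x] that by force
    moreover have "x + (1 / Suc n) *\<^sub>R i \<notin> K"
    proof
      assume "x + (1 / Suc n) *\<^sub>R i \<in> K"
      from R[OF this] have "norm (x + (1 / Suc n) *\<^sub>R i) \<le> R" .
      moreover have "norm ((1 / Suc n) *\<^sub>R i) \<le> 1" using i by simp
      moreover have "norm x \<le> norm (x + (1 / Suc n) *\<^sub>R i) + norm ((1 / Suc n) *\<^sub>R i)"
        by (metis add_diff_cancel_right' norm_triangle_ineq4)
      moreover have "norm x > R + 1" using that by simp
      ultimately show False by linarith
    qed
    ultimately show ?thesis unfolding D_def using K(2) by auto
  qed
  have lim: "(\<lambda>n. D n x) \<longlonglongrightarrow> partial_deriv i F x" for x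
  proof -
    have "((\<lambda>h. (F (x + h *\<^sub>R i) - F (x + 0 *\<^sub>R i)) / h) \<longlongrightarrow> partial_deriv i F (x + 0 *\<^sub>R i)) (at 0)"
      using line[of x 0] by (simp add: DERIV_def)
    then have "((\<lambda>h. (F (x + h *\<^sub>R i) - F x) / h) \<longlongrightarrow> partial_deriv i F x) (at 0)" by simp
    moreover have "filterlim (\<lambda>n. 1 / real (Suc n)) (at 0) sequentially"
      unfolding filterlim_at using LIMSEQ_inverse_real_of_nat by (simp add: divide_inverse del: of_nat_Suc)
    ultimately have "(\<lambda>n. (F (x + (1 / Suc n) *\<^sub>R i) - F x) / (1 / real (Suc n))) \<longlonglongrightarrow> partial_deriv i F x"
      by (rule filterlim_compose)
    then show ?thesis by (simp add: D_def)
  qed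
  have "(\<lambda>n. \<integral>x. D n x \<partial>lborel) \<longlonglongrightarrow> (LBINT x. partial_deriv i F x)"
  proof (rule integral_dominated_convergence)
    show "integrable lborel (\<lambda>x::'a. indicator (cball 0 (R + 1)) x * B)"
      by (intro integrable_mult_left) (auto intro!: emeasure_lborel_cball_finite)
    show "AE x in lborel. norm (D n x) \<le> indicator (cball 0 (R + 1)) x * B" for n
      using bD[of n] zD[of _ n] by (intro AE_I2) (auto simp: indicator_def)
  qed (use lim mD cD in \<open>auto intro: borel_measurable_continuous_onI\<close>)
  moreover have "(LBINT x. D n x) = 0" for n
  proof -
    have mF: "F \<in> borel_measurable borel" using cF by (rule borel_measurable_continuous_onI)
    have iF: "integrable lborel F" by (rule integrable_cc[OF cF K])
    let ?a = "(1 / Suc n) *\<^sub>R i"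
    have "integrable lborel (\<lambda>x. F (x + ?a))"
    proof (rule integrable_cc)
      show "continuous_on UNIV (\<lambda>x. F (x + ?a))"
        by (intro continuous_on_compose2[OF cF] continuous_intros) auto
      show "compact ((\<lambda>x. x - ?a) ` K)"
        by (intro compact_continuous_image continuous_intros K)
      show "F (x + ?a) = 0" if "x \<notin> (\<lambda>x. x - ?a) ` K" for x
        using that by (intro K(2)) (force simp: image_iff)
    qed
    then show ?thesis
      unfolding D_def using lborel_integral_translation[OF mF, of ?a] iF by simp
  qed
  ultimately show ?thesis by (simp add: LIMSEQ_const_iff)
qed

lemma integration_by_parts_cc:
  fixes f g :: "'a::euclidean_space \<Rightarrow> real"
  assumes f: "Ck_on 1 UNIV f" and g: "Ck_on 1 UNIV g" and i: "i \<in> Basis"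
    and K: "compact K" "\<And>x. x \<notin> K \<Longrightarrow> g x = 0"
  shows "(LBINT x. f x * partial_deriv i g x) = - (LBINT x. partial_deriv i f x * g x)"
proof -
  have d: "f differentiable (at x)" "g differentiable (at x)" for x
    using f g by auto
  have c: "continuous_on UNIV f" "continuous_on UNIV g"
    "continuous_on UNIV (partial_deriv i f)" "continuous_on UNIV (partial_deriv i g)"
    using f g i Ck_on_imp_continuous[OF f] Ck_on_imp_continuous[OF g] by auto
  have g0: "partial_deriv i g x = 0" if "x \<notin> K" for x
    using partial_deriv_outside(1)[OF compact_imp_closed[OF K(1)] K(2) that] .
  have "0 = (LBINT x. partial_deriv i (\<lambda>x. f x * g x) x)"
    using integral_partial_deriv_eq_0[OF Ck_on_1_mult[OF f g] K(1) _ i] K(2) by simp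
  also have "\<dots> = (LBINT x. f x * partial_deriv i g x + partial_deriv i f x * g x)"
    using partial_deriv_mult[OF d] by simp
  also have "\<dots> = (LBINT x. f x * partial_deriv i g x) + (LBINT x. partial_deriv i f x * g x)"
    by (intro Bochner_Integration.integral_add integrable_cc[OF _ K(1)] continuous_intros c) (use g0 K(2) in auto)
  finally show ?thesis by simp
qed

lemma Green_identity:
  fixes f g :: "'a::euclidean_space \<Rightarrow> real"
  assumes f: "Ck_on 2 UNIV f" and g: "Ck_on 2 UNIV g"
    and K: "compact K" "\<And>x. x \<notin> K \<Longrightarrow> g x = 0"
  shows "(LBINT x. f x * laplacian g x) = - (\<Sum>i\<in>Basis. \<integral>x. partial_deriv i f x * partial_deriv i g x \<partial>lborel)"
    and "(LBINT x. f x * laplacian g x) = (LBINT x. laplacian f x * g x)"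
proof -
  have f1: "Ck_on 1 UNIV f" and g1: "Ck_on 1 UNIV g" using f g by (auto intro: Ck_on_2_1 simp del: One_nat_def)
  have pf: "Ck_on 1 UNIV (partial_deriv i f)" and pg: "Ck_on 1 UNIV (partial_deriv i g)" if "i \<in> Basis" for i
    using f g that unfolding Ck_on_2_iff by auto
  note cont = Ck_on_imp_continuous[OF f] Ck_on_imp_continuous[OF g]
    Ck_on_imp_continuous[OF pf] Ck_on_imp_continuous[OF pg]
  have c2: "continuous_on UNIV (partial_deriv i (partial_deriv i f))"
    "continuous_on UNIV (partial_deriv i (partial_deriv i g))" if "i \<in> Basis" for i
    using pf[OF that] pg[OF that] that by auto
  have g0: "partial_deriv i g x = 0" if "x \<notin> K" for x i
    using partial_deriv_outside(1)[OF compact_imp_closed[OF K(1)] K(2) that] .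
  have g00: "partial_deriv i (partial_deriv i g) x = 0" if "x \<notin> K" for x i
    using partial_deriv_outside(1)[OF compact_imp_closed[OF K(1)] g0 that] .
  have "(LBINT x. f x * laplacian g x) = (\<Sum>i\<in>Basis. \<integral>x. f x * partial_deriv i (partial_deriv i g) x \<partial>lborel)"
    unfolding laplacian_def sum_distrib_left
    by (intro Bochner_Integration.integral_sum integrable_cc[OF _ K(1)] continuous_intros cont c2) (use g00 in auto)
  also have e: "(LBINT x. f x * partial_deriv i (partial_deriv i g) x) =
      - (LBINT x. partial_deriv i f x * partial_deriv i g x)" if "i \<in> Basis" for i
    using that by (intro integration_by_parts_cc[OF f1 pg _ K(1)] g0)
  then have "(\<Sum>i\<in>Basis. \<integral>x. f x * partial_deriv i (partial_deriv i g) x \<partial>lborel) =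
      (\<Sum>i\<in>Basis. - (LBINT x. partial_deriv i f x * partial_deriv i g x))"
    by (intro sum.cong) auto
  finally show *: "(LBINT x. f x * laplacian g x) = - (\<Sum>i\<in>Basis. \<integral>x. partial_deriv i f x * partial_deriv i g x \<partial>lborel)"
    by (simp add: sum_negf)
  have "(LBINT x. laplacian f x * g x) = (\<Sum>i\<in>Basis. \<integral>x. partial_deriv i (partial_deriv i f) x * g x \<partial>lborel)"
    unfolding laplacian_def sum_distrib_right
    by (intro Bochner_Integration.integral_sum integrable_cc[OF _ K(1)] continuous_intros cont c2) (use K(2) in auto)
  also have "\<dots> = (\<Sum>i\<in>Basis. - (LBINT x. partial_deriv i f x * partial_deriv i g x))"
    using integration_by_parts_cc[OF pf g1 _ K] by (intro sum.cong) auto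
  finally show "(LBINT x. f x * laplacian g x) = (LBINT x. laplacian f x * g x)"
    unfolding * by (simp add: sum_negf)
qed

text \<open>Green's identity with \<open>0 \<le> \<eta> \<le> 1\<close>. It upgrades smallness of the Laplacian in \<open>L^1\<close>, the only
  information the capacity gives at once, to smallness of the gradient in \<open>L^2\<close>.\<close>

lemma energy_le:
  fixes \<eta> :: "'a::euclidean_space \<Rightarrow> real"
  assumes \<eta>: "Ck_on 2 UNIV \<eta>" and K: "compact K" "\<And>x. x \<notin> K \<Longrightarrow> \<eta> x = 0"
    and b: "\<And>x. 0 \<le> \<eta> x" "\<And>x. \<eta> x \<le> 1"
  shows "(\<Sum>i\<in>Basis. \<integral>x. (partial_deriv i \<eta> x)\<^sup>2 \<partial>lborel) \<le> (LBINT x. \<bar>laplacian \<eta> x\<bar>)"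
proof -
  have l0: "laplacian \<eta> x = 0" if "x \<notin> K" for x
    using laplacian_outside[where f=\<eta>, OF compact_imp_closed[OF K(1)] K(2) that] .
  note c = continuous_on_laplacian[OF \<eta>] Ck_on_imp_continuous[OF \<eta>]
  have "(\<Sum>i\<in>Basis. \<integral>x. (partial_deriv i \<eta> x)\<^sup>2 \<partial>lborel) = (LBINT x. - (\<eta> x * laplacian \<eta> x))"
    using Green_identity(1)[OF \<eta> \<eta> K] by (simp add: power2_eq_square)
  also have "\<dots> \<le> (LBINT x. \<bar>laplacian \<eta> x\<bar>)"
  proof (rule integral_mono)
    show "integrable lborel (\<lambda>x. - (\<eta> x * laplacian \<eta> x))" "integrable lborel (\<lambda>x. \<bar>laplacian \<eta> x\<bar>)"
      by (intro integrable_cc[OF _ K(1)] continuous_intros c; simp add: l0)+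
    show "- (\<eta> x * laplacian \<eta> x) \<le> \<bar>laplacian \<eta> x\<bar>" for x
    proof -
      have "- (\<eta> x * laplacian \<eta> x) \<le> \<bar>\<eta> x * laplacian \<eta> x\<bar>" by linarith
      also have "\<dots> = \<eta> x * \<bar>laplacian \<eta> x\<bar>" using b by (simp add: abs_mult)
      also have "\<dots> \<le> 1 * \<bar>laplacian \<eta> x\<bar>" by (intro mult_right_mono b) auto
      finally show ?thesis by simp
    qed
  qed
  finally show ?thesis .
qed

text \<open>Integrating the partial derivative of \<open>(x \<bullet> i) * (\<eta> x)\<^sup>2\<close> expresses \<open>\<integral> \<eta>\<^sup>2\<close> through
  \<open>(x \<bullet> i) * \<eta> x\<close> times the derivative of \<open>\<eta>\<close>; half of \<open>\<integral> \<eta>\<^sup>2\<close> is absorbed by the inequality of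
  arithmetic and geometric means.\<close>

lemma Poincare:
  fixes \<eta> :: "'a::euclidean_space \<Rightarrow> real"
  assumes \<eta>: "Ck_on 1 UNIV \<eta>" and K: "compact K" "\<And>x. x \<notin> K \<Longrightarrow> \<eta> x = 0"
    and i: "i \<in> Basis" and R: "\<And>x. x \<in> K \<Longrightarrow> norm x \<le> R" and "0 \<le> R"
  shows "(LBINT x. (\<eta> x)\<^sup>2) \<le> 4 * R\<^sup>2 * (LBINT x. (partial_deriv i \<eta> x)\<^sup>2)"
proof -
  have d: "\<eta> differentiable (at x)" for x using \<eta> by auto
  have c: "continuous_on UNIV \<eta>" "continuous_on UNIV (partial_deriv i \<eta>)"
    using \<eta> i Ck_on_imp_continuous[OF \<eta>] by auto
  have p0: "partial_deriv i \<eta> x = 0" if "x \<notin> K" for x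
    using partial_deriv_outside(1)[where f=\<eta>, OF compact_imp_closed[OF K(1)] K(2) that] .
  have ider: "((\<lambda>x. x \<bullet> i) has_derivative (\<lambda>h. h \<bullet> i)) (at x)" for x
    by (auto intro!: derivative_eq_intros)
  have pi: "partial_deriv j (\<lambda>x. x \<bullet> i) x = j \<bullet> i" for j x
    using partial_deriv_eq[OF ider] .
  have "partial_deriv j (\<lambda>x. x \<bullet> i) = (\<lambda>x. j \<bullet> i)" for j
    using pi by auto
  then have "Ck_on 1 UNIV (\<lambda>x. x \<bullet> i)"
    using ider by (auto simp: differentiable_def)
  from Ck_on_1_mult[OF this Ck_on_1_mult[OF \<eta> \<eta>]]
  have C: "Ck_on 1 UNIV (\<lambda>x. (x \<bullet> i) * (\<eta> x * \<eta> x))" .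
  have "partial_deriv i (\<lambda>x. (x \<bullet> i) * (\<eta> x * \<eta> x)) x = (\<eta> x)\<^sup>2 + 2 * ((x \<bullet> i) * \<eta> x * partial_deriv i \<eta> x)" for x
  proof -
    have "(\<lambda>x. x \<bullet> i) differentiable (at x)" "(\<lambda>x. \<eta> x * \<eta> x) differentiable (at x)"
      using ider differentiable_mult[OF d d] by (auto simp: differentiable_def)
    from partial_deriv_mult[OF this] show ?thesis
      using i by (simp add: partial_deriv_mult[OF d d] pi power2_eq_square algebra_simps)
  qed
  then have "0 = (LBINT x. (\<eta> x)\<^sup>2 + 2 * ((x \<bullet> i) * \<eta> x * partial_deriv i \<eta> x))"
    using integral_partial_deriv_eq_0[OF C K(1) _ i] K(2) by simp
  also have "\<dots> \<ge> (LBINT x. (\<eta> x)\<^sup>2 - ((\<eta> x)\<^sup>2 / 2 + 2 * R\<^sup>2 * (partial_deriv i \<eta> x)\<^sup>2))"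
  proof (rule integral_mono)
    show "integrable lborel (\<lambda>x. (\<eta> x)\<^sup>2 - ((\<eta> x)\<^sup>2 / 2 + 2 * R\<^sup>2 * (partial_deriv i \<eta> x)\<^sup>2))"
      "integrable lborel (\<lambda>x. (\<eta> x)\<^sup>2 + 2 * ((x \<bullet> i) * \<eta> x * partial_deriv i \<eta> x))"
      by (intro integrable_cc[OF _ K(1)] continuous_intros c; simp add: p0 K(2))+
    show "(\<eta> x)\<^sup>2 - ((\<eta> x)\<^sup>2 / 2 + 2 * R\<^sup>2 * (partial_deriv i \<eta> x)\<^sup>2) \<le>
      (\<eta> x)\<^sup>2 + 2 * ((x \<bullet> i) * \<eta> x * partial_deriv i \<eta> x)" for x
    proof (cases "x \<in> K")
      case True
      let ?a = "\<eta> x" and ?p = "(x \<bullet> i) * partial_deriv i \<eta> x"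
      have "\<bar>x \<bullet> i\<bar> \<le> R" using Basis_le_norm[OF i, of x] R[OF True] by linarith
      then have "(x \<bullet> i)\<^sup>2 \<le> R\<^sup>2" by (metis abs_ge_zero power2_abs power_mono)
      then have "(x \<bullet> i)\<^sup>2 * (partial_deriv i \<eta> x)\<^sup>2 \<le> R\<^sup>2 * (partial_deriv i \<eta> x)\<^sup>2"
        by (rule mult_right_mono) simp
      moreover have "0 \<le> (?a + 2 * ?p)\<^sup>2" by simp
      ultimately show ?thesis
        by (simp add: power2_eq_square algebra_simps)
    qed (simp add: K(2) p0)
  qed
  also have "(LBINT x. (\<eta> x)\<^sup>2 - ((\<eta> x)\<^sup>2 / 2 + 2 * R\<^sup>2 * (partial_deriv i \<eta> x)\<^sup>2)) =
     (LBINT x. (\<eta> x)\<^sup>2 / 2 - 2 * R\<^sup>2 * (partial_deriv i \<eta> x)\<^sup>2)"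
    by (rule Bochner_Integration.integral_cong) auto
  also have "\<dots> = (LBINT x. (\<eta> x)\<^sup>2 / 2) - (LBINT x. 2 * R\<^sup>2 * (partial_deriv i \<eta> x)\<^sup>2)"
    by (intro Bochner_Integration.integral_diff integrable_cc[OF _ K(1)] continuous_intros c; simp add: p0 K(2))
  finally show ?thesis by simp
qed

section \<open>Convolution with a compactly supported kernel\<close>

lemma uniformly_continuous_cc:
  fixes g :: "'a::euclidean_space \<Rightarrow> real"
  assumes "continuous_on UNIV g" "compact K" "\<And>x. x \<notin> K \<Longrightarrow> g x = 0"
  shows "uniformly_continuous_on UNIV g"
  unfolding uniformly_continuous_on_def
proof (intro allI impI)
  fix e :: real assume e: "e > 0"
  obtain R where R: "\<And>x. x \<in> K \<Longrightarrow> norm x \<le> R"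
    using compact_imp_bounded[OF assms(2)] by (auto simp: bounded_iff)
  have "uniformly_continuous_on (cball 0 (R + 1)) g"
    by (intro compact_uniformly_continuous continuous_on_subset[OF assms(1)]) auto
  then obtain d where d: "d > 0" "\<And>x y. x \<in> cball 0 (R+1) \<Longrightarrow> y \<in> cball 0 (R+1) \<Longrightarrow> dist y x < d \<Longrightarrow> dist (g y) (g x) < e"
    using e unfolding uniformly_continuous_on_def by meson
  show "\<exists>d>0. \<forall>x\<in>UNIV. \<forall>y\<in>UNIV. dist y x < d \<longrightarrow> dist (g y) (g x) < e"
  proof (intro exI[of _ "min d 1"] conjI ballI impI)
    fix x y :: 'a assume xy: "dist y x < min d 1"
    show "dist (g y) (g x) < e"
    proof (cases "x \<in> K \<or> y \<in> K")
      case True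
      have "norm x \<le> norm y + dist y x" "norm y \<le> norm x + dist y x"
        by (simp_all add: dist_norm norm_triangle_sub norm_minus_commute) (metis norm_minus_commute norm_triangle_sub)
      then have "x \<in> cball 0 (R+1)" "y \<in> cball 0 (R+1)"
        using True R[of x] R[of y] xy by auto
      then show ?thesis using d(2) xy by auto
    qed (use assms(3) e in auto)
  qed (use d in auto)
qed

lemma integrable_mult_bounded:
  fixes v g :: "'a \<Rightarrow> real"
  assumes "integrable M v" "g \<in> borel_measurable M" "\<And>x. \<bar>g x\<bar> \<le> B"
  shows "integrable M (\<lambda>x. v x * g x)"
proof (rule Bochner_Integration.integrable_bound[where f="\<lambda>x. v x * B"])
  show "AE x in M. norm (v x * g x) \<le> norm (v x * B)"
  proof (intro AE_I2)
    fix x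
    have "\<bar>v x\<bar> * \<bar>g x\<bar> \<le> \<bar>v x\<bar> * \<bar>B\<bar>"
      using assms(3)[of x] by (intro mult_left_mono) auto
    then show "norm (v x * g x) \<le> norm (v x * B)" by (simp add: abs_mult)
  qed
qed (use assms in auto)

definition conv :: "('a::euclidean_space \<Rightarrow> real) \<Rightarrow> ('a \<Rightarrow> real) \<Rightarrow> 'a \<Rightarrow> real" where
  "conv v k x = (LBINT y. v y * k (x - y))"

lemma conv_integrand_integrable:
  fixes v k :: "'a::euclidean_space \<Rightarrow> real"
  assumes "integrable lborel v" "continuous_on UNIV k" "compact K" "\<And>x. x \<notin> K \<Longrightarrow> k x = 0"
  shows "integrable lborel (\<lambda>y. v y * k (x - y))"
proof -
  obtain B where "\<forall>x. \<bar>k x\<bar> \<le> B"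
    using continuous_cc_bounded[OF assms(2-4)] by blast
  then show ?thesis
    by (intro integrable_mult_bounded[OF assms(1), where B=B] borel_measurable_continuous_onI
         continuous_on_compose2[OF assms(2)] continuous_intros)
       (auto intro!: borel_measurable_continuous_onI continuous_on_compose2[OF assms(2)] continuous_intros)
qed

lemma conv_error_le:
  fixes v :: "'a::euclidean_space \<Rightarrow> real"
  assumes v: "integrable lborel v" and r: "\<And>y. \<bar>r y\<bar> \<le> e" and m: "r \<in> borel_measurable borel"
  shows "\<bar>\<integral>y. v y * r y \<partial>lborel\<bar> \<le> e * (LBINT y. \<bar>v y\<bar>)"
proof -
  have "\<bar>\<integral>y. v y * r y \<partial>lborel\<bar> \<le> (LBINT y. \<bar>v y * r y\<bar>)"
    by (rule integral_abs_bound)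
  also have "\<dots> \<le> (LBINT y. e * \<bar>v y\<bar>)"
  proof (rule integral_mono)
    show "integrable lborel (\<lambda>y. \<bar>v y * r y\<bar>)"
      using integrable_mult_bounded[OF v, of r e] m r by auto
    show "\<bar>v y * r y\<bar> \<le> e * \<bar>v y\<bar>" for y
      using mult_right_mono[OF r[of y], of "\<bar>v y\<bar>"] by (simp add: abs_mult mult.commute)
  qed (use v in auto)
  finally show ?thesis using v by simp
qed

lemma continuous_on_conv:
  fixes v k :: "'a::euclidean_space \<Rightarrow> real"
  assumes v: "integrable lborel v" and k: "continuous_on UNIV k" "compact K" "\<And>x. x \<notin> K \<Longrightarrow> k x = 0"
  shows "continuous_on UNIV (conv v k)"
proof -
  have u: "uniformly_continuous_on UNIV k" by (rule uniformly_continuous_cc[OF k])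
  have ii: "integrable lborel (\<lambda>y. v y * k (x - y))" for x
    by (rule conv_integrand_integrable[OF v k])
  define V where "V = (LBINT y. \<bar>v y\<bar>)"
  have V: "V \<ge> 0" unfolding V_def by simp
  have mk: "(\<lambda>y. k (x - y)) \<in> borel_measurable borel" for x
    by (intro borel_measurable_continuous_onI continuous_on_compose2[OF k(1)] continuous_intros) auto
  show ?thesis
    unfolding continuous_on_iff
  proof (intro ballI allI impI)
    fix x and e :: real assume e: "e > 0"
    have "e / (V + 1) > 0" using e V by simp
    then obtain d where d: "d > 0" "\<And>x y. dist y x < d \<Longrightarrow> dist (k y) (k x) < e / (V + 1)"
      using u unfolding uniformly_continuous_on_def by (metis UNIV_I)
    show "\<exists>d>0. \<forall>x'\<in>UNIV. dist x' x < d \<longrightarrow> dist (conv v k x') (conv v k x) < e"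
    proof (intro exI[of _ d] conjI ballI impI d(1))
      fix x' assume x': "dist x' x < d"
      have "conv v k x' - conv v k x = (LBINT y. v y * (k (x' - y) - k (x - y)))"
        unfolding conv_def
        by (subst Bochner_Integration.integral_diff[symmetric, OF ii ii])
          (intro Bochner_Integration.integral_cong refl right_diff_distrib[symmetric])
      moreover have "\<bar>\<integral>y. v y * (k (x' - y) - k (x - y)) \<partial>lborel\<bar> \<le> e / (V + 1) * V"
        unfolding V_def
      proof (rule conv_error_le[OF v], fold V_def)
        show "\<bar>k (x' - y) - k (x - y)\<bar> \<le> e / (V + 1)" for y
          using d(2)[of "x' - y" "x - y"] x' by (simp add: dist_norm)
      qed (use mk in auto)
      moreover have "e / (V + 1) * V < e"
        using e V by (simp add: field_simps)
      ultimately show "dist (conv v k x') (conv v k x) < e"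
        by (simp add: dist_norm)
    qed
  qed
qed

text \<open>The first-order Taylor error is uniform in the base point because the gradient is uniformly
  continuous. This allows differentiation under the convolution integral against a function that is
  merely integrable.\<close>

lemma uniform_differentiability:
  fixes k :: "'a::euclidean_space \<Rightarrow> real"
  assumes k: "Ck_on 1 UNIV k" "compact K" "\<And>x. x \<notin> K \<Longrightarrow> k x = 0" and e: "e > 0"
  shows "\<exists>d>0. \<forall>z h. norm h < d \<longrightarrow>
     \<bar>k (z + h) - k z - (\<Sum>i\<in>Basis. (h \<bullet> i) * partial_deriv i k z)\<bar> \<le> e * norm h"
proof -
  have dk: "k differentiable (at x)" for x using k(1) by auto
  have u: "uniformly_continuous_on UNIV (partial_deriv i k)" if "i \<in> Basis" for i
    by (rule uniformly_continuous_cc[OF continuous_on_partial[OF k(1)] k(2)])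
       (use that partial_deriv_outside(1)[where f=k, OF compact_imp_closed[OF k(2)] k(3)] in auto)
  have "\<forall>i\<in>Basis. \<exists>d>0. \<forall>x y. dist y x < d \<longrightarrow> dist (partial_deriv i k y) (partial_deriv i k x) < e / DIM('a)"
    using u e unfolding uniformly_continuous_on_def by simp
  then obtain d where d: "\<And>i. i \<in> Basis \<Longrightarrow> d i > 0"
    "\<And>i x y. i \<in> Basis \<Longrightarrow> dist y x < d i \<Longrightarrow> dist (partial_deriv i k y) (partial_deriv i k x) < e / DIM('a)"
    by metis
  define D where "D = Min (d ` Basis)"
  have D: "D > 0" "\<And>i. i \<in> Basis \<Longrightarrow> D \<le> d i"
    unfolding D_def using d(1) by (auto simp: Min_gr_iff)
  have "\<bar>k (z + h) - k z - (\<Sum>i\<in>Basis. (h \<bullet> i) * partial_deriv i k z)\<bar> \<le> e * norm h"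
    if h: "norm h < D" for z h
  proof -
    let ?g = "\<lambda>t. \<Sum>i\<in>Basis. (h \<bullet> i) * partial_deriv i k (z + t *\<^sub>R h)"
    have line: "((\<lambda>t. k (z + t *\<^sub>R h)) has_real_derivative ?g t) (at t)" for t
    proof -
      have "((\<lambda>t. k (z + t *\<^sub>R h)) has_derivative (\<lambda>s. \<Sum>i\<in>Basis. ((s *\<^sub>R h) \<bullet> i) * partial_deriv i k (z + t *\<^sub>R h))) (at t)"
        by (rule has_derivative_compose[where g=k and f="\<lambda>t. z + t *\<^sub>R h", OF _ has_derivative_partial[OF dk]])
           (auto intro!: derivative_eq_intros)
      then show ?thesis
        unfolding has_field_derivative_def
        by (rule has_derivative_eq_rhs) (auto simp: sum_distrib_left sum_distrib_right algebra_simps intro!: sum.cong)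
    qed
    have "\<exists>t. 0 < t \<and> t < 1 \<and> k (z + 1 *\<^sub>R h) - k (z + 0 *\<^sub>R h) = (1 - 0) * ?g t"
      by (rule MVT2) (use line in auto)
    then obtain t where t: "0 < t" "t < 1" "k (z + h) - k z = ?g t" by auto
    have "\<bar>k (z + h) - k z - (\<Sum>i\<in>Basis. (h \<bullet> i) * partial_deriv i k z)\<bar>
      = \<bar>\<Sum>i\<in>Basis. (h \<bullet> i) * (partial_deriv i k (z + t *\<^sub>R h) - partial_deriv i k z)\<bar>"
      unfolding t(3) by (simp add: sum_subtractf[symmetric] algebra_simps)
    also have "\<dots> \<le> (\<Sum>i\<in>Basis. \<bar>(h \<bullet> i) * (partial_deriv i k (z + t *\<^sub>R h) - partial_deriv i k z)\<bar>)"
      by (rule sum_abs)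
    also have "\<dots> \<le> (\<Sum>i\<in>(Basis::'a set). norm h * (e / DIM('a)))"
    proof (rule sum_mono)
      fix i :: 'a assume i: "i \<in> Basis"
      have "dist (z + t *\<^sub>R h) z < D"
        using h t mult_left_le_one_le[of "norm h" t] by (simp add: dist_norm)
      then have "\<bar>partial_deriv i k (z + t *\<^sub>R h) - partial_deriv i k z\<bar> \<le> e / DIM('a)"
        using d(2)[OF i, of "z + t *\<^sub>R h" z] D(2)[OF i] by (simp add: dist_real_def)
      then show "\<bar>(h \<bullet> i) * (partial_deriv i k (z + t *\<^sub>R h) - partial_deriv i k z)\<bar> \<le> norm h * (e / DIM('a))"
        unfolding abs_mult using Basis_le_norm[OF i, of h] by (intro mult_mono) auto
    qed
    also have "\<dots> = e * norm h" by simp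
    finally show ?thesis .
  qed
  with D(1) show ?thesis by blast
qed

lemma conv_C1:
  fixes v k :: "'a::euclidean_space \<Rightarrow> real"
  assumes v: "integrable lborel v" and k: "Ck_on 1 UNIV k" "compact K" "\<And>x. x \<notin> K \<Longrightarrow> k x = 0"
  shows "conv v k differentiable (at x)"
    and "i \<in> Basis \<Longrightarrow> partial_deriv i (conv v k) x = conv v (partial_deriv i k) x"
proof -
  have ck: "continuous_on UNIV k" by (rule Ck_on_imp_continuous[OF k(1)])
  have cp: "continuous_on UNIV (partial_deriv i k)" if "i \<in> Basis" for i
    using k(1) that by auto
  have p0: "partial_deriv i k x = 0" if "x \<notin> K" for x i
    using partial_deriv_outside(1)[where f=k, OF compact_imp_closed[OF k(2)] k(3) that] .
  note ii = conv_integrand_integrable[OF v ck k(2,3)] conv_integrand_integrable[OF v cp k(2) p0]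
  have mk: "(\<lambda>y. g (x - y)) \<in> borel_measurable borel" if "continuous_on UNIV g" for x and g :: "'a \<Rightarrow> real"
    by (intro borel_measurable_continuous_onI continuous_on_compose2[OF that] continuous_intros) auto
  define V where "V = (LBINT y. \<bar>v y\<bar>)"
  have V: "V \<ge> 0" unfolding V_def by simp
  let ?D = "\<lambda>h. \<Sum>i\<in>Basis. (h \<bullet> i) * conv v (partial_deriv i k) x"
  have D: "(conv v k has_derivative ?D) (at x)"
    unfolding has_derivative_at_alt
  proof (intro conjI allI impI)
    show "bounded_linear ?D"
      by (intro bounded_linear_sum bounded_linear_mult_const bounded_linear_inner_left)
    fix e :: real assume e: "e > 0"
    have e': "e / (V + 1) > 0" using e V by simp
    obtain d where d: "d > 0" "\<And>z h. norm h < d \<Longrightarrow>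
       \<bar>k (z + h) - k z - (\<Sum>i\<in>Basis. (h \<bullet> i) * partial_deriv i k z)\<bar> \<le> e / (V + 1) * norm h"
      using uniform_differentiability[OF k e'] by blast
    show "\<exists>d>0. \<forall>y. norm (y - x) < d \<longrightarrow> norm (conv v k y - conv v k x - ?D (y - x)) \<le> e * norm (y - x)"
    proof (intro exI[of _ d] conjI allI impI d(1))
      fix x' assume x': "norm (x' - x) < d"
      let ?r = "\<lambda>y. k (x' - y) - k (x - y) - (\<Sum>i\<in>Basis. ((x' - x) \<bullet> i) * partial_deriv i k (x - y))"
      have "conv v k x' - conv v k x - ?D (x' - x) = (LBINT y. v y * k (x' - y)) - (LBINT y. v y * k (x - y))
         - (LBINT y. (\<Sum>i\<in>Basis. ((x' - x) \<bullet> i) * (v y * partial_deriv i k (x - y))))"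
        unfolding conv_def using ii(2)
        by (subst Bochner_Integration.integral_sum) auto
      also have "\<dots> = (LBINT y. v y * ?r y)"
        using ii
        by (subst Bochner_Integration.integral_diff[symmetric], simp, simp,
            subst Bochner_Integration.integral_diff[symmetric], simp, intro Bochner_Integration.integrable_sum, simp)
          (simp add: algebra_simps sum_distrib_left)
      finally have *: "conv v k x' - conv v k x - ?D (x' - x) = (LBINT y. v y * ?r y)" .
      have "\<bar>\<integral>y. v y * ?r y \<partial>lborel\<bar> \<le> (e / (V + 1) * norm (x' - x)) * V"
        unfolding V_def
      proof (rule conv_error_le[OF v], fold V_def)
        show "\<bar>?r y\<bar> \<le> e / (V + 1) * norm (x' - x)" for y
          using d(2)[OF x', of "x - y"] by (simp add: algebra_simps)
        show "?r \<in> borel_measurable borel"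
          by (intro borel_measurable_diff borel_measurable_sum borel_measurable_times mk ck cp) auto
      qed
      also have "\<dots> \<le> e * norm (x' - x)"
      proof -
        have "e / (V + 1) * V \<le> e" using e V by (simp add: field_simps)
        from mult_right_mono[OF this norm_ge_zero[of "x' - x"]] show ?thesis by (simp add: mult_ac)
      qed
      finally show "norm (conv v k x' - conv v k x - ?D (x' - x)) \<le> e * norm (x' - x)"
        using * by simp
    qed
  qed
  then show "conv v k differentiable (at x)" by (auto simp: differentiable_def)
  show "partial_deriv i (conv v k) x = conv v (partial_deriv i k) x" if i: "i \<in> Basis"
    using partial_deriv_eq[OF D, of i] i by (simp add: inner_Basis if_distrib if_distribR cong: if_cong)
qed

lemma conv_C2:
  fixes v k :: "'a::euclidean_space \<Rightarrow> real"
  assumes v: "integrable lborel v" and k: "Ck_on 2 UNIV k" "compact K" "\<And>x. x \<notin> K \<Longrightarrow> k x = 0"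
  shows "Ck_on 2 UNIV (conv v k)" and "laplacian (conv v k) x = conv v (laplacian k) x"
proof -
  have k1: "Ck_on 1 UNIV k" by (rule Ck_on_2_1[OF k(1)])
  have pk: "Ck_on 1 UNIV (partial_deriv i k)" if "i \<in> Basis" for i
    using k(1) that unfolding Ck_on_2_iff by blast
  have p0: "partial_deriv i k x = 0" if "x \<notin> K" for x i
    using partial_deriv_outside(1)[where f=k, OF compact_imp_closed[OF k(2)] k(3) that] .
  have p00: "partial_deriv i (partial_deriv i k) x = 0" if "x \<notin> K" for x i
    using partial_deriv_outside(1)[where f="partial_deriv i k", OF compact_imp_closed[OF k(2)] p0 that] .
  have p00': "partial_deriv j (partial_deriv i k) x = 0" if "x \<notin> K" for x i j
    using partial_deriv_outside(1)[where f="partial_deriv i k", OF compact_imp_closed[OF k(2)] p0 that] .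
  have cpp: "continuous_on UNIV (partial_deriv j (partial_deriv i k))" if "i \<in> Basis" "j \<in> Basis" for i j
    using pk[OF that(1)] that(2) by auto
  have e1: "partial_deriv i (conv v k) = conv v (partial_deriv i k)" if "i \<in> Basis" for i
    using conv_C1(2)[OF v k1 k(2,3) that] by auto
  have e2: "partial_deriv j (conv v (partial_deriv i k)) = conv v (partial_deriv j (partial_deriv i k))"
    if "i \<in> Basis" "j \<in> Basis" for i j
    using conv_C1(2)[OF v pk[OF that(1)] k(2) p0 that(2)] by auto
  show "Ck_on 2 UNIV (conv v k)"
    unfolding Ck_on_2_iff
    using conv_C1(1)[OF v k1 k(2,3)] conv_C1(1)[OF v pk k(2) p0] continuous_on_conv[OF v cpp k(2) p00']
    by (simp add: e1 e2)
  have "laplacian (conv v k) x = (\<Sum>i\<in>Basis. conv v (partial_deriv i (partial_deriv i k)) x)"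
    unfolding laplacian_def by (intro sum.cong) (auto simp: e1 e2)
  also have "\<dots> = conv v (laplacian k) x"
    unfolding conv_def laplacian_def sum_distrib_left
    by (rule Bochner_Integration.integral_sum[symmetric]) (rule conv_integrand_integrable[OF v cpp k(2) p00'])
  finally show "laplacian (conv v k) x = conv v (laplacian k) x" .
qed

section \<open>Continuity of translations in the mean\<close>

lemma integrable_lborel_translation:
  fixes f :: "'a::euclidean_space \<Rightarrow> real"
  assumes "integrable lborel f"
  shows "integrable lborel (\<lambda>x. f (x + a))"
proof -
  have "integrable (distr lborel borel ((+) a)) f" using assms by (simp add: lborel_distr_plus)
  then show ?thesis
    by (subst (asm) integrable_distr_eq) (use assms in \<open>auto simp: add.commute\<close>)
qed

lemma lborel_integral_scale:
  fixes f :: "'a::euclidean_space \<Rightarrow> real"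
  assumes [measurable]: "f \<in> borel_measurable borel" and c: "c \<noteq> 0"
  shows "(LBINT x. f x) = \<bar>c\<bar> ^ DIM('a) * (LBINT x. f (c *\<^sub>R x))"
proof -
  have "(LBINT x. f x) = (\<integral>x. f x \<partial>(density (distr lborel borel (\<lambda>x. 0 + c *\<^sub>R x)) (\<lambda>_. \<bar>c\<bar>^DIM('a))))"
    by (subst lborel_affine[OF c, of 0, symmetric]) simp
  also have "\<dots> = (\<integral>x. \<bar>c\<bar>^DIM('a) * f x \<partial>(distr lborel borel (\<lambda>x. 0 + c *\<^sub>R x)))"
    by (subst integral_density) auto
  also have "\<dots> = \<bar>c\<bar> ^ DIM('a) * (LBINT x. f (c *\<^sub>R x))"
    by (subst integral_distr) auto
  finally show ?thesis .
qed

lemma lborel_integral_reflect: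
  fixes f :: "'a::euclidean_space \<Rightarrow> real"
  assumes [measurable]: "f \<in> borel_measurable borel"
  shows "(LBINT y. f (x - y)) = (LBINT y. f y)"
proof -
  have "(LBINT y. f y) = (LBINT y. f (- y))"
    using lborel_integral_scale[of f "-1"] by simp
  also have "\<dots> = (LBINT y. f (- (y + - x)))"
    by (rule lborel_integral_translation[symmetric]) simp
  finally show ?thesis by simp
qed

text \<open>For values in \<open>{0, 1}\<close> one has \<open>\<bar>p - q\<bar> = (p - q) + 2 * q * (1 - p)\<close>. The first summand has integral
  zero by translation invariance; the second tends to zero pointwise because \<open>U\<close> is open.\<close>

lemma translation_continuous_L1_open:
  fixes U :: "'a::euclidean_space set"
  assumes U: "open U" "emeasure lborel U < \<infinity>" and a: "a \<longlonglongrightarrow> 0"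
  shows "(\<lambda>n. \<integral>x. \<bar>indicator U (x + a n) - indicator U x\<bar> \<partial>lborel) \<longlonglongrightarrow> (0::real)"
proof -
  have [measurable]: "U \<in> sets borel" using U by auto
  have iU: "integrable lborel (indicator U :: 'a \<Rightarrow> real)" using U by simp
  have iUa: "integrable lborel (\<lambda>x. indicator U (x + a n) :: real)" for n
    by (rule integrable_lborel_translation[OF iU])
  have lim: "(\<lambda>n. \<integral>x. indicator U x * (1 - indicator U (x + a n)) \<partial>lborel) \<longlonglongrightarrow> integral\<^sup>L lborel (\<lambda>x::'a. 0::real)"
  proof (rule integral_dominated_convergence[where w="indicator U"])
    show "AE x in lborel. (\<lambda>n. indicator U x * (1 - indicator U (x + a n))) \<longlonglongrightarrow> (0::real)"
    proof (intro AE_I2)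
      fix x
      show "(\<lambda>n. indicator U x * (1 - indicator U (x + a n))) \<longlonglongrightarrow> (0::real)"
      proof (cases "x \<in> U")
        case True
        have "(\<lambda>n. x + a n) \<longlonglongrightarrow> x + 0" by (intro tendsto_intros a)
        then have "eventually (\<lambda>n. x + a n \<in> U) sequentially"
          using topological_tendstoD[OF _ U(1)] True by simp
        then have "eventually (\<lambda>n. indicator U x * (1 - indicator U (x + a n)) = (0::real)) sequentially"
          by (rule eventually_mono) simp
        then show ?thesis
          by (rule tendsto_eventually)
      qed simp
    qed
    show "AE x in lborel. norm (indicator U x * (1 - indicator U (x + a n)) :: real) \<le> indicator U x" for n
      by (intro AE_I2) (auto simp: indicator_def)
  qed (use iU in auto)
  have i3: "integrable lborel (\<lambda>x. indicator U x * (1 - indicator U (x + a n)) :: real)" for n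
    by (rule Bochner_Integration.integrable_bound[OF iU]) (auto simp: indicator_def)
  have "(LBINT x. \<bar>indicator U (x + a n) - indicator U x :: real\<bar>) = 2 * (LBINT x. indicator U x * (1 - indicator U (x + a n)))"
    (is "_ = 2 * ?I") for n
  proof -
    have "(LBINT x. \<bar>indicator U (x + a n) - indicator U x :: real\<bar>) =
      (LBINT x. (indicator U (x + a n) - indicator U x) + 2 * (indicator U x * (1 - indicator U (x + a n))))"
      by (rule Bochner_Integration.integral_cong) (auto simp: indicator_def)
    also have "\<dots> = (LBINT x. indicator U (x + a n) - indicator U x) + 2 * ?I"
      using i3 iU iUa by (subst Bochner_Integration.integral_add) auto
    also have "(LBINT x. indicator U (x + a n) - indicator U x) = (0::real)"
      using iU iUa lborel_integral_translation[of "indicator U" "a n"]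
      by (subst Bochner_Integration.integral_diff) auto
    finally show ?thesis by simp
  qed
  then show ?thesis using tendsto_mult_left[OF lim, of 2] by simp
qed

text \<open>Used to pass from a class of functions to its closure in \<open>L^1\<close>: \<open>e\<close> is the distance to the
  approximating function and \<open>G\<close> the error for that function.\<close>

lemma tendsto_zero_approx:
  fixes F :: "nat \<Rightarrow> real"
  assumes "\<And>n. 0 \<le> F n" and "\<And>e. e > 0 \<Longrightarrow> \<exists>G. G \<longlonglongrightarrow> 0 \<and> (\<forall>n. F n \<le> e + G n)"
  shows "F \<longlonglongrightarrow> 0"
proof (rule LIMSEQ_I)
  fix r :: real assume r: "r > 0"
  then obtain G where G: "G \<longlonglongrightarrow> 0" "\<And>n. F n \<le> r / 2 + G n"
    using assms(2)[of "r / 2"] by auto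
  from LIMSEQ_D[OF G(1), of "r / 2"] r obtain N where "\<And>n. n \<ge> N \<Longrightarrow> \<bar>G n\<bar> < r / 2" by auto
  then have "norm (F n - 0) < r" if "n \<ge> N" for n
    using assms(1)[of n] G(2)[of n] that by (smt (verit) real_norm_def field_sum_of_halves)
  then show "\<exists>N. \<forall>n\<ge>N. norm (F n - 0) < r" by blast
qed

text \<open>The functions with this property are closed under sums and limits in \<open>L^1\<close>, and indicators of open
  sets generate all integrable functions by outer regularity.\<close>

lemma translation_continuous_L1:
  fixes f :: "'a::euclidean_space \<Rightarrow> real" and a :: "nat \<Rightarrow> 'a"
  assumes "integrable lborel f" and a: "a \<longlonglongrightarrow> 0"
  shows "(\<lambda>n. \<integral>x. \<bar>f (x + a n) - f x\<bar> \<partial>lborel) \<longlonglongrightarrow> 0"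
  using assms(1)
proof (induction rule: integrable_induct)
  case (base A c)
  then have [measurable]: "A \<in> sets borel" by simp
  have "(\<lambda>n. \<integral>x. \<bar>indicator A (x + a n) - indicator A x\<bar> \<partial>lborel) \<longlonglongrightarrow> (0::real)"
  proof (rule tendsto_zero_approx)
    fix e :: real assume "e > 0"
    then obtain U where U: "open U" "A \<subseteq> U" "emeasure lborel (U - A) < ennreal (e / 2)"
      using outer_regular_lborel[of A "e / 2"] by auto
    have [measurable]: "U \<in> sets borel" using U by auto
    have "emeasure lborel U \<le> emeasure lborel (A \<union> (U - A))" using U(2) by (intro emeasure_mono) auto
    also have "\<dots> \<le> emeasure lborel A + emeasure lborel (U - A)" by (intro emeasure_subadditive) auto
    also have "\<dots> < \<infinity>" using base U(3) by (auto simp: less_top[symmetric] top_unique)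
    finally have fU: "emeasure lborel U < \<infinity>" .
    have fD: "emeasure lborel (U - A) < \<infinity>" using U(3) by (rule less_trans) simp
    have iU: "integrable lborel (indicator U :: 'a \<Rightarrow> real)" "integrable lborel (indicator (U - A) :: 'a \<Rightarrow> real)"
        "integrable lborel (indicator A :: 'a \<Rightarrow> real)"
      using fU fD base by auto
    note iT = integrable_lborel_translation[OF iU(1)] integrable_lborel_translation[OF iU(2)]
      integrable_lborel_translation[OF iU(3)]
    have mD: "measure lborel (U - A) \<le> e / 2"
      using U(3) \<open>e > 0\<close> fD by (simp add: emeasure_eq_ennreal_measure ennreal_less_iff)
    let ?G = "\<lambda>n. \<integral>x. \<bar>indicator U (x + a n) - indicator U x\<bar> \<partial>lborel :: real"
    have "(LBINT x. \<bar>indicator A (x + a n) - indicator A x\<bar>) \<le> e + ?G n" for n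
    proof -
      have "(LBINT x. \<bar>indicator A (x + a n) - indicator A x :: real\<bar>) \<le>
        (LBINT x. (indicator (U - A) (x + a n) + indicator (U - A) x) + \<bar>indicator U (x + a n) - indicator U x\<bar>)"
      proof (rule integral_mono)
        show "\<bar>indicator A (x + a n) - indicator A x :: real\<bar> \<le>
          (indicator (U - A) (x + a n) + indicator (U - A) x) + \<bar>indicator U (x + a n) - indicator U x\<bar>" for x
          using U(2) by (auto simp: indicator_def)
      qed (use iU iT in \<open>simp_all only: Bochner_Integration.integrable_add integrable_abs Bochner_Integration.integrable_diff\<close>)
      also have "\<dots> = (LBINT x. indicator (U - A) (x + a n)) + (LBINT x. indicator (U - A) x) + ?G n"
        using iU iT by (simp add: Bochner_Integration.integral_add)
      also have "(LBINT x. indicator (U - A) (x + a n)) = (\<integral>x. indicator (U - A) x \<partial>lborel :: real)"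
        by (rule lborel_integral_translation) simp
      finally show ?thesis using mD by simp
    qed
    then show "\<exists>G. G \<longlonglongrightarrow> 0 \<and> (\<forall>n. (LBINT x. \<bar>indicator A (x + a n) - indicator A x\<bar>) \<le> e + G n)"
      using translation_continuous_L1_open[OF U(1) fU a] by blast
  qed simp
  from tendsto_mult_right[OF this, of "\<bar>c\<bar>"]
  show ?case
    by (simp add: left_diff_distrib[symmetric] abs_mult)
next
  case (add f g)
  note i = add.hyps integrable_lborel_translation[OF add.hyps(1)] integrable_lborel_translation[OF add.hyps(2)]
  show ?case
  proof (rule tendsto_sandwich[of "\<lambda>_. 0"])
    show "(\<lambda>n. (LBINT x. \<bar>f (x + a n) - f x\<bar>) + (LBINT x. \<bar>g (x + a n) - g x\<bar>)) \<longlonglongrightarrow> 0"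
      using tendsto_add[OF add.IH] by simp
    show "eventually (\<lambda>n. (LBINT x. \<bar>f (x + a n) + g (x + a n) - (f x + g x)\<bar>) \<le>
       (LBINT x. \<bar>f (x + a n) - f x\<bar>) + (LBINT x. \<bar>g (x + a n) - g x\<bar>)) sequentially"
    proof (intro always_eventually allI)
      fix n
      have "(LBINT x. \<bar>f (x + a n) + g (x + a n) - (f x + g x)\<bar>) \<le>
        (LBINT x. \<bar>f (x + a n) - f x\<bar> + \<bar>g (x + a n) - g x\<bar>)"
        using i by (intro integral_mono Bochner_Integration.integrable_add integrable_abs Bochner_Integration.integrable_diff) auto
      then show "(LBINT x. \<bar>f (x + a n) + g (x + a n) - (f x + g x)\<bar>) \<le>
       (LBINT x. \<bar>f (x + a n) - f x\<bar>) + (LBINT x. \<bar>g (x + a n) - g x\<bar>)"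
        using i by (subst (asm) Bochner_Integration.integral_add) auto
    qed
  qed auto
next
  case (lim f s)
  note i = lim.hyps(1,4) integrable_lborel_translation[OF lim.hyps(1)] integrable_lborel_translation[OF lim.hyps(4)]
  have c: "(\<lambda>k. \<integral>x. \<bar>s k x - f x\<bar> \<partial>lborel) \<longlonglongrightarrow> integral\<^sup>L lborel (\<lambda>x::'a. 0::real)"
  proof (rule integral_dominated_convergence[where w="\<lambda>x. 3 * \<bar>f x\<bar>"])
    show "AE x in lborel. (\<lambda>k. \<bar>s k x - f x\<bar>) \<longlonglongrightarrow> 0"
      using lim.hyps(2) by (auto intro!: tendsto_rabs_zero simp: LIM_zero_iff)
    show "AE x in lborel. norm \<bar>s k x - f x\<bar> \<le> 3 * \<bar>f x\<bar>" for k
    proof (intro AE_I2)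
      fix x
      show "norm \<bar>s k x - f x\<bar> \<le> 3 * \<bar>f x\<bar>"
        using lim.hyps(3)[of x k] by simp
    qed
  qed (use i in auto)
  show ?case
  proof (rule tendsto_zero_approx)
    fix e :: real assume "e > 0"
    then have "e / 2 > 0" by simp
    with c have "eventually (\<lambda>k. (LBINT x. \<bar>s k x - f x\<bar>) < e / 2) sequentially"
      by (intro order_tendstoD(2)) auto
    then obtain k where k: "(LBINT x. \<bar>s k x - f x\<bar>) < e / 2"
      by (auto simp: eventually_sequentially)
    have "(LBINT x. \<bar>f (x + a n) - f x\<bar>) \<le> e + (LBINT x. \<bar>s k (x + a n) - s k x\<bar>)" for n
    proof -
      have isf: "integrable lborel (\<lambda>x. \<bar>s k x - f x\<bar>)" using i by auto
      have "(LBINT x. \<bar>f (x + a n) - f x\<bar>) \<le>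
        (LBINT x. (\<bar>s k (x + a n) - f (x + a n)\<bar> + \<bar>s k x - f x\<bar>) + \<bar>s k (x + a n) - s k x\<bar>)"
        using i by (intro integral_mono Bochner_Integration.integrable_add integrable_abs Bochner_Integration.integrable_diff) auto
      also have "\<dots> = (LBINT x. \<bar>s k (x + a n) - f (x + a n)\<bar>) + (LBINT x. \<bar>s k x - f x\<bar>)
          + (LBINT x. \<bar>s k (x + a n) - s k x\<bar>)"
        using i by (simp add: Bochner_Integration.integral_add)
      also have "(LBINT x. \<bar>s k (x + a n) - f (x + a n)\<bar>) = (LBINT x. \<bar>s k x - f x\<bar>)"
        using isf by (intro lborel_integral_translation[where f="\<lambda>x. \<bar>s k x - f x\<bar>"]) auto
      finally show ?thesis using k by simp
    qed
    then show "\<exists>G. G \<longlonglongrightarrow> 0 \<and> (\<forall>n. (LBINT x. \<bar>f (x + a n) - f x\<bar>) \<le> e + G n)"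
      using lim.IH[of k] by blast
  qed simp
qed

section \<open>Radial functions and mollifiers\<close>

lemma pos_part_power_deriv:
  fixes s :: real
  shows "((\<lambda>s. (max 0 s) ^ Suc (Suc n)) has_real_derivative real (Suc (Suc n)) * (max 0 s) ^ Suc n) (at s)"
proof -
  consider "s > 0" | "s < 0" | "s = 0" by linarith
  then show ?thesis
  proof cases
    case 1
    have "((\<lambda>s. s ^ Suc (Suc n)) has_real_derivative real (Suc (Suc n)) * s ^ Suc n) (at s)"
      using DERIV_pow[of "Suc (Suc n)" s UNIV] by (simp only: diff_Suc_Suc diff_zero)
    then have "((\<lambda>s. (max 0 s) ^ Suc (Suc n)) has_real_derivative real (Suc (Suc n)) * s ^ Suc n) (at s)"
      by (rule has_field_derivative_transform_within_open[of _ _ _ "{0<..}"]) (use 1 in auto)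
    then show ?thesis using 1 by (simp add: max_def)
  next
    case 2
    have "((\<lambda>s. 0) has_real_derivative 0) (at s)" by simp
    then have "((\<lambda>s. (max 0 s) ^ Suc (Suc n)) has_real_derivative 0) (at s)"
      by (rule has_field_derivative_transform_within_open[of _ _ _ "{..<0}"]) (use 2 in auto)
    then show ?thesis using 2 by simp
  next
    case 3
    have "((\<lambda>h. ((max 0 (s + h)) ^ Suc (Suc n) - (max 0 s) ^ Suc (Suc n)) / h) \<longlongrightarrow> 0) (at 0)"
    proof (rule Lim_null_comparison)
      show "eventually (\<lambda>h. norm (((max 0 (s + h)) ^ Suc (Suc n) - (max 0 s) ^ Suc (Suc n)) / h) \<le> \<bar>h\<bar> ^ Suc n) (at 0)"
      proof (rule eventually_at_filter[THEN iffD2], intro always_eventually allI impI)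
        fix h :: real assume "h \<noteq> 0"
        then show "norm (((max 0 (s + h)) ^ Suc (Suc n) - (max 0 s) ^ Suc (Suc n)) / h) \<le> \<bar>h\<bar> ^ Suc n"
        proof (cases "h > 0")
          case True
          then show ?thesis using 3 by simp
        next
          case False
          then have "max 0 (s + h) = 0" using 3 by simp
          then show ?thesis using 3 zero_le_power_abs[of h "Suc n"] by (simp del: power_Suc add: power_0_Suc)
        qed
      qed
      show "((\<lambda>h. \<bar>h\<bar> ^ Suc n) \<longlongrightarrow> 0) (at (0::real))"
        by (rule tendsto_eq_intros refl | simp)+
    qed
    then show ?thesis using 3 unfolding DERIV_def by simp
  qed
qed

lemma pos_part_cube_deriv: "((\<lambda>s::real. (max 0 s) ^ 3) has_real_derivative 3 * (max 0 s)\<^sup>2) (at s)"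
  using pos_part_power_deriv[of 1 s] by (simp add: eval_nat_numeral)

lemma pos_part_square_deriv: "((\<lambda>s::real. (max 0 s)\<^sup>2) has_real_derivative 2 * max 0 s) (at s)"
  using pos_part_power_deriv[of 0 s] by (simp add: eval_nat_numeral)

lemma pos_part_cube_compose:
  assumes "(g has_real_derivative g') (at x)"
  shows "((\<lambda>x. (max 0 (g x)) ^ 3) has_real_derivative (3 * (max 0 (g x))\<^sup>2 * g')) (at x)"
  using DERIV_chain2[OF pos_part_cube_deriv assms] by simp

lemma pos_part_square_compose:
  assumes "(g has_real_derivative g') (at x)"
  shows "((\<lambda>x. (max 0 (g x))\<^sup>2) has_real_derivative (2 * max 0 (g x) * g')) (at x)"
  using DERIV_chain2[OF pos_part_square_deriv assms] by simp

lemma sq_dist_C2: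
  fixes x0 :: "'a::euclidean_space"
  defines "q \<equiv> \<lambda>y. (y - x0) \<bullet> (y - x0)"
  shows "Ck_on 2 UNIV q" "laplacian q y = 2 * DIM('a)" "(\<Sum>i\<in>Basis. (partial_deriv i q y)\<^sup>2) = 4 * q y"
proof -
  have D: "(q has_derivative (\<lambda>h. 2 * (h \<bullet> (y - x0)))) (at y)" for y
    unfolding q_def by (auto intro!: derivative_eq_intros simp: inner_commute)
  have p: "partial_deriv i q = (\<lambda>y. 2 * (i \<bullet> (y - x0)))" for i
    using partial_deriv_eq[OF D] by auto
  have D2: "((\<lambda>y. 2 * (i \<bullet> (y - x0))) has_derivative (\<lambda>h. 2 * (i \<bullet> h))) (at y)" for i y
    by (auto intro!: derivative_eq_intros)
  have p2: "partial_deriv j (\<lambda>y. 2 * (i \<bullet> (y - x0))) = (\<lambda>y. 2 * (i \<bullet> j))" for i j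
    using partial_deriv_eq[OF D2] by auto
  show "Ck_on 2 UNIV q"
    unfolding Ck_on_2_iff p using D D2 by (auto simp: p2 differentiable_def)
  show "laplacian q y = 2 * DIM('a)"
    unfolding laplacian_def p p2 by simp
  have "(\<Sum>i\<in>Basis. (partial_deriv i q y)\<^sup>2) = 4 * (\<Sum>i\<in>Basis. ((y - x0) \<bullet> i) * ((y - x0) \<bullet> i))"
    unfolding p by (simp add: sum_distrib_left power2_eq_square inner_commute mult_ac)
  also have "\<dots> = 4 * q y"
    unfolding q_def by (subst euclidean_inner[of "y - x0" "y - x0"]) simp
  finally show "(\<Sum>i\<in>Basis. (partial_deriv i q y)\<^sup>2) = 4 * q y" .
qed

lemma radial_C2:
  fixes x0 :: "'a::euclidean_space" and \<phi> \<phi>' \<phi>'' :: "real \<Rightarrow> real"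
  assumes 1: "\<And>s. s \<ge> 0 \<Longrightarrow> (\<phi> has_real_derivative \<phi>' s) (at s)"
    and 2: "\<And>s. s \<ge> 0 \<Longrightarrow> (\<phi>' has_real_derivative \<phi>'' s) (at s)"
    and c: "continuous_on {0..} \<phi>''"
  shows "Ck_on 2 UNIV (\<lambda>y. \<phi> ((y - x0) \<bullet> (y - x0)))"
    and "laplacian (\<lambda>y. \<phi> ((y - x0) \<bullet> (y - x0))) y =
      2 * DIM('a) * \<phi>' ((y - x0) \<bullet> (y - x0)) + 4 * ((y - x0) \<bullet> (y - x0)) * \<phi>'' ((y - x0) \<bullet> (y - x0))"
proof -
  have c': "continuous_on UNIV (\<lambda>y. \<phi>'' ((y - x0) \<bullet> (y - x0)))"
    by (rule continuous_on_compose2[OF c]) (auto intro!: continuous_intros)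
  note * = Ck_on_2_comp[OF sq_dist_C2(1)[of x0] 1 2 c', simplified]
  show "Ck_on 2 UNIV (\<lambda>y. \<phi> ((y - x0) \<bullet> (y - x0)))" by (rule *)
  show "laplacian (\<lambda>y. \<phi> ((y - x0) \<bullet> (y - x0))) y =
      2 * DIM('a) * \<phi>' ((y - x0) \<bullet> (y - x0)) + 4 * ((y - x0) \<bullet> (y - x0)) * \<phi>'' ((y - x0) \<bullet> (y - x0))"
    using *(2)[of y] by (simp add: sq_dist_C2)
qed

text \<open>The cube is the least integer power of the positive part that is twice continuously
  differentiable.\<close>

definition bump :: "'a::euclidean_space \<Rightarrow> real" where
  "bump y = (max 0 (1 - y \<bullet> y)) ^ 3"

definition bump_mass :: "'a::euclidean_space itself \<Rightarrow> real" where
  "bump_mass _ = (LBINT y. bump (y::'a))"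

definition mollifier :: "real \<Rightarrow> 'a::euclidean_space \<Rightarrow> real" where
  "mollifier \<epsilon> y = bump ((1 / \<epsilon>) *\<^sub>R y) / (\<epsilon> ^ DIM('a) * bump_mass TYPE('a))"

lemma bump_bounds: "0 \<le> bump y" "bump y \<le> 1"
  unfolding bump_def using power_mono[of "max 0 (1 - y \<bullet> y)" 1 3] by auto

lemma bump_outside: "norm y \<ge> 1 \<Longrightarrow> bump y = 0"
  unfolding bump_def using power_mono[of 1 "norm y" 2] by (auto simp: power2_norm_eq_inner)

text \<open>The Laplacian of a radial function depends only on the distance from the centre; hence
  shifting and reflecting the kernel commutes with the Laplacian.\<close>

lemma bump_scaled_C2:
  fixes x :: "'a::euclidean_space"
  shows "Ck_on 2 UNIV (\<lambda>y. c * bump (b *\<^sub>R (x - y)))"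
    and "\<exists>l. \<forall>(x::'a) y. laplacian (\<lambda>y. c * bump (b *\<^sub>R (x - y))) y = l ((x - y) \<bullet> (x - y))"
proof -
  let ?p = "\<lambda>s. c * (max 0 (1 - b\<^sup>2 * s)) ^ 3"
  let ?p' = "\<lambda>s. c * (3 * (max 0 (1 - b\<^sup>2 * s))\<^sup>2 * - b\<^sup>2)"
  let ?p'' = "\<lambda>s. c * (3 * (2 * max 0 (1 - b\<^sup>2 * s) * - b\<^sup>2) * - b\<^sup>2)"
  have l: "((\<lambda>s. 1 - b\<^sup>2 * s) has_real_derivative - b\<^sup>2) (at s)" for s :: real
    by (auto intro!: derivative_eq_intros)
  have 1: "(?p has_real_derivative ?p' s) (at s)" for s :: real
    by (intro DERIV_cmult pos_part_cube_compose l)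
  have 2: "(?p' has_real_derivative ?p'' s) (at s)" for s :: real
    by (intro DERIV_cmult DERIV_cmult_right pos_part_square_compose l)
  have 3: "continuous_on {0..} ?p''"
    by (intro continuous_intros)
  have swap: "(y - x) \<bullet> (y - x) = (x - y) \<bullet> (x - y)" for x y :: 'a
    by (metis minus_diff_eq inner_minus_left inner_minus_right minus_minus)
  have eq: "(\<lambda>y. c * bump (b *\<^sub>R (x - y))) = (\<lambda>y. ?p ((y - x) \<bullet> (y - x)))" for x :: 'a
    using swap[of _ x] by (intro ext) (simp add: bump_def power2_eq_square mult_ac)
  note rad = radial_C2[where \<phi>="?p" and \<phi>'="?p'" and \<phi>''="?p''", OF 1 2 3]
  show "Ck_on 2 UNIV (\<lambda>y. c * bump (b *\<^sub>R (x - y)))"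
    unfolding eq by (rule rad(1))
  show "\<exists>l. \<forall>(x::'a) y. laplacian (\<lambda>y. c * bump (b *\<^sub>R (x - y))) y = l ((x - y) \<bullet> (x - y))"
  proof (intro exI allI)
    fix x y :: 'a
    show "laplacian (\<lambda>y. c * bump (b *\<^sub>R (x - y))) y =
       (\<lambda>s. 2 * DIM('a) * ?p' s + 4 * s * ?p'' s) ((x - y) \<bullet> (x - y))"
      unfolding eq rad(2) using swap[of y x] by simp
  qed
qed

lemma bump_even: "bump (- y) = bump y"
  by (simp add: bump_def)

lemma bump_continuous: "continuous_on UNIV (bump :: 'a::euclidean_space \<Rightarrow> real)"
  using Ck_on_imp_continuous[OF bump_scaled_C2(1)[of 1 1 0]] by (simp add: bump_even)

lemma bump_mass_pos: "bump_mass TYPE('a::euclidean_space) > 0"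
proof -
  have i: "integrable lborel (bump :: 'a \<Rightarrow> real)"
    by (rule integrable_cc[OF bump_continuous, of "cball 0 1"]) (auto intro: bump_outside)
  have "0 < (1/2) ^ 3 * measure lborel (cball (0::'a) (1/2))"
    using content_cball_pos[of "1/2" "0::'a"] by simp
  also have "\<dots> = (LBINT y. (1/2) ^ 3 * indicator (cball (0::'a) (1/2)) y)"
    by simp
  also have "\<dots> \<le> bump_mass TYPE('a)"
    unfolding bump_mass_def
  proof (rule integral_mono)
    show "integrable lborel (\<lambda>y::'a. (1/2) ^ 3 * indicator (cball 0 (1/2)) y :: real)"
      by (intro integrable_mult_right) (auto intro!: emeasure_lborel_cball_finite)
    show "(1/2) ^ 3 * indicator (cball 0 (1/2)) y \<le> bump y" for y :: 'a
    proof (cases "norm y \<le> 1/2")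
      case True
      have "y \<bullet> y \<le> (1/2)\<^sup>2" using power_mono[OF True, of 2] by (simp only: norm_ge_zero power2_norm_eq_inner)
      then have "(1/2::real) \<le> max 0 (1 - y \<bullet> y)" by (simp add: power2_eq_square)
      then have "(1/2) ^ 3 \<le> bump y" unfolding bump_def by (rule power_mono) simp
      with True show ?thesis by (simp only: indicator_def mem_cball dist_0_norm) simp
    qed (simp add: bump_bounds)
  qed (rule i)
  finally show ?thesis .
qed

context
  fixes \<epsilon> :: real
  assumes eps: "\<epsilon> > 0"
begin

lemma mollifier_nonneg: "0 \<le> mollifier \<epsilon> y"
  unfolding mollifier_def using eps bump_mass_pos by (intro divide_nonneg_pos bump_bounds mult_pos_pos) auto

lemma mollifier_le: "mollifier \<epsilon> (y::'a::euclidean_space) \<le> 1 / (\<epsilon> ^ DIM('a) * bump_mass TYPE('a))"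
  unfolding mollifier_def using eps bump_mass_pos[where 'a='a] by (intro divide_right_mono bump_bounds) auto

lemma mollifier_outside: "norm y \<ge> \<epsilon> \<Longrightarrow> mollifier \<epsilon> y = 0"
  unfolding mollifier_def using eps by (subst bump_outside) (auto simp: field_simps)

lemma mollifier_shifted_C2:
  fixes x :: "'a::euclidean_space"
  shows "Ck_on 2 UNIV (\<lambda>y. mollifier \<epsilon> (x - y))"
    and "laplacian (\<lambda>y. mollifier \<epsilon> (x - y)) y = laplacian (mollifier \<epsilon>) (x - y)"
proof -
  let ?c = "1 / (\<epsilon> ^ DIM('a) * bump_mass TYPE('a))"
  have eq: "(\<lambda>y. mollifier \<epsilon> (x - y)) = (\<lambda>y. ?c * bump ((1 / \<epsilon>) *\<^sub>R (x - y)))" for x :: 'a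
    by (simp add: mollifier_def)
  have eq0: "mollifier \<epsilon> = (\<lambda>y::'a. mollifier \<epsilon> (0 - y))"
    by (simp add: mollifier_def[abs_def] bump_even)
  show "Ck_on 2 UNIV (\<lambda>y. mollifier \<epsilon> (x - y))"
    unfolding eq by (rule bump_scaled_C2(1))
  obtain l where l: "\<And>(x::'a) y. laplacian (\<lambda>y. ?c * bump ((1 / \<epsilon>) *\<^sub>R (x - y))) y = l ((x - y) \<bullet> (x - y))"
    using bump_scaled_C2(2) by blast
  have "laplacian (mollifier \<epsilon>) z = l (z \<bullet> z)" for z :: 'a
    by (subst eq0, unfold eq l) simp
  then show "laplacian (\<lambda>y. mollifier \<epsilon> (x - y)) y = laplacian (mollifier \<epsilon>) (x - y)"
    unfolding eq l by simp
qed

lemma mollifier_C2: "Ck_on 2 UNIV (mollifier \<epsilon> :: 'a::euclidean_space \<Rightarrow> real)"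
  using mollifier_shifted_C2(1)[of 0] by (simp add: mollifier_def[abs_def] bump_even)

lemma mollifier_continuous: "continuous_on UNIV (mollifier \<epsilon> :: 'a::euclidean_space \<Rightarrow> real)"
  by (rule Ck_on_imp_continuous[OF mollifier_C2])

lemma mollifier_support: "x \<notin> cball 0 \<epsilon> \<Longrightarrow> mollifier \<epsilon> x = 0"
  using mollifier_outside[of x] by simp

lemma mollifier_measurable [measurable]: "mollifier \<epsilon> \<in> borel_measurable borel"
  by (rule borel_measurable_continuous_onI[OF mollifier_continuous])

lemma mollifier_integral: "(LBINT y. mollifier \<epsilon> (y::'a::euclidean_space)) = 1"
proof -
  have b: "(bump :: 'a \<Rightarrow> real) \<in> borel_measurable borel"
    by (rule borel_measurable_continuous_onI[OF bump_continuous])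
  have "bump_mass TYPE('a) = (1 / \<epsilon>) ^ DIM('a) * (LBINT y. bump ((1 / \<epsilon>) *\<^sub>R (y::'a)))"
    unfolding bump_mass_def using lborel_integral_scale[OF b, of "1 / \<epsilon>"] eps by simp
  then have "(LBINT y. bump ((1 / \<epsilon>) *\<^sub>R (y::'a))) = \<epsilon> ^ DIM('a) * bump_mass TYPE('a)"
    using eps by (simp add: power_one_over field_simps)
  then show ?thesis
    unfolding mollifier_def using eps bump_mass_pos[where 'a='a] by simp
qed

end

lemma mollifier_integrable: "\<epsilon> > 0 \<Longrightarrow> integrable lborel (mollifier \<epsilon> :: 'a::euclidean_space \<Rightarrow> real)"
  by (rule integrable_cc[OF mollifier_continuous compact_cball mollifier_support])

text \<open>Convolution averages translates of \<open>f\<close>, so by Tonelli the error is at most the largest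
  \<open>\<integral> \<bar>f (x - y) - f x\<bar> dx\<close> over \<open>y\<close> in the support of the kernel.\<close>

lemma mollify_L1:
  fixes f :: "'a::euclidean_space \<Rightarrow> real"
  assumes f: "integrable lborel f" and e: "e > 0"
  shows "\<exists>d>0. \<forall>\<epsilon>. 0 < \<epsilon> \<and> \<epsilon> < d \<longrightarrow>
    integrable lborel (conv f (mollifier \<epsilon>)) \<and> (LBINT x. \<bar>conv f (mollifier \<epsilon>) x - f x\<bar>) \<le> e"
proof -
  have mf[measurable]: "f \<in> borel_measurable borel" using f by auto
  let ?I = "\<lambda>y. \<integral>x. \<bar>f (x + y) - f x\<bar> \<partial>lborel"
  have "eventually (\<lambda>y. ?I y < e) (inf (nhds 0) (principal UNIV))"
  proof (rule sequentially_imp_eventually_nhds_within, safe)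
    fix a :: "nat \<Rightarrow> 'a" assume "a \<longlonglongrightarrow> 0"
    from order_tendstoD(2)[OF translation_continuous_L1[OF f this] e]
    show "eventually (\<lambda>n. ?I (a n) < e) sequentially" .
  qed
  then obtain d where d: "d > 0" "\<And>y. norm y < d \<Longrightarrow> ?I y < e"
    by (auto simp: eventually_nhds_metric)
  have "integrable lborel (conv f (mollifier \<epsilon>)) \<and> (LBINT x. \<bar>conv f (mollifier \<epsilon>) x - f x\<bar>) \<le> e"
    if \<epsilon>: "0 < \<epsilon>" "\<epsilon> < d" for \<epsilon>
  proof -
    let ?k = "mollifier \<epsilon> :: 'a \<Rightarrow> real"
    note km[measurable] = mollifier_measurable[OF \<epsilon>(1), where 'a='a]
    note k0 = mollifier_nonneg[OF \<epsilon>(1), where 'a='a]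
    have ik: "integrable lborel ?k" by (rule mollifier_integrable[OF \<epsilon>(1)])
    have mc[measurable]: "conv f ?k \<in> borel_measurable borel"
      by (rule borel_measurable_continuous_onI[OF continuous_on_conv[OF f mollifier_continuous[OF \<epsilon>(1)] compact_cball mollifier_support[OF \<epsilon>(1)]]])
    have conv_diff: "ennreal \<bar>conv f ?k x - f x\<bar> \<le> (\<integral>\<^sup>+y. ennreal (\<bar>f (x - y) - f x\<bar> * ?k y) \<partial>lborel)" for x
    proof -
      have i1: "integrable lborel (\<lambda>y. f y * ?k (x - y))"
        by (rule conv_integrand_integrable[OF f mollifier_continuous[OF \<epsilon>(1)] compact_cball mollifier_support[OF \<epsilon>(1)]])
      have "integrable lborel (\<lambda>y. f (x + (-1) *\<^sub>R y) * ?k (x - (x + (-1) *\<^sub>R y)))"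
      proof -
        have "integrable (density (distr lborel borel (\<lambda>y. x + (-1) *\<^sub>R y)) (\<lambda>_. ennreal (\<bar>-1\<bar>^DIM('a)))) (\<lambda>y. f y * ?k (x - y))"
          using i1 by (subst lborel_affine[of "-1" x, symmetric]) auto
        then show ?thesis
          by (subst (asm) integrable_density) (auto simp: integrable_distr_eq)
      qed
      then have i2: "integrable lborel (\<lambda>y. f (x - y) * ?k y)" by simp
      have "conv f ?k x = (LBINT y. f (x - y) * ?k (x - (x - y)))"
        unfolding conv_def by (rule lborel_integral_reflect[symmetric]) measurable
      also have "\<dots> = (LBINT y. f (x - y) * ?k y)" by simp
      finally have "conv f ?k x - f x = (LBINT y. f (x - y) * ?k y) - (LBINT y. f x * ?k y)"
        by (simp add: mollifier_integral[OF \<epsilon>(1)])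
      also have "\<dots> = (LBINT y. f (x - y) * ?k y - f x * ?k y)"
        using i2 ik by (intro Bochner_Integration.integral_diff[symmetric]) auto
      finally have eq: "conv f ?k x - f x = (LBINT y. f (x - y) * ?k y - f x * ?k y)" .
      have "integrable lborel (\<lambda>y. f (x - y) * ?k y - f x * ?k y)" using i2 ik by auto
      from integral_norm_bound_ennreal[OF this]
      have "ennreal \<bar>conv f ?k x - f x\<bar> \<le> (\<integral>\<^sup>+y. ennreal \<bar>f (x - y) * ?k y - f x * ?k y\<bar> \<partial>lborel)"
        by (simp add: eq)
      also have "\<dots> = (\<integral>\<^sup>+y. ennreal (\<bar>f (x - y) - f x\<bar> * ?k y) \<partial>lborel)"
        using k0 by (intro nn_integral_cong) (simp add: left_diff_distrib[symmetric] abs_mult)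
      finally show ?thesis .
    qed
    have "(\<integral>\<^sup>+x. ennreal \<bar>conv f ?k x - f x\<bar> \<partial>lborel) \<le>
       (\<integral>\<^sup>+x. (\<integral>\<^sup>+y. ennreal (\<bar>f (x - y) - f x\<bar> * ?k y) \<partial>lborel) \<partial>lborel)"
      by (intro nn_integral_mono conv_diff)
    also have "\<dots> = (\<integral>\<^sup>+y. (\<integral>\<^sup>+x. ennreal (\<bar>f (x - y) - f x\<bar> * ?k y) \<partial>lborel) \<partial>lborel)"
      by (rule lborel_pair.Fubini') measurable
    also have "\<dots> \<le> (\<integral>\<^sup>+y. ennreal e * ennreal (?k y) \<partial>lborel)"
    proof (intro nn_integral_mono)
      fix y :: 'a
      show "(\<integral>\<^sup>+x. ennreal (\<bar>f (x - y) - f x\<bar> * ?k y) \<partial>lborel) \<le> ennreal e * ennreal (?k y)"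
      proof (cases "norm y < \<epsilon>")
        case True
        have ii: "integrable lborel (\<lambda>x. \<bar>f (x + - y) - f x\<bar>)"
          using f integrable_lborel_translation[OF f, of "- y"] by auto
        have "(\<integral>\<^sup>+x. ennreal (\<bar>f (x - y) - f x\<bar> * ?k y) \<partial>lborel) = (\<integral>\<^sup>+x. ennreal \<bar>f (x - y) - f x\<bar> * ennreal (?k y) \<partial>lborel)"
          using k0 by (intro nn_integral_cong) (simp add: ennreal_mult)
        also have "\<dots> = (\<integral>\<^sup>+x. ennreal \<bar>f (x - y) - f x\<bar> \<partial>lborel) * ennreal (?k y)"
          by (rule nn_integral_multc) measurable
        also have "(\<integral>\<^sup>+x. ennreal \<bar>f (x - y) - f x\<bar> \<partial>lborel) = ennreal (?I (- y))"
          using nn_integral_eq_integral[OF ii] by simp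
        also have "\<dots> * ennreal (?k y) \<le> ennreal e * ennreal (?k y)"
          using d(2)[of "- y"] True \<epsilon> by (intro mult_right_mono ennreal_leI) auto
        finally show ?thesis .
      next
        case False
        then show ?thesis using mollifier_outside[OF \<epsilon>(1), of y] by simp
      qed
    qed
    also have "\<dots> = ennreal e * (\<integral>\<^sup>+y. ennreal (?k y) \<partial>lborel)"
      by (rule nn_integral_cmult) measurable
    also have "(\<integral>\<^sup>+y. ennreal (?k y) \<partial>lborel) = 1"
      using nn_integral_eq_integral[OF ik] k0 by (simp add: mollifier_integral[OF \<epsilon>(1)])
    finally have le: "(\<integral>\<^sup>+x. ennreal \<bar>conv f ?k x - f x\<bar> \<partial>lborel) \<le> ennreal e" by simp
    have id: "integrable lborel (\<lambda>x. conv f ?k x - f x)"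
      by (rule integrableI_bounded) (use le in \<open>auto intro: le_less_trans\<close>)
    have "integrable lborel (\<lambda>x. (conv f ?k x - f x) + f x)"
      using id f by (rule Bochner_Integration.integrable_add)
    then have "integrable lborel (conv f ?k)" by simp
    moreover have "ennreal (LBINT x. \<bar>conv f ?k x - f x\<bar>) \<le> ennreal e"
      using le nn_integral_eq_integral[of lborel "\<lambda>x. \<bar>conv f ?k x - f x\<bar>"] id by simp
    ultimately show ?thesis using e by (simp add: ennreal_le_iff)
  qed
  with d(1) show ?thesis by blast
qed

section \<open>Kato's inequality\<close>

text \<open>A convex \<open>C^2\<close> substitute for the positive part: its second derivative \<open>soft_pos''\<close> is the hat
  function with nodes 0, 1 and 2, so that \<open>soft_pos\<close> vanishes on the negative half-line and has slope 1
  from 2 on.\<close>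

definition soft_pos :: "real \<Rightarrow> real" where
  "soft_pos s = ((max 0 s) ^ 3 - 2 * (max 0 (s - 1)) ^ 3 + (max 0 (s - 2)) ^ 3) / 6"
definition soft_pos' :: "real \<Rightarrow> real" where
  "soft_pos' s = ((max 0 s)\<^sup>2 - 2 * (max 0 (s - 1))\<^sup>2 + (max 0 (s - 2))\<^sup>2) / 2"
definition soft_pos'' :: "real \<Rightarrow> real" where
  "soft_pos'' s = max 0 s - 2 * max 0 (s - 1) + max 0 (s - 2)"

lemma soft_pos_deriv: "(soft_pos has_real_derivative soft_pos' s) (at s)"
proof -
  have d: "((\<lambda>s. s - c) has_real_derivative 1) (at s)" for c s :: real
    by (auto intro!: derivative_eq_intros)
  have "((\<lambda>s. ((max 0 s) ^ 3 - 2 * (max 0 (s - 1)) ^ 3 + (max 0 (s - 2)) ^ 3) / 6) has_real_derivative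
     (3 * (max 0 s)\<^sup>2 * 1 - 2 * (3 * (max 0 (s - 1))\<^sup>2 * 1) + 3 * (max 0 (s - 2))\<^sup>2 * 1) / 6) (at s)"
    by (intro DERIV_cdivide DERIV_add DERIV_diff DERIV_cmult pos_part_cube_compose d DERIV_ident)
  then show ?thesis unfolding soft_pos_def[abs_def] soft_pos'_def by (rule DERIV_cong) (simp add: field_simps)
qed

lemma soft_pos'_deriv: "(soft_pos' has_real_derivative soft_pos'' s) (at s)"
proof -
  have d: "((\<lambda>s. s - c) has_real_derivative 1) (at s)" for c s :: real
    by (auto intro!: derivative_eq_intros)
  have "((\<lambda>s. ((max 0 s)\<^sup>2 - 2 * (max 0 (s - 1))\<^sup>2 + (max 0 (s - 2))\<^sup>2) / 2) has_real_derivative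
     (2 * max 0 s * 1 - 2 * (2 * max 0 (s - 1) * 1) + 2 * max 0 (s - 2) * 1) / 2) (at s)"
    by (intro DERIV_cdivide DERIV_add DERIV_diff DERIV_cmult pos_part_square_compose d DERIV_ident)
  then show ?thesis unfolding soft_pos'_def[abs_def] soft_pos''_def by (rule DERIV_cong) (simp add: field_simps)
qed

lemma soft_pos''_continuous: "continuous_on S soft_pos''"
  unfolding soft_pos''_def[abs_def] by (intro continuous_intros)

lemma soft_pos_continuous: "continuous_on S soft_pos" "continuous_on S soft_pos'"
  unfolding soft_pos_def[abs_def] soft_pos'_def[abs_def] by (intro continuous_intros; simp)+

lemma soft_pos_measurable [measurable]: "soft_pos \<in> borel_measurable borel" "soft_pos' \<in> borel_measurable borel"
  by (intro borel_measurable_continuous_onI soft_pos_continuous)+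

lemma soft_pos''_bounds: "0 \<le> soft_pos'' s" "soft_pos'' s \<le> 1" "s \<le> 0 \<Longrightarrow> soft_pos'' s = 0" "s \<ge> 2 \<Longrightarrow> soft_pos'' s = 0"
  unfolding soft_pos''_def by (auto simp: max_def)

lemma soft_pos'_values:
  "s \<le> 0 \<Longrightarrow> soft_pos' s = 0" "s \<ge> 2 \<Longrightarrow> soft_pos' s = 1"
  unfolding soft_pos'_def by (auto simp: power2_eq_square field_simps)

lemma soft_pos'_mono: "s \<le> t \<Longrightarrow> soft_pos' s \<le> soft_pos' t"
  using soft_pos''_bounds(1) soft_pos'_deriv by (rule_tac DERIV_nonneg_imp_nondecreasing) auto

lemma soft_pos'_bounds: "0 \<le> soft_pos' s" "soft_pos' s \<le> 1"
  using soft_pos'_mono[of "min s 0" s] soft_pos'_mono[of s "max s 2"] soft_pos'_values(1)[of "min s 0"] soft_pos'_values(2)[of "max s 2"]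
  by auto

text \<open>In the application \<open>s\<close> approximates a nonpositive value \<open>t\<close>, where the derivative vanishes; the
  bound is the approximation error.\<close>

lemma soft_pos'_le: "t \<le> 0 \<Longrightarrow> soft_pos' s \<le> \<bar>s - t\<bar>"
proof -
  assume t: "t \<le> 0"
  have "soft_pos' s \<le> max 0 s"
  proof (cases "s \<le> 0")
    case False
    show ?thesis
    proof (cases "s \<le> 1")
      case True
      then have "s * s \<le> s * 1" using False by (intro mult_left_mono) auto
      then show ?thesis using True False unfolding soft_pos'_def by (simp add: power2_eq_square)
    qed (use soft_pos'_bounds(2)[of s] in auto)
  qed (simp add: soft_pos'_values)
  with t show ?thesis by linarith
qed

lemma soft_pos_Lipschitz: "\<bar>soft_pos a - soft_pos b\<bar> \<le> \<bar>a - b\<bar>"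
proof -
  have *: "\<bar>soft_pos a - soft_pos b\<bar> \<le> \<bar>a - b\<bar>" if "a < b" for a b
  proof -
    have "\<exists>z>a. z < b \<and> soft_pos b - soft_pos a = (b - a) * soft_pos' z"
      using that soft_pos_deriv by (intro MVT2) auto
    then obtain z where z: "soft_pos b - soft_pos a = (b - a) * soft_pos' z" by auto
    moreover have "0 \<le> (b - a) * soft_pos' z" "(b - a) * soft_pos' z \<le> (b - a) * 1"
      using that soft_pos'_bounds[of z] by (auto intro!: mult_nonneg_nonneg mult_left_mono simp del: mult_1_right)
    ultimately show ?thesis using that by auto
  qed
  show ?thesis
    using *[of a b] *[of b a] by (cases a b rule: linorder_cases) (auto simp: abs_minus_commute)
qed

lemma soft_pos_0: "s \<le> 0 \<Longrightarrow> soft_pos s = 0"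
  unfolding soft_pos_def by simp

lemma soft_pos_nonneg: "0 \<le> soft_pos s"
proof (cases "s \<le> 0")
  case False
  have "soft_pos 0 \<le> soft_pos s"
    using False soft_pos_deriv soft_pos'_bounds(1) by (intro DERIV_nonneg_imp_nondecreasing[of 0 s soft_pos]) auto
  then show ?thesis using soft_pos_0[of 0] by simp
qed (simp add: soft_pos_0)

lemma pos_part_le_soft_pos: "max 0 s \<le> soft_pos s + 1"
proof (cases "s \<le> 1")
  case True
  then show ?thesis using soft_pos_nonneg[of s] by linarith
next
  case False
  have 2: "soft_pos 2 = 1" unfolding soft_pos_def by simp
  show ?thesis
  proof (cases "s \<le> 2")
    case True
    have "soft_pos 2 - soft_pos s \<le> 2 - s" using soft_pos_Lipschitz[of 2 s] True by simp
    then show ?thesis using 2 False by simp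
  next
    case s: False
    have "(soft_pos s - s) = (soft_pos 2 - 2)"
    proof -
      have "soft_pos s - s = -1"
        using s False unfolding soft_pos_def by (simp add: power3_eq_cube field_simps)
      with 2 show ?thesis by simp
    qed
    then show ?thesis using 2 s by simp
  qed
qed

text \<open>Splitting \<open>\<bar>g\<bar>\<close> at a high level \<open>A\<close>: the part above the level has small integral. The constant does not
  depend on \<open>f\<close>, so that \<open>f\<close> can be chosen after \<open>\<delta>\<close> and \<open>A\<close>.\<close>

lemma integrable_times_small:
  fixes g :: "'a \<Rightarrow> real"
  assumes g: "integrable M g" and \<delta>: "\<delta> > 0"
  shows "\<exists>A>0. \<forall>f. integrable M f \<longrightarrow> (\<forall>x. 0 \<le> f x \<and> f x \<le> 1) \<longrightarrow>
     (\<integral>x. \<bar>g x\<bar> * f x \<partial>M) \<le> \<delta> + A * (\<integral>x. f x \<partial>M)"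
proof -
  have gm[measurable]: "g \<in> borel_measurable M" using g by auto
  have ig: "integrable M (\<lambda>x. max 0 (\<bar>g x\<bar> - real (Suc n)))" for n
    by (rule Bochner_Integration.integrable_bound[OF g]) auto
  have "(\<lambda>n. \<integral>x. max 0 (\<bar>g x\<bar> - real (Suc n)) \<partial>M) \<longlonglongrightarrow> (\<integral>x. 0 \<partial>M)"
  proof (rule integral_dominated_convergence[where w="\<lambda>x. \<bar>g x\<bar>"])
    show "AE x in M. (\<lambda>n. max 0 (\<bar>g x\<bar> - real (Suc n))) \<longlonglongrightarrow> 0"
    proof (intro AE_I2 tendsto_eventually)
      fix x
      obtain m :: nat where "\<bar>g x\<bar> \<le> m" using real_arch_simple by blast
      then show "eventually (\<lambda>n. max 0 (\<bar>g x\<bar> - real (Suc n)) = 0) sequentially"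
        by (intro eventually_sequentiallyI[of m]) auto
    qed
  qed (use g in auto)
  then have "(\<lambda>n. \<integral>x. max 0 (\<bar>g x\<bar> - real (Suc n)) \<partial>M) \<longlonglongrightarrow> 0" by simp
  from order_tendstoD(2)[OF this \<delta>] obtain n where n: "(\<integral>x. max 0 (\<bar>g x\<bar> - real (Suc n)) \<partial>M) < \<delta>"
    by (auto simp: eventually_sequentially)
  show ?thesis
  proof (intro exI[of _ "real (Suc n)"] conjI allI impI)
    fix f :: "'a \<Rightarrow> real" assume f: "integrable M f" "\<forall>x. 0 \<le> f x \<and> f x \<le> 1"
    have "(\<integral>x. \<bar>g x\<bar> * f x \<partial>M) \<le> (\<integral>x. max 0 (\<bar>g x\<bar> - real (Suc n)) + real (Suc n) * f x \<partial>M)"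
    proof (rule integral_mono)
      show "integrable M (\<lambda>x. \<bar>g x\<bar> * f x)"
        by (rule integrable_mult_bounded[where B=1]) (use f g in auto)
      show "integrable M (\<lambda>x. max 0 (\<bar>g x\<bar> - real (Suc n)) + real (Suc n) * f x)"
        using ig f by auto
      fix x
      have "(\<bar>g x\<bar> - real (Suc n)) * f x \<le> max 0 (\<bar>g x\<bar> - real (Suc n)) * f x"
        using f by (intro mult_right_mono) auto
      also have "\<dots> \<le> max 0 (\<bar>g x\<bar> - real (Suc n)) * 1"
        using f by (intro mult_left_mono) auto
      finally show "\<bar>g x\<bar> * f x \<le> max 0 (\<bar>g x\<bar> - real (Suc n)) + real (Suc n) * f x"
        by (simp add: algebra_simps)
    qed
    also have "\<dots> = (\<integral>x. max 0 (\<bar>g x\<bar> - real (Suc n)) \<partial>M) + real (Suc n) * (\<integral>x. f x \<partial>M)"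
      using ig f(1) by (subst Bochner_Integration.integral_add) auto
    finally show "(\<integral>x. \<bar>g x\<bar> * f x \<partial>M) \<le> \<delta> + real (Suc n) * (\<integral>x. f x \<partial>M)" using n by simp
  qed simp
qed

lemma mollifier_test_C2_0:
  assumes "\<epsilon> > 0" "cball x \<epsilon> \<subseteq> \<Omega>"
  shows "(\<lambda>y. mollifier \<epsilon> (x - y)) \<in> C2_0 \<Omega>"
proof (rule C2_0_I)
  show "Ck_on 2 UNIV (\<lambda>y. mollifier \<epsilon> (x - y))"
    by (rule mollifier_shifted_C2(1)[OF assms(1)])
  show "mollifier \<epsilon> (x - y) = 0" if "y \<notin> cball x \<epsilon>" for y
    using that by (intro mollifier_outside[OF assms(1)]) (simp add: dist_norm)
qed (use assms in auto)

text \<open>If \<open>\<Delta>v \<ge> h\<close> held pointwise, the chain rule for a convex nondecreasing function would give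
  \<open>\<Delta>(soft_pos v) \<ge> soft_pos' v * h\<close>, and the right-hand side is nonnegative since \<open>h \<ge> 0\<close> where \<open>v \<ge> 0\<close> and
  \<open>soft_pos' v = 0\<close> elsewhere. Mollification at scale \<open>\<epsilon>\<close> makes the inequality pointwise on the support of
  the test function. Convergence in \<open>L^1\<close> of the mollified functions suffices for the limit, because
  only \<open>soft_pos\<close> and \<open>soft_pos'\<close>, which are Lipschitz, occur in the integrated inequality.\<close>

lemma Kato_inequality:
  fixes v h :: "'a::euclidean_space \<Rightarrow> real"
  assumes v: "integrable lborel v" and h: "integrable lborel h" and \<Omega>: "open \<Omega>"
    and sub: "\<And>\<zeta>. \<zeta> \<in> C2_0 \<Omega> \<Longrightarrow> (\<And>x. 0 \<le> \<zeta> x) \<Longrightarrow>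
       (LBINT x. h x * \<zeta> x) \<le> (LBINT x. v x * laplacian \<zeta> x)"
    and sgn: "\<And>x. 0 \<le> v x \<Longrightarrow> 0 \<le> h x"
    and \<zeta>: "\<zeta> \<in> C2_0 \<Omega>" "\<And>x. 0 \<le> \<zeta> x"
  shows "0 \<le> (LBINT x. soft_pos (v x) * laplacian \<zeta> x)"
proof (rule field_le_epsilon)
  fix e :: real assume e: "0 < e"
  have [measurable]: "v \<in> borel_measurable borel" "h \<in> borel_measurable borel" using v h by auto
  have \<zeta>2: "Ck_on 2 UNIV \<zeta>" using C2_0_D(1)[OF \<zeta>(1) \<Omega>] .
  obtain K where K: "compact K" "K \<subseteq> \<Omega>" "\<And>x. x \<notin> K \<Longrightarrow> \<zeta> x = 0"
    using C2_0_D(2)[OF \<zeta>(1) \<Omega>] by blast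
  have l0: "laplacian \<zeta> x = 0" if "x \<notin> K" for x
    using laplacian_outside[where f=\<zeta>, OF compact_imp_closed[OF K(1)] K(3) that] .
  have c\<zeta>: "continuous_on UNIV \<zeta>" and cl: "continuous_on UNIV (laplacian \<zeta>)"
    using Ck_on_imp_continuous[OF \<zeta>2] continuous_on_laplacian[OF \<zeta>2] by auto
  note [measurable] = borel_measurable_continuous_onI[OF c\<zeta>] borel_measurable_continuous_onI[OF cl]
  obtain B where B: "B > 0" "\<And>x. \<bar>\<zeta> x\<bar> \<le> B" using continuous_cc_bounded[OF c\<zeta> K(1,3)] by blast
  obtain L where L: "L > 0" "\<And>x. \<bar>laplacian \<zeta> x\<bar> \<le> L" using continuous_cc_bounded[OF cl K(1) l0] by blast
  obtain r where r0: "r > 0" "(\<Union>x\<in>K. cball x r) \<subseteq> \<Omega>"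
    by (rule compact_subset_open_imp_cball_epsilon_subset[OF K(1) \<Omega> K(2)])
  then have r: "r > 0" "\<And>x. x \<in> K \<Longrightarrow> cball x r \<subseteq> \<Omega>" by (simp_all add: UN_subset_iff)
  define \<delta> where "\<delta> = e / (2 * B)"
  have \<delta>: "\<delta> > 0" "B * \<delta> = e / 2" unfolding \<delta>_def using e B by auto
  obtain A where A: "A > 0" "\<And>f. integrable lborel f \<Longrightarrow> (\<And>x. 0 \<le> f x \<and> f x \<le> 1) \<Longrightarrow>
     (LBINT x. \<bar>h x\<bar> * f x) \<le> \<delta> + A * (LBINT x. f x)"
    using integrable_times_small[OF h \<delta>(1)] by blast
  \<comment> \<open>The three errors below are L * e1, B * e1 and B * (\<delta> + A * e1), which add up to e.\<close>
  define S where "S = L + B + B * A"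
  define e1 where "e1 = e / (2 * S)"
  have "S > 0" unfolding S_def using L B A by (simp add: add_pos_pos)
  then have e1: "e1 > 0" "S * e1 = e / 2"
    unfolding e1_def using e by auto
  obtain d1 where d1: "d1 > 0" "\<And>\<epsilon>. 0 < \<epsilon> \<Longrightarrow> \<epsilon> < d1 \<Longrightarrow> integrable lborel (conv v (mollifier \<epsilon>)) \<and>
      (LBINT x. \<bar>conv v (mollifier \<epsilon>) x - v x\<bar>) \<le> e1"
    using mollify_L1[OF v e1(1)] by blast
  obtain d2 where d2: "d2 > 0" "\<And>\<epsilon>. 0 < \<epsilon> \<Longrightarrow> \<epsilon> < d2 \<Longrightarrow> integrable lborel (conv h (mollifier \<epsilon>)) \<and>
      (LBINT x. \<bar>conv h (mollifier \<epsilon>) x - h x\<bar>) \<le> e1"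
    using mollify_L1[OF h e1(1)] by blast
  define \<epsilon> where "\<epsilon> = min r (min d1 d2) / 2"
  have \<epsilon>: "0 < \<epsilon>" "\<epsilon> < r" "\<epsilon> < d1" "\<epsilon> < d2" unfolding \<epsilon>_def using r(1) d1(1) d2(1) by auto
  let ?k = "mollifier \<epsilon> :: 'a \<Rightarrow> real"
  define ve where "ve = conv v ?k"
  define he where "he = conv h ?k"
  note kk = mollifier_C2[OF \<epsilon>(1), where 'a='a] compact_cball[of 0 \<epsilon>] mollifier_support[OF \<epsilon>(1)]
  have ve: "integrable lborel ve" "(LBINT x. \<bar>ve x - v x\<bar>) \<le> e1"
    using d1(2)[OF \<epsilon>(1,3)] unfolding ve_def by auto
  have he: "integrable lborel he" "(LBINT x. \<bar>he x - h x\<bar>) \<le> e1"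
    using d2(2)[OF \<epsilon>(1,4)] unfolding he_def by auto
  note [measurable] = borel_measurable_integrable[OF ve(1), simplified] borel_measurable_integrable[OF he(1), simplified]
  have ve2: "Ck_on 2 UNIV ve" unfolding ve_def by (rule conv_C2(1)[OF v kk])
  have lve: "laplacian ve x \<ge> he x" if "x \<in> K" for x
  proof -
    have "cball x \<epsilon> \<subseteq> \<Omega>" using r(2)[OF that] \<epsilon>(2) by (auto simp: subset_eq)
    then have T: "(\<lambda>y. ?k (x - y)) \<in> C2_0 \<Omega>" by (rule mollifier_test_C2_0[OF \<epsilon>(1)])
    have "he x \<le> (LBINT y. v y * laplacian (\<lambda>y. ?k (x - y)) y)"
      using sub[OF T] mollifier_nonneg[OF \<epsilon>(1)] unfolding he_def conv_def by blast
    also have "\<dots> = conv v (laplacian ?k) x"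
      unfolding conv_def by (simp add: mollifier_shifted_C2(2)[OF \<epsilon>(1)])
    also have "\<dots> = laplacian ve x"
      unfolding ve_def by (rule conv_C2(2)[OF v kk, symmetric])
    finally show ?thesis .
  qed
  let ?f = "\<lambda>x. soft_pos (ve x)"
  have ck: "continuous_on UNIV (\<lambda>x. soft_pos'' (ve x))"
    by (rule continuous_on_compose2[OF soft_pos''_continuous[of UNIV] Ck_on_imp_continuous[OF ve2]]) simp
  have f2: "Ck_on 2 UNIV ?f" and lf: "\<And>x. laplacian ?f x =
       soft_pos' (ve x) * laplacian ve x + soft_pos'' (ve x) * (\<Sum>i\<in>Basis. (partial_deriv i ve x)\<^sup>2)"
    by (rule Ck_on_2_comp[OF ve2 soft_pos_deriv soft_pos'_deriv ck])+
  \<comment> \<open>The convex term of the Laplacian of the composition is nonnegative, so the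
    pointwise inequality for ve survives the chain rule.\<close>
  have iL: "integrable lborel (\<lambda>x. laplacian ?f x * \<zeta> x)"
    by (rule integrable_cc[OF _ K(1)])
       (auto intro!: continuous_intros continuous_on_laplacian[OF f2] c\<zeta> simp: K(3))
  have ih: "integrable lborel (\<lambda>x. g x * (soft_pos' (ve x) * \<zeta> x))" if "integrable lborel g" for g
  proof (rule integrable_mult_bounded[OF that, where B=B])
    show "\<bar>soft_pos' (ve x) * \<zeta> x\<bar> \<le> B" for x
      using mult_mono[of "\<bar>soft_pos' (ve x)\<bar>" 1 "\<bar>\<zeta> x\<bar>" B] soft_pos'_bounds[of "ve x"] B by (simp add: abs_mult)
  qed measurable
  have il: "integrable lborel (\<lambda>x. g x * laplacian \<zeta> x)" if "integrable lborel g" for g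
    by (rule integrable_mult_bounded[OF that, where B=L]) (use L in auto)
  have i_soft_pos: "integrable lborel (\<lambda>x. soft_pos (g x))" if "integrable lborel g" for g :: "'a \<Rightarrow> real"
  proof (rule Bochner_Integration.integrable_bound[OF that])
    show "AE x in lborel. norm (soft_pos (g x)) \<le> norm (g x)"
      using soft_pos_Lipschitz[of "g _" 0] soft_pos_0[of 0] by (intro AE_I2) auto
  qed (use that in measurable)
  have b: "(LBINT x. he x * (soft_pos' (ve x) * \<zeta> x)) \<le> (LBINT x. ?f x * laplacian \<zeta> x)"
  proof -
    have "(LBINT x. he x * (soft_pos' (ve x) * \<zeta> x)) \<le> (LBINT x. laplacian ?f x * \<zeta> x)"
    proof (rule integral_mono[OF ih[OF he(1)] iL])
      fix x
      show "he x * (soft_pos' (ve x) * \<zeta> x) \<le> laplacian ?f x * \<zeta> x"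
      proof (cases "x \<in> K")
        case True
        have "soft_pos' (ve x) * he x \<le> soft_pos' (ve x) * laplacian ve x"
          using lve[OF True] soft_pos'_bounds by (intro mult_left_mono) auto
        also have "\<dots> \<le> laplacian ?f x"
          unfolding lf using soft_pos''_bounds(1) by (simp add: sum_nonneg)
        finally have "(soft_pos' (ve x) * he x) * \<zeta> x \<le> laplacian ?f x * \<zeta> x"
          by (rule mult_right_mono) (rule \<zeta>(2))
        then show ?thesis by (simp add: mult_ac)
      qed (simp add: K(3))
    qed
    also have "\<dots> = (LBINT x. ?f x * laplacian \<zeta> x)"
      by (rule Green_identity(2)[OF f2 \<zeta>2 K(1,3), symmetric])
    finally show ?thesis .
  qed
  \<comment> \<open>Replacing ve by v on the left-hand side costs at most L * e1.\<close>
  have a: "(LBINT x. ?f x * laplacian \<zeta> x) - (LBINT x. soft_pos (v x) * laplacian \<zeta> x) \<le> L * e1"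
  proof -
    have "(LBINT x. ?f x * laplacian \<zeta> x) - (LBINT x. soft_pos (v x) * laplacian \<zeta> x)
      = (LBINT x. ?f x * laplacian \<zeta> x - soft_pos (v x) * laplacian \<zeta> x)"
      using il[OF i_soft_pos[OF ve(1)]] il[OF i_soft_pos[OF v]] by (rule Bochner_Integration.integral_diff[symmetric])
    also have "\<dots> \<le> (LBINT x. L * \<bar>ve x - v x\<bar>)"
    proof (rule integral_mono)
      show "integrable lborel (\<lambda>x. ?f x * laplacian \<zeta> x - soft_pos (v x) * laplacian \<zeta> x)"
        using il[OF i_soft_pos[OF ve(1)]] il[OF i_soft_pos[OF v]] by (rule Bochner_Integration.integrable_diff)
      show "integrable lborel (\<lambda>x. L * \<bar>ve x - v x\<bar>)" using ve v by auto
      fix x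
      have "?f x * laplacian \<zeta> x - soft_pos (v x) * laplacian \<zeta> x \<le> \<bar>?f x - soft_pos (v x)\<bar> * \<bar>laplacian \<zeta> x\<bar>"
        by (metis abs_ge_self abs_mult left_diff_distrib)
      also have "\<dots> \<le> \<bar>ve x - v x\<bar> * L"
        by (intro mult_mono soft_pos_Lipschitz L) auto
      finally show "?f x * laplacian \<zeta> x - soft_pos (v x) * laplacian \<zeta> x \<le> L * \<bar>ve x - v x\<bar>" by (simp add: mult.commute)
    qed
    also have "\<dots> \<le> L * e1" using ve(2) L(1) by simp
    finally show ?thesis .
  qed
  \<comment> \<open>Replacing he by h on the right-hand side costs at most B * e1.\<close>
  have c: "(LBINT x. h x * (soft_pos' (ve x) * \<zeta> x)) - (LBINT x. he x * (soft_pos' (ve x) * \<zeta> x)) \<le> B * e1"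
  proof -
    have "(LBINT x. h x * (soft_pos' (ve x) * \<zeta> x)) - (LBINT x. he x * (soft_pos' (ve x) * \<zeta> x))
      = (LBINT x. h x * (soft_pos' (ve x) * \<zeta> x) - he x * (soft_pos' (ve x) * \<zeta> x))"
      using ih[OF h] ih[OF he(1)] by (rule Bochner_Integration.integral_diff[symmetric])
    also have "\<dots> \<le> (LBINT x. B * \<bar>he x - h x\<bar>)"
    proof (rule integral_mono)
      show "integrable lborel (\<lambda>x. h x * (soft_pos' (ve x) * \<zeta> x) - he x * (soft_pos' (ve x) * \<zeta> x))"
        using ih[OF h] ih[OF he(1)] by (rule Bochner_Integration.integrable_diff)
      show "integrable lborel (\<lambda>x. B * \<bar>he x - h x\<bar>)" using he h by auto
      fix x
      have "h x * (soft_pos' (ve x) * \<zeta> x) - he x * (soft_pos' (ve x) * \<zeta> x) \<le> \<bar>he x - h x\<bar> * (\<bar>soft_pos' (ve x)\<bar> * \<bar>\<zeta> x\<bar>)"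
        by (metis abs_ge_self abs_minus_commute abs_mult left_diff_distrib)
      also have "\<dots> \<le> \<bar>he x - h x\<bar> * (1 * B)"
        using soft_pos'_bounds[of "ve x"] B by (intro mult_mono) auto
      finally show "h x * (soft_pos' (ve x) * \<zeta> x) - he x * (soft_pos' (ve x) * \<zeta> x) \<le> B * \<bar>he x - h x\<bar>" by (simp add: mult.commute)
    qed
    also have "\<dots> \<le> B * e1" using he(2) B(1) by simp
    finally show ?thesis .
  qed
  \<comment> \<open>Only points with v < 0 can contribute negatively; there the derivative of the
    composition vanishes at v x, so F is dominated by the mollification error.\<close>
  define F where "F = (\<lambda>x. soft_pos' (ve x) * indicator {x. v x < 0} x)"
  have Fm[measurable]: "F \<in> borel_measurable borel" unfolding F_def by measurable
  have F: "0 \<le> F x" "F x \<le> 1" "F x \<le> \<bar>ve x - v x\<bar>" for x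
    unfolding F_def using soft_pos'_bounds[of "ve x"] soft_pos'_le[of "v x" "ve x"] by (auto simp: indicator_def)
  have iF: "integrable lborel F"
    by (rule Bochner_Integration.integrable_bound[of _ "\<lambda>x. ve x - v x"]) (use F ve v in auto)
  have iFe: "(LBINT x. F x) \<le> e1"
    using integral_mono[of lborel F "\<lambda>x. \<bar>ve x - v x\<bar>"] iF F(3) ve v by auto
  have d: "- (B * (\<delta> + A * e1)) \<le> (LBINT x. h x * (soft_pos' (ve x) * \<zeta> x))"
  proof -
    have ihF: "integrable lborel (\<lambda>x. \<bar>h x\<bar> * F x)"
      by (rule integrable_mult_bounded[where B=1]) (use F h in auto)
    have "(LBINT x. \<bar>h x\<bar> * F x) \<le> \<delta> + A * (LBINT x. F x)"
      by (rule A(2)[OF iF]) (use F in auto)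
    also have "\<dots> \<le> \<delta> + A * e1" using iFe A(1) by simp
    finally have "- (B * (\<delta> + A * e1)) \<le> (LBINT x. - (B * (\<bar>h x\<bar> * F x)))" using B(1) by simp
    also have "\<dots> \<le> (LBINT x. h x * (soft_pos' (ve x) * \<zeta> x))"
    proof (rule integral_mono[OF _ ih[OF h]])
      show "integrable lborel (\<lambda>x. - (B * (\<bar>h x\<bar> * F x)))" using ihF by auto
      fix x
      show "- (B * (\<bar>h x\<bar> * F x)) \<le> h x * (soft_pos' (ve x) * \<zeta> x)"
      proof (cases "v x < 0")
        case True
        have "\<bar>h x * (soft_pos' (ve x) * \<zeta> x)\<bar> = \<bar>h x\<bar> * F x * \<zeta> x"
          using True F(1)[of x] \<zeta>(2)[of x] unfolding F_def by (simp add: abs_mult)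
        also have "\<dots> \<le> \<bar>h x\<bar> * F x * B"
          using B(2)[of x] F(1)[of x] by (intro mult_left_mono) auto
        finally show ?thesis by (simp add: mult_ac abs_le_iff)
      next
        case False
        then have "0 \<le> h x * (soft_pos' (ve x) * \<zeta> x)"
          using sgn[of x] soft_pos'_bounds(1)[of "ve x"] \<zeta>(2)[of x] by (intro mult_nonneg_nonneg) auto
        moreover have "F x = 0" unfolding F_def using False by simp
        ultimately show ?thesis by simp
      qed
    qed
    finally show ?thesis .
  qed
  have "L * e1 + B * e1 + B * (\<delta> + A * e1) = S * e1 + B * \<delta>"
    by (simp add: S_def algebra_simps)
  also have "\<dots> = e" using e1 \<delta> by simp
  finally show "0 \<le> (LBINT x. soft_pos (v x) * laplacian \<zeta> x) + e"
    using a b c d by linarith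
qed

section \<open>Local boundedness of weakly subharmonic functions\<close>

text \<open>The radial profile of the fundamental solution of the Laplacian in dimension \<open>n\<close>, up to a constant
  factor, as a function of the squared distance \<open>t\<close>. In every dimension its derivative is
  \<open>t powr (- n / 2)\<close>.\<close>

definition fund_profile :: "real \<Rightarrow> real \<Rightarrow> real" where
  "fund_profile n t = (if n = 2 then ln t else t powr (1 - n / 2) / (1 - n / 2))"

lemma fund_profile_deriv:
  assumes "t > 0"
  shows "(fund_profile n has_real_derivative t powr (- n / 2)) (at t)"
proof (cases "n = 2")
  case True
  have "(ln has_real_derivative t powr (- n / 2)) (at t)"
    using DERIV_ln[OF assms] assms True by (simp add: powr_minus)
  then show ?thesis using True by (simp add: fund_profile_def[abs_def])
next
  case False
  then have "((\<lambda>t. t powr (1 - n / 2) / (1 - n / 2)) has_real_derivative t powr (- n / 2)) (at t)"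
    using has_real_derivative_powr[OF assms, of "1 - n / 2"]
    by (auto intro!: DERIV_cong[OF DERIV_cdivide])
  then show ?thesis using False by (simp add: fund_profile_def[abs_def])
qed

lemma fund_profile_strict_mono:
  assumes "0 < s" "s < t"
  shows "fund_profile n s < fund_profile n t"
  by (rule DERIV_pos_imp_increasing[OF assms(2)])
    (use assms in \<open>auto intro!: exI[of _ "_ powr (- n / 2)"] fund_profile_deriv\<close>)

lemma fund_profile_mono: "0 < s \<Longrightarrow> s \<le> t \<Longrightarrow> fund_profile n s \<le> fund_profile n t"
  using fund_profile_strict_mono[of s t n] by (cases "s = t") auto

text \<open>With \<open>t = \<bar>y - x\<bar>\<^sup>2 + \<epsilon>\<^sup>2\<close>, the Laplacian of \<open>fund_profile n t\<close> is \<open>2 n \<epsilon>\<^sup>2 t powr (- n / 2 - 1)\<close>: an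
  approximate identity at \<open>x\<close> of width \<open>\<epsilon>\<close>, which dominates a multiple of the mollifier. The barrier is
  \<open>soft_pos\<close> of a multiple of \<open>fund_profile n (R\<^sup>2) - fund_profile n t\<close>, so that it vanishes for
  \<open>t \<ge> R\<^sup>2\<close>. Truncation by the convex function adds to the Laplacian only where
  \<open>R\<^sup>2 / 2 < t < R\<^sup>2\<close>, by the choice of the multiple, and there the addition is bounded independently of \<open>\<epsilon>\<close>.\<close>

lemma barrier_exists:
  assumes R: "R > 0"
  shows "\<exists>C c. c > 0 \<and> 0 \<le> C \<and> (\<forall>x::'a::euclidean_space. \<forall>\<epsilon>. 0 < \<epsilon> \<and> 2 * \<epsilon> \<le> R \<longrightarrow>
    (\<exists>\<zeta>. \<zeta> \<in> C2_0 UNIV \<and> (\<forall>y. 0 \<le> \<zeta> y) \<and> (\<forall>y. y \<notin> cball x R \<longrightarrow> \<zeta> y = 0) \<and>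
      (\<forall>y. laplacian \<zeta> y \<le> C - c * mollifier \<epsilon> (x - y))))"
proof -
  define n :: real where "n = DIM('a)"
  have n: "n \<ge> 1" unfolding n_def by (simp add: Suc_leI)
  let ?F = "fund_profile n"
  define A where "A = 2 / (?F (R\<^sup>2) - ?F (R\<^sup>2 / 2))"
  have gap: "?F (R\<^sup>2) - ?F (R\<^sup>2 / 2) > 0"
    using fund_profile_strict_mono[of "R\<^sup>2 / 2" "R\<^sup>2" n] R by simp
  have A: "A > 0" "A * (?F (R\<^sup>2) - ?F (R\<^sup>2 / 2)) = 2" unfolding A_def using gap by (simp_all del: right_diff_distrib_numeral)
  define m where "m = bump_mass TYPE('a)"
  have m: "m > 0" unfolding m_def by (rule bump_mass_pos)
  define C where "C = 4 * A\<^sup>2 * R\<^sup>2 * (R\<^sup>2 / 2) powr (- n)"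
  define c where "c = 2 * n * A * 2 powr (- n / 2 - 1) * m"
  have C: "0 \<le> C" unfolding C_def by simp
  have c: "c > 0" unfolding c_def using n A m by simp
  have "\<exists>\<zeta>. \<zeta> \<in> C2_0 UNIV \<and> (\<forall>y. 0 \<le> \<zeta> y) \<and> (\<forall>y. y \<notin> cball x R \<longrightarrow> \<zeta> y = 0) \<and>
      (\<forall>y. laplacian \<zeta> y \<le> C - c * mollifier \<epsilon> (x - y))" if eps: "0 < \<epsilon>" "2 * \<epsilon> \<le> R" for x :: 'a and \<epsilon>
  proof -
    \<comment> \<open>The argument of soft_pos reaches 2, the start of its slope-1 range, where t is at
      most \<open>R\<^sup>2 / 2\<close>: this is how A was chosen.\<close>
    let ?g = "\<lambda>s. A * (?F (R\<^sup>2) - ?F (s + \<epsilon>\<^sup>2))"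
    let ?p = "\<lambda>s. soft_pos (?g s)"
    let ?p' = "\<lambda>s. soft_pos' (?g s) * (- A * (s + \<epsilon>\<^sup>2) powr (- n / 2))"
    let ?p'' = "\<lambda>s. soft_pos'' (?g s) * (- A * (s + \<epsilon>\<^sup>2) powr (- n / 2)) * (- A * (s + \<epsilon>\<^sup>2) powr (- n / 2))
       + soft_pos' (?g s) * (- A * ((- n / 2) * (s + \<epsilon>\<^sup>2) powr (- n / 2 - 1)))"
    let ?\<zeta> = "\<lambda>y. ?p ((y - x) \<bullet> (y - x))"
    have tpos: "s + \<epsilon>\<^sup>2 > 0" if "s \<ge> 0" for s using that eps by (simp add: add_nonneg_pos)
    have shift: "((\<lambda>s. s + \<epsilon>\<^sup>2) has_real_derivative 1) (at s)" for s
      by (auto intro!: derivative_eq_intros)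
    have g': "(?g has_real_derivative - A * (s + \<epsilon>\<^sup>2) powr (- n / 2)) (at s)" if "s \<ge> 0" for s
      using DERIV_cmult[OF DERIV_diff[OF DERIV_const DERIV_chain2[OF fund_profile_deriv[OF tpos[OF that], of n] shift]], of A "?F (R\<^sup>2)"]
      by simp
    have q': "((\<lambda>s. (s + \<epsilon>\<^sup>2) powr (- n / 2)) has_real_derivative (- n / 2) * (s + \<epsilon>\<^sup>2) powr (- n / 2 - 1)) (at s)" if "s \<ge> 0" for s
      using DERIV_chain2[OF has_real_derivative_powr[OF tpos[OF that], of "- n / 2"] shift] by simp
    have p1: "(?p has_real_derivative ?p' s) (at s)" if "s \<ge> 0" for s
      by (rule DERIV_chain2[OF soft_pos_deriv g'[OF that]])
    have p2: "(?p' has_real_derivative ?p'' s) (at s)" if "s \<ge> 0" for s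
      using DERIV_mult'[OF DERIV_chain2[OF soft_pos'_deriv g'[OF that]] DERIV_cmult[OF q'[OF that], of "- A"]]
      by (simp add: add.commute)
    have cg: "continuous_on {0..} ?g"
      by (intro continuous_at_imp_continuous_on ballI DERIV_isCont[OF g']) simp
    have p3: "continuous_on {0..} ?p''"
      by (intro continuous_intros continuous_on_compose2[OF soft_pos''_continuous[of UNIV] cg]
          continuous_on_compose2[OF soft_pos_continuous(2)[of UNIV] cg]) (use tpos in force)+
    note rad = radial_C2[where \<phi>="?p" and \<phi>'="?p'" and \<phi>''="?p''" and ?x0.0=x, OF p1 p2 p3]
    have zero: "?\<zeta> y = 0" if "y \<notin> cball x R" for y
    proof -
      have "R\<^sup>2 \<le> (norm (y - x))\<^sup>2" using that R by (intro power_mono) (auto simp: dist_norm norm_minus_commute)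
      then have "R\<^sup>2 \<le> (y - x) \<bullet> (y - x)" by (simp only: power2_norm_eq_inner)
      moreover have "\<epsilon>\<^sup>2 > 0" using eps by simp
      ultimately have "R\<^sup>2 < (y - x) \<bullet> (y - x) + \<epsilon>\<^sup>2" by linarith
      then have "?F (R\<^sup>2) < ?F ((y - x) \<bullet> (y - x) + \<epsilon>\<^sup>2)" using R by (intro fund_profile_strict_mono) auto
      then show ?thesis using A(1) by (intro soft_pos_0) (simp add: mult_le_0_iff)
    qed
    have lap: "laplacian ?\<zeta> y \<le> C - c * mollifier \<epsilon> (x - y)" for y
    proof -
      define s where "s = (y - x) \<bullet> (y - x)"
      define t where "t = s + \<epsilon>\<^sup>2"
      have s: "s \<ge> 0" unfolding s_def by simp
      have t: "t > 0" unfolding t_def by (rule tpos[OF s])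
      define P where "P = t powr (- n / 2)"
      have P1: "P * P = t powr (- n)" unfolding P_def by (simp add: powr_add[symmetric])
      define Q where "Q = t powr (- n / 2 - 1)"
      have PQ: "P = t * Q" unfolding P_def Q_def using t by (simp add: powr_diff)
      have Q: "Q \<ge> 0" unfolding Q_def by simp
      let ?k1 = "soft_pos' (?g s)" and ?k2 = "soft_pos'' (?g s)"
      have "laplacian ?\<zeta> y = 2 * n * (?k1 * (- A * P)) + 4 * s * (?k2 * (- A * P) * (- A * P) + ?k1 * (- A * ((- n / 2) * Q)))"
        using rad(2)[of y] unfolding s_def[symmetric] t_def[symmetric] P_def[symmetric] Q_def[symmetric] by (simp add: n_def[symmetric])
      also have "\<dots> = 2 * n * ?k1 * A * Q * (s - t) + 4 * s * ?k2 * A\<^sup>2 * (P * P)"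
        unfolding PQ by (simp add: algebra_simps power2_eq_square)
      also have "\<dots> = 4 * A\<^sup>2 * (s * ?k2 * (t powr (- n))) - 2 * n * A * (?k1 * \<epsilon>\<^sup>2 * Q)"
        unfolding P1 by (simp add: t_def algebra_simps)
      also have "4 * A\<^sup>2 * (s * ?k2 * (t powr (- n))) \<le> 4 * A\<^sup>2 * (R\<^sup>2 * 1 * (R\<^sup>2 / 2) powr (- n))"
      proof (cases "R\<^sup>2 / 2 < t \<and> t < R\<^sup>2")
        case True
        then have "s \<le> R\<^sup>2" unfolding t_def by (smt (verit) zero_le_power2)
        moreover have "t powr (- n) \<le> (R\<^sup>2 / 2) powr (- n)"
          using True n R by (intro powr_mono2') auto
        ultimately show ?thesis
          using soft_pos''_bounds(1,2) by (intro mult_left_mono mult_mono) auto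
      next
        case False
        have "?k2 = 0"
        proof (cases "t < R\<^sup>2")
          case True
          with False have "t \<le> R\<^sup>2 / 2" by simp
          then have "?F t \<le> ?F (R\<^sup>2 / 2)" using t by (intro fund_profile_mono)
          then have "A * (?F (R\<^sup>2) - ?F (R\<^sup>2 / 2)) \<le> ?g s"
            using A(1) unfolding t_def by (intro mult_left_mono) auto
          then show ?thesis using A(2) by (intro soft_pos''_bounds(4)) simp
        next
          case False
          then have "?F (R\<^sup>2) \<le> ?F t" using R by (intro fund_profile_mono) auto
          then show ?thesis using A(1) unfolding t_def by (intro soft_pos''_bounds(3)) (simp add: mult_le_0_iff)
        qed
        then show ?thesis by simp
      qed
      also have "4 * A\<^sup>2 * (R\<^sup>2 * 1 * (R\<^sup>2 / 2) powr (- n)) = C" unfolding C_def by simp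
      finally have le: "laplacian ?\<zeta> y \<le> C - 2 * n * A * (?k1 * \<epsilon>\<^sup>2 * Q)" by simp
      have "c * mollifier \<epsilon> (x - y) \<le> 2 * n * A * (?k1 * \<epsilon>\<^sup>2 * Q)"
      proof (cases "norm (x - y) < \<epsilon>")
        case False
        then have "mollifier \<epsilon> (x - y) = 0" by (intro mollifier_outside eps) simp
        then show ?thesis using A n Q soft_pos'_bounds(1) by simp
      next
        case True
        have "s = (norm (x - y))\<^sup>2" unfolding s_def by (simp add: power2_norm_eq_inner[symmetric] norm_minus_commute)
        also have "\<dots> \<le> \<epsilon>\<^sup>2" using True by (intro power_mono) auto
        finally have t2: "t \<le> 2 * \<epsilon>\<^sup>2" unfolding t_def by simp
        also have "2 * \<epsilon>\<^sup>2 \<le> R\<^sup>2 / 2" using power_mono[OF eps(2), of 2] eps(1) by (simp add: power2_eq_square)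
        finally have "t \<le> R\<^sup>2 / 2" .
        then have "?F t \<le> ?F (R\<^sup>2 / 2)" using t by (intro fund_profile_mono)
        then have "A * (?F (R\<^sup>2) - ?F (R\<^sup>2 / 2)) \<le> ?g s"
          using A(1) unfolding t_def by (intro mult_left_mono) auto
        then have k1: "?k1 = 1" using A(2) by (intro soft_pos'_values(2)) simp
        have q1: "(2 * \<epsilon>\<^sup>2) powr (- n / 2 - 1) \<le> Q"
          unfolding Q_def using t t2 n by (intro powr_mono2') auto
        have q2: "(2 * \<epsilon>\<^sup>2) powr (- n / 2 - 1) = 2 powr (- n / 2 - 1) * (\<epsilon>\<^sup>2) powr (- n / 2 - 1)"
          using eps by (simp add: powr_mult)
        have q3: "\<epsilon>\<^sup>2 * (\<epsilon>\<^sup>2) powr (- n / 2 - 1) = 1 / \<epsilon> ^ DIM('a)"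
        proof -
          have "\<epsilon>\<^sup>2 * (\<epsilon>\<^sup>2) powr (- n / 2 - 1) = (\<epsilon>\<^sup>2) powr (- n / 2)"
            using eps by (simp add: powr_diff)
          also have "\<dots> = (\<epsilon> powr 2) powr (- n / 2)" using eps by simp
          also have "\<dots> = \<epsilon> powr (- n)" by (simp add: powr_powr)
          also have "\<dots> = 1 / \<epsilon> ^ DIM('a)" using eps unfolding n_def by (simp add: powr_minus powr_realpow divide_inverse)
          finally show ?thesis .
        qed
        have "2 powr (- n / 2 - 1) * (1 / \<epsilon> ^ DIM('a)) = \<epsilon>\<^sup>2 * (2 * \<epsilon>\<^sup>2) powr (- n / 2 - 1)"
          unfolding q2 q3[symmetric] by (simp only: mult_ac)
        also have "\<dots> \<le> \<epsilon>\<^sup>2 * Q"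
          using q1 by (rule mult_left_mono) simp
        finally have Qe: "2 powr (- n / 2 - 1) * (1 / \<epsilon> ^ DIM('a)) \<le> \<epsilon>\<^sup>2 * Q" .
        have "c * mollifier \<epsilon> (x - y) \<le> c * (1 / (\<epsilon> ^ DIM('a) * m))"
          using c mollifier_le[OF eps(1), of "x - y"] unfolding m_def by (intro mult_left_mono) auto
        also have "\<dots> = 2 * n * A * (2 powr (- n / 2 - 1) * (1 / \<epsilon> ^ DIM('a)))"
          unfolding c_def using m by simp
        also have "\<dots> \<le> 2 * n * A * (\<epsilon>\<^sup>2 * Q)"
          using Qe n A by (intro mult_left_mono) auto
        finally show ?thesis using k1 by simp
      qed
      with le show ?thesis by linarith
    qed
    have "?\<zeta> \<in> C2_0 UNIV"
      by (rule C2_0_I[OF rad(1) compact_cball[of x R] _ zero]) auto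
    then show ?thesis using soft_pos_nonneg zero lap by (intro exI[of _ ?\<zeta>]) auto
  qed
  with C c show ?thesis by blast
qed

text \<open>Testing with the barrier centred at a point of \<open>K\<close> bounds the mollification of \<open>w\<close> there, uniformly in
  the scale. The conclusion is in the form that survives passage to the limit in \<open>L^1\<close>: it says
  that \<open>w \<le> C\<close> almost everywhere on the interior of \<open>K\<close>.\<close>

lemma subharmonic_locally_bounded:
  fixes w :: "'a::euclidean_space \<Rightarrow> real"
  assumes w: "integrable lborel w" "\<And>x. 0 \<le> w x" and \<Omega>: "open \<Omega>"
    and sub: "\<And>\<zeta>. \<zeta> \<in> C2_0 \<Omega> \<Longrightarrow> (\<And>x. 0 \<le> \<zeta> x) \<Longrightarrow> 0 \<le> (LBINT x. w x * laplacian \<zeta> x)"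
    and K: "compact K" "K \<subseteq> \<Omega>"
  shows "\<exists>C\<ge>0. \<forall>g. continuous_on UNIV g \<longrightarrow> (\<forall>x. 0 \<le> g x) \<longrightarrow> (\<forall>x. x \<notin> K \<longrightarrow> g x = 0) \<longrightarrow>
     (LBINT x. w x * g x) \<le> C * (LBINT x. g x)"
proof -
  obtain R where R0: "R > 0" "(\<Union>x\<in>K. cball x R) \<subseteq> \<Omega>"
    by (rule compact_subset_open_imp_cball_epsilon_subset[OF K(1) \<Omega> K(2)])
  then have R: "R > 0" "\<And>x. x \<in> K \<Longrightarrow> cball x R \<subseteq> \<Omega>" by (simp_all add: UN_subset_iff)
  obtain C c where cC: "c > 0" "0 \<le> C" and barrier: "\<And>(x::'a) \<epsilon>. 0 < \<epsilon> \<Longrightarrow> 2 * \<epsilon> \<le> R \<Longrightarrow>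
    (\<exists>\<zeta>. \<zeta> \<in> C2_0 UNIV \<and> (\<forall>y. 0 \<le> \<zeta> y) \<and> (\<forall>y. y \<notin> cball x R \<longrightarrow> \<zeta> y = 0) \<and>
      (\<forall>y. laplacian \<zeta> y \<le> C - c * mollifier \<epsilon> (x - y)))"
    using barrier_exists[OF R(1), where 'a='a] by blast
  define W where "W = (LBINT x. w x)"
  have W: "W \<ge> 0" unfolding W_def using w(2) by simp
  define D where "D = C * W / c"
  have D: "D \<ge> 0" unfolding D_def using cC W by simp
  have up: "conv w (mollifier \<epsilon>) x \<le> D" if x: "x \<in> K" and eps: "0 < \<epsilon>" "2 * \<epsilon> \<le> R" for x \<epsilon>
  proof -
    obtain \<zeta> where \<zeta>: "\<zeta> \<in> C2_0 UNIV" "\<And>y. 0 \<le> \<zeta> y" "\<And>y. y \<notin> cball x R \<Longrightarrow> \<zeta> y = 0"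
      "\<And>y. laplacian \<zeta> y \<le> C - c * mollifier \<epsilon> (x - y)"
      using barrier[OF eps, of x] by blast
    have \<zeta>2: "Ck_on 2 UNIV \<zeta>" using C2_0_D(1)[OF \<zeta>(1)] by simp
    have "\<zeta> \<in> C2_0 \<Omega>" by (rule C2_0_I[OF \<zeta>2 compact_cball[of x R] R(2)[OF x] \<zeta>(3)])
    then have sub_\<zeta>: "0 \<le> (LBINT y. w y * laplacian \<zeta> y)" by (rule sub) (rule \<zeta>(2))
    have cl: "continuous_on UNIV (laplacian \<zeta>)" by (rule continuous_on_laplacian[OF \<zeta>2])
    have l0: "laplacian \<zeta> y = 0" if "y \<notin> cball x R" for y
      using laplacian_outside[where f=\<zeta>, OF closed_cball \<zeta>(3) that] .
    obtain L where L: "\<And>y. \<bar>laplacian \<zeta> y\<bar> \<le> L" using continuous_cc_bounded[OF cl compact_cball l0] by blast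
    have ik: "integrable lborel (\<lambda>y. w y * mollifier \<epsilon> (x - y))"
      by (rule conv_integrand_integrable[OF w(1) mollifier_continuous[OF eps(1)] compact_cball mollifier_support[OF eps(1)]])
    have "(LBINT y. w y * laplacian \<zeta> y) \<le> (LBINT y. C * w y - c * (w y * mollifier \<epsilon> (x - y)))"
    proof (rule integral_mono)
      show "integrable lborel (\<lambda>y. w y * laplacian \<zeta> y)"
        by (rule integrable_mult_bounded[OF w(1), where B=L]) (use L cl in \<open>auto intro: borel_measurable_continuous_onI\<close>)
      show "integrable lborel (\<lambda>y. C * w y - c * (w y * mollifier \<epsilon> (x - y)))"
        using w(1) ik by auto
      show "w y * laplacian \<zeta> y \<le> C * w y - c * (w y * mollifier \<epsilon> (x - y))" for y
        using mult_left_mono[OF \<zeta>(4)[of y] w(2)[of y]] by (simp add: algebra_simps)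
    qed
    also have "\<dots> = C * W - c * conv w (mollifier \<epsilon>) x"
      unfolding W_def conv_def using w(1) ik by (subst Bochner_Integration.integral_diff) auto
    finally have "c * conv w (mollifier \<epsilon>) x \<le> C * W" using sub_\<zeta> by linarith
    then show ?thesis unfolding D_def using cC by (simp add: field_simps)
  qed
  show ?thesis
  proof (intro exI[of _ D] conjI D allI impI)
    fix g :: "'a \<Rightarrow> real" assume g: "continuous_on UNIV g" "\<forall>x. 0 \<le> g x" "\<forall>x. x \<notin> K \<longrightarrow> g x = 0"
    have g0: "g x = 0" if "x \<notin> K" for x using g(3) that by blast
    have gm[measurable]: "g \<in> borel_measurable borel" by (rule borel_measurable_continuous_onI[OF g(1)])
    obtain B where B: "B > 0" "\<And>x. \<bar>g x\<bar> \<le> B" using continuous_cc_bounded[OF g(1) K(1) g0] by blast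
    have ig: "integrable lborel g" by (rule integrable_cc[OF g(1) K(1) g0])
    have im: "integrable lborel (\<lambda>x. f x * g x)" if "integrable lborel f" for f
      by (rule integrable_mult_bounded[OF that, where B=B]) (use B in auto)
    show "(LBINT x. w x * g x) \<le> D * (LBINT x. g x)"
    proof (rule field_le_epsilon)
      fix e :: real assume e: "0 < e"
      then have eB: "e / B > 0" using B by simp
      obtain d where d: "d > 0" "\<And>\<epsilon>. 0 < \<epsilon> \<Longrightarrow> \<epsilon> < d \<Longrightarrow> integrable lborel (conv w (mollifier \<epsilon>)) \<and>
          (LBINT x. \<bar>conv w (mollifier \<epsilon>) x - w x\<bar>) \<le> e / B"
        using mollify_L1[OF w(1) eB] by blast
      define \<epsilon> where "\<epsilon> = min d R / 2"
      have \<epsilon>: "0 < \<epsilon>" "\<epsilon> < d" "2 * \<epsilon> \<le> R" unfolding \<epsilon>_def using d(1) R(1) by auto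
      define we where "we = conv w (mollifier \<epsilon>)"
      have we: "integrable lborel we" "(LBINT x. \<bar>we x - w x\<bar>) \<le> e / B"
        unfolding we_def using d(2)[OF \<epsilon>(1,2)] by auto
      have "(LBINT x. w x * g x) \<le> (LBINT x. D * g x + B * \<bar>we x - w x\<bar>)"
      proof (rule integral_mono[OF im[OF w(1)]])
        show "integrable lborel (\<lambda>x. D * g x + B * \<bar>we x - w x\<bar>)" using ig we w by auto
        fix x
        show "w x * g x \<le> D * g x + B * \<bar>we x - w x\<bar>"
        proof (cases "x \<in> K")
          case True
          have "w x * g x = we x * g x + g x * (w x - we x)" by (simp add: algebra_simps)
          also have "we x * g x \<le> D * g x"
            using up[OF True \<epsilon>(1,3)] g(2) unfolding we_def by (intro mult_right_mono) auto
          also have "g x * (w x - we x) \<le> \<bar>g x\<bar> * \<bar>we x - w x\<bar>"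
            by (metis abs_ge_self abs_minus_commute abs_mult)
          also have "\<dots> \<le> B * \<bar>we x - w x\<bar>" using B(2) by (intro mult_right_mono) auto
          finally show ?thesis by simp
        next
          case False
          then show ?thesis using B g0[OF False] by simp
        qed
      qed
      also have "\<dots> = D * (LBINT x. g x) + B * (LBINT x. \<bar>we x - w x\<bar>)"
        using ig we w by (subst Bochner_Integration.integral_add) auto
      also have "B * (LBINT x. \<bar>we x - w x\<bar>) \<le> B * (e / B)"
        using we(2) B by (intro mult_left_mono) auto
      finally show "(LBINT x. w x * g x) \<le> D * (LBINT x. g x) + e" using B by simp
    qed
  qed
qed

section \<open>The Calderon-Zygmund decomposition of a cube\<close>

text \<open>Half-open cubes, because the \<open>2 ^ DIM('a)\<close> subcells of half the side length partition such a cube exactly.\<close>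

definition cell :: "'a::euclidean_space \<Rightarrow> real \<Rightarrow> 'a set" where
  "cell a r = {x. \<forall>i\<in>Basis. a \<bullet> i \<le> x \<bullet> i \<and> x \<bullet> i < a \<bullet> i + r}"

lemma cell_borel [measurable]: "cell a r \<in> sets borel"
proof -
  have "cell a r = (\<Inter>i\<in>Basis. {x. a \<bullet> i \<le> x \<bullet> i} \<inter> {x. x \<bullet> i < a \<bullet> i + r})"
    by (auto simp: cell_def)
  also have "\<dots> \<in> sets borel" by (intro sets.finite_INT) auto
  finally show ?thesis .
qed

lemma box_subset_cell: "box a (a + r *\<^sub>R One) \<subseteq> cell a r"
  by (auto simp: cell_def box_def inner_simps)

lemma cell_subset_cbox: "cell a r \<subseteq> cbox a (a + r *\<^sub>R One)"
  by (auto simp: cell_def cbox_def inner_simps intro: less_imp_le)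

lemma emeasure_cube:
  assumes "r \<ge> 0"
  shows "emeasure lborel (cbox a (a + r *\<^sub>R One :: 'a::euclidean_space)) = ennreal (r ^ DIM('a))"
    "emeasure lborel (box a (a + r *\<^sub>R One :: 'a::euclidean_space)) = ennreal (r ^ DIM('a))"
  using assms by (auto simp: emeasure_lborel_cbox_eq emeasure_lborel_box_eq inner_simps)

lemma emeasure_cell:
  assumes "r \<ge> 0"
  shows "emeasure lborel (cell (a::'a::euclidean_space) r) = ennreal (r ^ DIM('a))"
proof (rule antisym)
  show "emeasure lborel (cell a r) \<le> ennreal (r ^ DIM('a))"
    using emeasure_mono[OF cell_subset_cbox[of a r], of lborel] emeasure_cube[OF assms, of a] by simp
  show "emeasure lborel (cell a r) \<ge> ennreal (r ^ DIM('a))"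
    using emeasure_mono[OF box_subset_cell[of a r], of lborel] emeasure_cube[OF assms, of a] by simp
qed

definition subcorner :: "'a::euclidean_space \<Rightarrow> real \<Rightarrow> 'a set \<Rightarrow> 'a" where
  "subcorner a r S = a + (r / 2) *\<^sub>R \<Sum>S"

lemma inner_sum_Basis_subset:
  assumes "S \<subseteq> Basis" "i \<in> Basis"
  shows "\<Sum>S \<bullet> i = (if i \<in> S then 1 else (0::real))"
proof -
  have "finite S" using assms(1) finite_Basis finite_subset by blast
  have "\<Sum>S \<bullet> i = (\<Sum>j\<in>S. j \<bullet> i)" by (simp add: inner_sum_left)
  also have "\<dots> = (\<Sum>j\<in>S. if j = i then 1 else 0)"
    using assms by (intro sum.cong) (auto simp: inner_Basis)
  finally show ?thesis using \<open>finite S\<close> by simp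
qed

lemma subcorner_inner:
  assumes "S \<subseteq> Basis" "i \<in> Basis"
  shows "subcorner a r S \<bullet> i = a \<bullet> i + (if i \<in> S then r / 2 else 0)"
  using inner_sum_Basis_subset[OF assms] by (simp add: subcorner_def inner_simps)

lemma cell_subdivide:
  assumes "r > 0"
  shows "cell a r = (\<Union>S\<in>Pow Basis. cell (subcorner a r S) (r / 2))"
proof (intro equalityI subsetI)
  fix x assume x: "x \<in> cell a r"
  let ?S = "{i\<in>Basis. a \<bullet> i + r / 2 \<le> x \<bullet> i}"
  have S: "?S \<subseteq> Basis" by auto
  have "x \<in> cell (subcorner a r ?S) (r / 2)"
    using x by (auto simp: cell_def subcorner_inner[OF S])
  then show "x \<in> (\<Union>S\<in>Pow Basis. cell (subcorner a r S) (r / 2))" using S by blast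
next
  fix x assume "x \<in> (\<Union>S\<in>Pow Basis. cell (subcorner a r S) (r / 2))"
  then obtain S where S: "S \<subseteq> Basis" "x \<in> cell (subcorner a r S) (r / 2)" by auto
  show "x \<in> cell a r"
    unfolding cell_def
  proof (intro CollectI ballI)
    fix i :: 'a assume i: "i \<in> Basis"
    then have "subcorner a r S \<bullet> i \<le> x \<bullet> i" "x \<bullet> i < subcorner a r S \<bullet> i + r / 2"
      using S(2) by (auto simp: cell_def)
    then show "a \<bullet> i \<le> x \<bullet> i \<and> x \<bullet> i < a \<bullet> i + r"
      using assms by (auto simp: subcorner_inner[OF S(1) i] split: if_splits)
  qed
qed

lemma cell_subdivide_disjoint:
  assumes "S \<subseteq> Basis" "T \<subseteq> Basis" "S \<noteq> T"
  shows "cell (subcorner a r S) (r / 2) \<inter> cell (subcorner a r T) (r / 2) = {}"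
proof -
  obtain i where i: "i \<in> Basis" "i \<in> S \<longleftrightarrow> i \<notin> T" using assms by blast
  show ?thesis
  proof (rule ccontr)
    assume "cell (subcorner a r S) (r / 2) \<inter> cell (subcorner a r T) (r / 2) \<noteq> {}"
    then obtain x where "x \<in> cell (subcorner a r S) (r / 2)" "x \<in> cell (subcorner a r T) (r / 2)" by auto
    then have "subcorner a r S \<bullet> i \<le> x \<bullet> i" "x \<bullet> i < subcorner a r S \<bullet> i + r / 2"
       "subcorner a r T \<bullet> i \<le> x \<bullet> i" "x \<bullet> i < subcorner a r T \<bullet> i + r / 2"
      using i(1) by (auto simp: cell_def)
    then show False
      using i(2) by (auto simp: subcorner_inner[OF assms(1) i(1)] subcorner_inner[OF assms(2) i(1)] split: if_splits)
  qed
qed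

lemma cbox_subcorner_subset:
  assumes "S \<subseteq> Basis" "r > 0"
  shows "cbox (subcorner a r S) (subcorner a r S + (r / 2) *\<^sub>R One) \<subseteq> cbox a (a + r *\<^sub>R One)"
  using assms by (auto simp: subset_box inner_simps subcorner_inner)

text \<open>A stopping-time argument, carried out as induction on the number \<open>m\<close> of bisections. A subcell on which
  the average of \<open>f\<close> exceeds \<open>lam\<close> is put into \<open>B\<close> as a whole; its mass is at most that of its parent,
  hence at most \<open>2 ^ DIM('a) * lam\<close> times its volume. The other subcells satisfy the induction
  hypothesis. After \<open>m\<close> bisections \<open>f\<close> oscillates by at most \<open>lam\<close> on each cell, and an average of at
  most \<open>lam\<close> leaves no room for values above \<open>2 * lam\<close>.\<close>

lemma Calderon_Zygmund_cell:
  fixes f :: "'a::euclidean_space \<Rightarrow> real" and Q :: "'a set" and M :: "'a \<Rightarrow> ennreal"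
  defines "V \<equiv> density lborel (\<lambda>y. ennreal (f y))"
  assumes f: "f \<in> borel_measurable borel" "\<And>x. 0 \<le> f x"
    and lam: "lam > 0"
    and osc: "\<And>x y. (\<forall>i\<in>Basis. \<bar>(x - y) \<bullet> i\<bar> < d) \<Longrightarrow> \<bar>f x - f y\<bar> \<le> lam"
    and M: "\<And>a r x. r > 0 \<Longrightarrow> cbox a (a + r *\<^sub>R One) \<subseteq> Q \<Longrightarrow> x \<in> cell a r \<Longrightarrow>
              emeasure V (cell a r) > ennreal lam * emeasure lborel (cell a r) \<Longrightarrow> M x > ennreal lam"
  shows "r > 0 \<Longrightarrow> r / 2 ^ m \<le> d \<Longrightarrow> cbox a (a + r *\<^sub>R One) \<subseteq> Q \<Longrightarrow>
     emeasure V (cell a r) \<le> ennreal lam * emeasure lborel (cell a r) \<Longrightarrow>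
     \<exists>B\<in>sets borel. B \<subseteq> cell a r \<and> (\<forall>x\<in>B. M x > ennreal lam) \<and>
       emeasure V (cell a r \<inter> {x. f x > 2 * lam}) \<le> ennreal (2 ^ DIM('a) * lam) * emeasure lborel B"
proof (induction m arbitrary: a r)
  case 0
  have [measurable]: "f \<in> borel_measurable borel" by fact
  have "f x \<le> 2 * lam" if x: "x \<in> cell a r" for x
  proof (rule ccontr)
    assume "\<not> f x \<le> 2 * lam"
    then have fx: "f x - lam > lam" by simp
    have "ennreal (f x - lam) * emeasure lborel (cell a r) = (\<integral>\<^sup>+y. ennreal (f x - lam) * indicator (cell a r) y \<partial>lborel)"
      by (subst nn_integral_cmult_indicator) auto
    also have "\<dots> \<le> (\<integral>\<^sup>+y. ennreal (f y) * indicator (cell a r) y \<partial>lborel)"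
    proof (intro nn_integral_mono)
      fix y
      show "ennreal (f x - lam) * indicator (cell a r) y \<le> ennreal (f y) * indicator (cell a r) y"
      proof (cases "y \<in> cell a r")
        case True
        have "\<forall>i\<in>Basis. \<bar>(x - y) \<bullet> i\<bar> < d"
        proof
          fix i :: 'a assume "i \<in> Basis"
          then have "a \<bullet> i \<le> x \<bullet> i" "x \<bullet> i < a \<bullet> i + r" "a \<bullet> i \<le> y \<bullet> i" "y \<bullet> i < a \<bullet> i + r"
            using x True by (auto simp: cell_def)
          then show "\<bar>(x - y) \<bullet> i\<bar> < d" using 0 by (simp add: inner_simps)
        qed
        from osc[OF this] have "f x - lam \<le> f y" by simp
        then show ?thesis by (intro mult_right_mono ennreal_leI) auto
      qed simp
    qed
    also have "\<dots> = emeasure V (cell a r)"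
      unfolding V_def by (subst emeasure_density) auto
    also have "\<dots> \<le> ennreal lam * emeasure lborel (cell a r)" by fact
    finally have "ennreal (f x - lam) * ennreal (r ^ DIM('a)) \<le> ennreal lam * ennreal (r ^ DIM('a))"
      using 0 by (simp add: emeasure_cell)
    then have "(f x - lam) * r ^ DIM('a) \<le> lam * r ^ DIM('a)"
      using 0 fx lam by (simp add: ennreal_mult[symmetric])
    then show False using fx 0 by simp
  qed
  then have "cell a r \<inter> {x. f x > 2 * lam} = {}" by force
  then show ?case by (intro bexI[of _ "{}"]) auto
next
  case (Suc m)
  have [measurable]: "f \<in> borel_measurable borel" by fact
  have sV: "sets V = sets borel" unfolding V_def by simp
  let ?c = "\<lambda>S. cell (subcorner a r S) (r / 2)"
  let ?A = "{x. f x > 2 * lam}"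
  have mA: "?A \<in> sets borel" by measurable
  have r: "r > 0" by fact
  have "\<exists>B\<in>sets borel. B \<subseteq> ?c S \<and> (\<forall>x\<in>B. M x > ennreal lam) \<and>
       emeasure V (?c S \<inter> ?A) \<le> ennreal (2 ^ DIM('a) * lam) * emeasure lborel B"
    if S: "S \<in> Pow Basis" for S
  proof (cases "emeasure V (?c S) \<le> ennreal lam * emeasure lborel (?c S)")
    case True
    show ?thesis
    proof (rule Suc.IH)
      show "cbox (subcorner a r S) (subcorner a r S + (r / 2) *\<^sub>R One) \<subseteq> Q"
        using cbox_subcorner_subset[of S r a] S r Suc.prems(3) by blast
    qed (use True r Suc.prems(2) in \<open>auto simp: field_simps\<close>)
  next
    case False
    then have gt: "emeasure V (?c S) > ennreal lam * emeasure lborel (?c S)" by simp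
    have "emeasure V (?c S \<inter> ?A) \<le> emeasure V (cell a r)"
      using S cell_subdivide[OF r, of a] by (intro emeasure_mono) (auto simp: sV)
    also have "\<dots> \<le> ennreal lam * ennreal (r ^ DIM('a))"
      using Suc.prems(4) r by (simp add: emeasure_cell)
    also have "\<dots> = ennreal (2 ^ DIM('a) * lam) * emeasure lborel (?c S)"
      using r lam by (simp add: emeasure_cell ennreal_mult[symmetric] power_divide)
    finally have "emeasure V (?c S \<inter> ?A) \<le> ennreal (2 ^ DIM('a) * lam) * emeasure lborel (?c S)" .
    moreover have "M x > ennreal lam" if "x \<in> ?c S" for x
    proof (rule M[OF _ _ that gt])
      show "cbox (subcorner a r S) (subcorner a r S + (r / 2) *\<^sub>R One) \<subseteq> Q"
        using cbox_subcorner_subset[of S r a] S r Suc.prems(3) by blast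
    qed (use r in simp)
    ultimately show ?thesis
      by (intro bexI[of _ "?c S"]) auto
  qed
  then obtain B where B: "\<And>S. S \<in> Pow Basis \<Longrightarrow> B S \<in> sets borel" "\<And>S. S \<in> Pow Basis \<Longrightarrow> B S \<subseteq> ?c S"
     "\<And>S x. S \<in> Pow Basis \<Longrightarrow> x \<in> B S \<Longrightarrow> M x > ennreal lam"
     "\<And>S. S \<in> Pow Basis \<Longrightarrow> emeasure V (?c S \<inter> ?A) \<le> ennreal (2 ^ DIM('a) * lam) * emeasure lborel (B S)"
    by metis
  have fin: "finite (Pow (Basis :: 'a set))" by simp
  have disjB: "disjoint_family_on B (Pow Basis)"
    unfolding disjoint_family_on_def
  proof (intro ballI impI)
    fix S T :: "'a set" assume ST: "S \<in> Pow Basis" "T \<in> Pow Basis" "S \<noteq> T"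
    then show "B S \<inter> B T = {}" using B(2)[OF ST(1)] B(2)[OF ST(2)] cell_subdivide_disjoint[of S T a r] by auto
  qed
  have "emeasure V (cell a r \<inter> ?A) = emeasure V (\<Union>S\<in>Pow Basis. ?c S \<inter> ?A)"
    by (subst cell_subdivide[OF r]) (auto intro!: arg_cong[where f="emeasure V"])
  also have "\<dots> \<le> (\<Sum>S\<in>Pow Basis. emeasure V (?c S \<inter> ?A))"
    using mA by (intro emeasure_subadditive_finite) (auto simp: sV)
  also have "\<dots> \<le> (\<Sum>S\<in>Pow Basis. ennreal (2 ^ DIM('a) * lam) * emeasure lborel (B S))"
    by (intro sum_mono B(4)) auto
  also have "\<dots> = ennreal (2 ^ DIM('a) * lam) * (\<Sum>S\<in>Pow Basis. emeasure lborel (B S))"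
    by (simp add: sum_distrib_left)
  also have "(\<Sum>S\<in>Pow Basis. emeasure lborel (B S)) = emeasure lborel (\<Union>S\<in>Pow Basis. B S)"
    using B(1) by (intro sum_emeasure disjB fin) auto
  finally have "emeasure V (cell a r \<inter> ?A) \<le> ennreal (2 ^ DIM('a) * lam) * emeasure lborel (\<Union>S\<in>Pow Basis. B S)" .
  moreover have "(\<Union>S\<in>Pow Basis. B S) \<subseteq> cell a r"
    using B(2) cell_subdivide[OF r, of a] by blast
  moreover have "(\<Union>S\<in>Pow Basis. B S) \<in> sets borel"
    using B(1) fin by (intro sets.finite_UN) auto
  ultimately show ?case using B(3) by blast
qed

section \<open>The L ln L bound by the maximal function\<close>

text \<open>Since \<open>ln 2 \<le> 1\<close>, the logarithm is at most the number of powers of two below \<open>t\<close>.\<close>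

lemma ln_plus_count:
  fixes t :: real
  assumes "0 \<le> t" "t \<le> 2 ^ n"
  shows "max 0 (ln t) \<le> 1 + (\<Sum>k<n. of_bool (2 * 2 ^ k < t))"
  using assms(2)
proof (induction n)
  case 0
  then have "ln t \<le> 0" using assms(1) by (cases "t = 0") auto
  then show ?case by simp
next
  case (Suc n)
  show ?case
  proof (cases "t \<le> 2 ^ n")
    case True
    then show ?thesis using Suc.IH by simp
  next
    case False
    have "of_bool (2 * 2 ^ k < t) = (1::real)" if "k < n" for k
    proof -
      have "(2::real) ^ Suc k \<le> 2 ^ n" using that by (intro power_increasing) auto
      with False show ?thesis by simp
    qed
    then have "(\<Sum>k<n. of_bool (2 * 2 ^ k < t)) = (\<Sum>k<n. 1::real)" by (intro sum.cong) auto
    then have s: "(\<Sum>k<Suc n. of_bool (2 * 2 ^ k < t)) \<ge> real n" by simp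
    have t: "t > 0" using False by (smt (verit) zero_less_power)
    then have "ln t \<le> ln (2 ^ Suc n)" using Suc.prems by simp
    also have "\<dots> = (real n + 1) * ln 2" by (subst ln_realpow) auto
    also have "\<dots> \<le> (real n + 1) * 1" using ln_2_less_1 by (intro mult_left_mono) auto
    finally show ?thesis using s by simp
  qed
qed

lemma dyadic_sum_le:
  fixes M :: ennreal
  assumes "\<And>k. k < n \<Longrightarrow> P k \<Longrightarrow> ennreal (2 ^ k) < M"
  shows "(\<Sum>k<n. ennreal (2 ^ k / 2) * of_bool (P k)) \<le> M"
  using assms
proof (induction n)
  case (Suc n)
  show ?case
  proof (cases "P n")
    case True
    have "(\<Sum>k<Suc n. ennreal (2 ^ k / 2) * of_bool (P k)) \<le> (\<Sum>k<Suc n. ennreal (2 ^ k / 2))"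
      by (intro sum_mono) auto
    also have "\<dots> = ennreal (\<Sum>k<Suc n. 2 ^ k / 2)" by (rule sum_ennreal) auto
    also have "(\<Sum>k<Suc n. 2 ^ k / 2) \<le> (2::real) ^ n"
    proof -
      have "(\<Sum>k<Suc n. 2 ^ k / 2) = (\<Sum>k<Suc n. (2::real) ^ k) / 2" by (rule sum_divide_distrib[symmetric])
      also have "(\<Sum>k<Suc n. (2::real) ^ k) = 2 ^ Suc n - 1" using geometric_sum[of "2::real" "Suc n"] by simp
      finally show ?thesis by simp
    qed
    then have "ennreal (\<Sum>k<Suc n. 2 ^ k / 2) \<le> ennreal (2 ^ n)" by (rule ennreal_leI)
    finally show ?thesis using Suc.prems[of n] True by (auto intro: order.trans less_imp_le)
  next
    case False
    then show ?thesis using Suc by simp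
  qed
qed simp

lemma cube_emeasure_lebesgue:
  assumes "r \<ge> 0"
  shows "emeasure lebesgue (cbox a (a + r *\<^sub>R One :: 'a::euclidean_space)) = ennreal (r ^ DIM('a))"
  using emeasure_cube(1)[OF assms, of a] by simp

lemma maximal_function_ge:
  fixes f g :: "'a::euclidean_space \<Rightarrow> real"
  assumes f: "f \<in> borel_measurable borel" and fg: "\<And>y. f y = \<bar>indicator \<Omega> y * g y\<bar>"
    and r: "r > 0" and Q: "cbox a (a + r *\<^sub>R One) \<subseteq> Q0" and x: "x \<in> cbox a (a + r *\<^sub>R One)"
  shows "emeasure (density lborel f) (cbox a (a + r *\<^sub>R One)) / ennreal (r ^ DIM('a)) \<le> maximal_function Q0 \<Omega> g x"
proof -
  let ?Q = "cbox a (a + r *\<^sub>R One)"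
  have mf: "f \<in> borel_measurable lborel" using f by simp
  have "emeasure (density lborel f) ?Q = (\<integral>\<^sup>+y. ennreal (f y) * indicator ?Q y \<partial>lborel)"
    using f by (subst emeasure_density) auto
  also have "\<dots> = (\<integral>\<^sup>+y. ennreal (f y) * indicator ?Q y \<partial>lebesgue)"
    by (rule nn_integral_completion[symmetric])
  also have "\<dots> = (\<integral>\<^sup>+y. ennreal \<bar>indicator \<Omega> y * g y\<bar> \<partial>lebesgue_on ?Q)"
    by (subst nn_integral_restrict_space) (auto simp: fg)
  finally have "emeasure (density lborel f) ?Q / ennreal (r ^ DIM('a)) =
    (\<integral>\<^sup>+y. ennreal \<bar>indicator \<Omega> y * g y\<bar> \<partial>lebesgue_on ?Q) / emeasure lebesgue ?Q"
    by (simp only: cube_emeasure_lebesgue[OF less_imp_le[OF r]])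
  also have "\<dots> \<le> maximal_function Q0 \<Omega> g x"
    unfolding maximal_function_def
    by (rule SUP_upper) (use r Q x in \<open>auto simp: is_cube_def\<close>)
  finally show ?thesis .
qed

text \<open>Stein's converse to the maximal theorem. The assumption \<open>j \<le> r0 ^ DIM('a)\<close> says that the average of \<open>f\<close>
  over \<open>Q0\<close> is at most 1, so that the decomposition is available at all levels \<open>2 ^ k\<close>. It bounds the mass
  of \<open>f\<close> above the level \<open>2 * 2 ^ k\<close> by a multiple of \<open>2 ^ k\<close> times the measure of a Borel set \<open>B k\<close> on
  which the maximal function exceeds \<open>2 ^ k\<close>. Summed over \<open>k\<close> and together with the
  integral of \<open>f\<close>, the masses dominate the integral of \<open>f ln\<^sup>+ f\<close> by \<open>ln_plus_count\<close>, while by \<open>dyadic_sum_le\<close> the functions \<open>2 ^ k / 2\<close> on \<open>B k\<close> add up to a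
  function below the maximal function.\<close>

lemma LlogL_le_maximal:
  fixes f g :: "'a::euclidean_space \<Rightarrow> real"
  assumes f: "continuous_on UNIV f" "compact K" "\<And>x. x \<notin> K \<Longrightarrow> f x = 0" and K: "K \<subseteq> \<Omega>" and \<Omega>: "open \<Omega>" "\<Omega> \<subseteq> Q0"
    and fg: "\<And>y. f y = \<bar>indicator \<Omega> y * g y\<bar>"
    and Q0: "Q0 = cbox a0 (a0 + r0 *\<^sub>R One)" "r0 > 0"
    and J: "(\<integral>\<^sup>+x. maximal_function Q0 \<Omega> g x \<partial>lebesgue_on Q0) \<le> ennreal j" "j \<le> r0 ^ DIM('a)" "0 \<le> j"
  shows "(LBINT x. f x) \<le> j"
    and "integrable lborel (\<lambda>x. f x * max 0 (ln (f x)))"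
    and "(LBINT x. f x * max 0 (ln (f x))) \<le> (1 + 2 * 2 ^ DIM('a)) * j"
proof -
  have mf[measurable]: "f \<in> borel_measurable borel" using f(1) by (rule borel_measurable_continuous_onI)
  have f0: "0 \<le> f x" for x unfolding fg by simp
  have fi: "integrable lborel f" by (rule integrable_cc[OF f])
  let ?M = "maximal_function Q0 \<Omega> g"
  define V where "V = density lborel (\<lambda>y. ennreal (f y))"
  have sV: "sets V = sets borel" unfolding V_def by simp
  have \<Omega>box: "\<Omega> \<subseteq> box a0 (a0 + r0 *\<^sub>R One)"
    using \<Omega> interior_maximal[of \<Omega> Q0] by (simp add: Q0 interior_cbox)
  then have Kcell: "K \<subseteq> cell a0 r0" using K box_subset_cell by blast
  have cellQ: "cell a0 r0 \<subseteq> Q0" using cell_subset_cbox Q0 by blast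
  have V_eq: "emeasure V A = (\<integral>\<^sup>+y. ennreal (f y) * indicator A y \<partial>lborel)" if "A \<in> sets borel" for A
    unfolding V_def using that by (subst emeasure_density) auto
  have VK: "emeasure V A = (\<integral>\<^sup>+y. ennreal (f y) \<partial>lborel)" if "A \<in> sets borel" "K \<subseteq> A" for A
  proof -
    have "f x = 0" if "x \<notin> A" for x using f(3)[of x] \<open>K \<subseteq> A\<close> that by blast
    then show ?thesis
      unfolding V_eq[OF that(1)] by (intro nn_integral_cong) (auto simp: indicator_def)
  qed
  define I where "I = (\<integral>\<^sup>+y. ennreal (f y) \<partial>lborel)"
  have I_eq: "I = ennreal (LBINT x. f x)"
    unfolding I_def by (rule nn_integral_eq_integral[OF fi]) (simp add: f0)
  define N :: real where "N = 2 ^ DIM('a)"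
  have r0N: "r0 ^ DIM('a) > 0" using Q0 by simp
  have Q0s: "Q0 \<inter> space lebesgue \<in> sets lebesgue" using Q0 by simp
  have "I \<le> (\<integral>\<^sup>+x. ?M x \<partial>lebesgue_on Q0)"
  proof -
    have "I / ennreal (r0 ^ DIM('a)) \<le> ?M x" if "x \<in> Q0" for x
      using maximal_function_ge[OF mf fg Q0(2), where ?Q0.0=Q0 and a=a0 and x=x] that Q0 VK[of Q0] Kcell cellQ
      unfolding V_def I_def by auto
    then have "(\<integral>\<^sup>+x. I / ennreal (r0 ^ DIM('a)) \<partial>lebesgue_on Q0) \<le> (\<integral>\<^sup>+x. ?M x \<partial>lebesgue_on Q0)"
      by (intro nn_integral_mono) auto
    moreover have "(\<integral>\<^sup>+x. I / ennreal (r0 ^ DIM('a)) \<partial>lebesgue_on Q0) = I / ennreal (r0 ^ DIM('a)) * ennreal (r0 ^ DIM('a))"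
      using Q0 cube_emeasure_lebesgue[of r0 a0] by (simp add: emeasure_restrict_space)
    moreover have "I / ennreal (r0 ^ DIM('a)) * ennreal (r0 ^ DIM('a)) = I"
    proof -
      have "ennreal (r0 ^ DIM('a)) / ennreal (r0 ^ DIM('a)) = 1"
        using Q0 by (intro ennreal_divide_self) auto
      then show ?thesis by (simp add: ennreal_divide_times)
    qed
    ultimately show ?thesis by simp
  qed
  then have "I \<le> ennreal j" using J(1) by order
  then show fj: "(LBINT x. f x) \<le> j" unfolding I_eq using J(3) by (simp add: ennreal_le_iff)
  have V0: "emeasure V (cell a0 r0) \<le> ennreal lam * emeasure lborel (cell a0 r0)" if "lam \<ge> 1" for lam
  proof -
    have "emeasure V (cell a0 r0) = I" unfolding I_def using VK Kcell by simp
    also have "\<dots> \<le> ennreal j" by fact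
    also have "\<dots> \<le> ennreal (lam * r0 ^ DIM('a))"
      using J(2) mult_right_mono[OF that, of "r0 ^ DIM('a)"] r0N by (intro ennreal_leI) linarith
    finally show ?thesis using Q0 that by (simp add: emeasure_cell ennreal_mult)
  qed
  have uc: "uniformly_continuous_on UNIV f" by (rule uniformly_continuous_cc[OF f])
  have "\<exists>B\<in>sets borel. B \<subseteq> cell a0 r0 \<and> (\<forall>x\<in>B. ?M x > ennreal lam) \<and>
       emeasure V (cell a0 r0 \<inter> {x. f x > 2 * lam}) \<le> ennreal (N * lam) * emeasure lborel B"
    if lam: "lam \<ge> 1" for lam
  proof -
    have lam0: "lam > 0" using lam by simp
    obtain d where d: "d > 0" "\<And>x y. dist y x < d \<Longrightarrow> dist (f y) (f x) < lam"
      using uc lam0 unfolding uniformly_continuous_on_def by (metis UNIV_I)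
    define d' where "d' = d / DIM('a)"
    have d': "d' > 0" unfolding d'_def using d(1) by simp
    obtain m where m: "r0 / 2 ^ m < d'"
    proof -
      obtain m where "(1/2) ^ m < d' / r0" using real_arch_pow_inv[of "d' / r0" "1/2"] d' Q0 by auto
      then show ?thesis using that[of m] Q0 by (simp add: field_simps power_divide)
    qed
    show ?thesis
      unfolding V_def N_def
    proof (rule Calderon_Zygmund_cell[where Q=Q0 and d=d' and m=m, OF mf f0 lam0])
      fix x y :: 'a assume xy: "\<forall>i\<in>Basis. \<bar>(x - y) \<bullet> i\<bar> < d'"
      have "norm (x - y) \<le> (\<Sum>i\<in>Basis. \<bar>(x - y) \<bullet> i\<bar>)" by (rule norm_le_l1)
      also have "\<dots> < (\<Sum>i\<in>(Basis::'a set). d')" using xy by (intro sum_strict_mono) auto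
      also have "\<dots> = d" unfolding d'_def by simp
      finally show "\<bar>f x - f y\<bar> \<le> lam" using d(2)[of x y] by (simp add: dist_norm)
    next
      fix a r and x :: 'a
      assume r: "r > 0" and sub: "cbox a (a + r *\<^sub>R One) \<subseteq> Q0" and x: "x \<in> cell a r"
        and gt: "emeasure (density lborel (\<lambda>x. ennreal (f x))) (cell a r) > ennreal lam * emeasure lborel (cell a r)"
      let ?L = "ennreal (r ^ DIM('a))"
      have L: "?L \<noteq> 0" "?L < top" using r by auto
      have "ennreal lam * ?L < emeasure (density lborel (\<lambda>x. ennreal (f x))) (cell a r)"
        using gt r by (simp add: emeasure_cell)
      also have "\<dots> \<le> emeasure (density lborel (\<lambda>x. ennreal (f x))) (cbox a (a + r *\<^sub>R One))"
        by (intro emeasure_mono cell_subset_cbox) simp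
      finally have "ennreal lam * ?L / ?L < emeasure (density lborel (\<lambda>x. ennreal (f x))) (cbox a (a + r *\<^sub>R One)) / ?L"
        using L by (metis (no_types, lifting) divide_less_ennreal ennreal_divide_times ennreal_divide_self mult.right_neutral)
      moreover have "ennreal lam * ?L / ?L = ennreal lam"
        using L by (simp add: ennreal_divide_times ennreal_times_divide[symmetric])
      ultimately have "ennreal lam < emeasure (density lborel (\<lambda>x. ennreal (f x))) (cbox a (a + r *\<^sub>R One)) / ?L" by simp
      also have "\<dots> \<le> ?M x"
        using x cell_subset_cbox by (intro maximal_function_ge[OF mf fg r sub]) blast
      finally show "?M x > ennreal lam" .
    qed (use Q0 m V0[OF lam] in \<open>auto simp: V_def\<close>)
  qed
  from this[of "2 ^ k" for k] obtain B where B: "\<And>k. B k \<in> sets borel" "\<And>k. B k \<subseteq> cell a0 r0"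
    "\<And>k x. x \<in> B k \<Longrightarrow> ?M x > ennreal (2 ^ k)"
    "\<And>k. emeasure V (cell a0 r0 \<inter> {x. f x > 2 * 2 ^ k}) \<le> ennreal (N * 2 ^ k) * emeasure lborel (B k)"
    by (simp add: one_le_power) metis
  obtain b where b: "\<And>x. f x \<le> b" using continuous_cc_bounded[OF f] f0 by (metis abs_of_nonneg)
  obtain n where n: "b < 2 ^ n" using real_arch_pow[of 2 b] by auto
  have point: "f x * max 0 (ln (f x)) \<le> f x + (\<Sum>k<n. f x * of_bool (2 * 2 ^ k < f x))" for x
  proof -
    have "max 0 (ln (f x)) \<le> 1 + (\<Sum>k<n. of_bool (2 * 2 ^ k < f x))"
      using b[of x] n by (intro ln_plus_count f0) simp
    from mult_left_mono[OF this f0[of x]] show ?thesis by (simp only: distrib_left sum_distrib_left mult_1_right)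
  qed
  have "(\<integral>\<^sup>+x. ennreal (f x * max 0 (ln (f x))) \<partial>lborel) \<le>
     (\<integral>\<^sup>+x. ennreal (f x) + (\<Sum>k<n. ennreal (f x) * indicator {x. f x > 2 * 2 ^ k} x) \<partial>lborel)"
  proof (intro nn_integral_mono)
    fix x
    have "ennreal (f x * max 0 (ln (f x))) \<le> ennreal (f x + (\<Sum>k<n. f x * of_bool (2 * 2 ^ k < f x)))"
      by (intro ennreal_leI point)
    also have "\<dots> = ennreal (f x) + (\<Sum>k<n. ennreal (f x * of_bool (2 * 2 ^ k < f x)))"
      using f0 by (subst ennreal_plus) (auto intro!: sum_nonneg)
    also have "\<dots> = ennreal (f x) + (\<Sum>k<n. ennreal (f x) * indicator {x. f x > 2 * 2 ^ k} x)"
      by (intro arg_cong2[where f="(+)"] sum.cong refl) (auto simp: indicator_def)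
    finally show "ennreal (f x * max 0 (ln (f x))) \<le> \<dots>" .
  qed
  also have "\<dots> = I + (\<Sum>k<n. emeasure V (cell a0 r0 \<inter> {x. f x > 2 * 2 ^ k}))"
  proof -
    have "emeasure V (cell a0 r0 \<inter> {x. f x > 2 * 2 ^ k}) = (\<integral>\<^sup>+x. ennreal (f x) * indicator {x. f x > 2 * 2 ^ k} x \<partial>lborel)" for k
    proof -
      have "f x = 0" if "x \<notin> cell a0 r0" for x using f(3)[of x] Kcell that by blast
      then show ?thesis
        by (subst V_eq) (auto intro!: nn_integral_cong simp: indicator_def)
    qed
    moreover have "(\<integral>\<^sup>+x. (\<Sum>k<n. ennreal (f x) * indicator {x. f x > 2 * 2 ^ k} x) \<partial>lborel) =
       (\<Sum>k<n. \<integral>\<^sup>+x. ennreal (f x) * indicator {x. f x > 2 * 2 ^ k} x \<partial>lborel)"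
      by (rule nn_integral_sum) measurable
    moreover have "(\<integral>\<^sup>+x. ennreal (f x) + (\<Sum>k<n. ennreal (f x) * indicator {x. f x > 2 * 2 ^ k} x) \<partial>lborel) =
       I + (\<integral>\<^sup>+x. (\<Sum>k<n. ennreal (f x) * indicator {x. f x > 2 * 2 ^ k} x) \<partial>lborel)"
      unfolding I_def by (rule nn_integral_add) measurable
    ultimately show ?thesis by simp
  qed
  finally have le1: "(\<integral>\<^sup>+x. ennreal (f x * max 0 (ln (f x))) \<partial>lborel) \<le>
     I + (\<Sum>k<n. emeasure V (cell a0 r0 \<inter> {x. f x > 2 * 2 ^ k}))" .
  have "(\<Sum>k<n. emeasure V (cell a0 r0 \<inter> {x. f x > 2 * 2 ^ k})) \<le> (\<Sum>k<n. ennreal (N * 2 ^ k) * emeasure lborel (B k))"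
    by (intro sum_mono B)
  also have "\<dots> = (\<Sum>k<n. ennreal (2 * N) * (\<integral>\<^sup>+x. ennreal (2 ^ k / 2) * indicator (B k) x \<partial>lborel))"
    using B(1) by (intro sum.cong refl)
      (auto simp: nn_integral_cmult_indicator mult.assoc[symmetric] ennreal_mult[symmetric] N_def)
  also have "\<dots> = ennreal (2 * N) * (\<integral>\<^sup>+x. (\<Sum>k<n. ennreal (2 ^ k / 2) * indicator (B k) x) \<partial>lborel)"
    using B(1) by (subst nn_integral_sum) (auto simp: sum_distrib_left)
  finally have le2: "(\<Sum>k<n. emeasure V (cell a0 r0 \<inter> {x. f x > 2 * 2 ^ k})) \<le>
     ennreal (2 * N) * (\<integral>\<^sup>+x. (\<Sum>k<n. ennreal (2 ^ k / 2) * indicator (B k) x) \<partial>lborel)" .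
  have "(\<integral>\<^sup>+x. (\<Sum>k<n. ennreal (2 ^ k / 2) * indicator (B k) x) \<partial>lborel) =
     (\<integral>\<^sup>+x. (\<Sum>k<n. ennreal (2 ^ k / 2) * indicator (B k) x) * indicator Q0 x \<partial>lborel)"
  proof (intro nn_integral_cong)
    fix x
    have "(\<Sum>k<n. ennreal (2 ^ k / 2) * indicator (B k) x) = 0" if "x \<notin> Q0"
      using that B(2) cellQ by (intro sum.neutral) (auto simp: indicator_def)
    then show "(\<Sum>k<n. ennreal (2 ^ k / 2) * indicator (B k) x) =
       (\<Sum>k<n. ennreal (2 ^ k / 2) * indicator (B k) x) * indicator Q0 x"
      by (cases "x \<in> Q0") simp_all
  qed
  also have "\<dots> = (\<integral>\<^sup>+x. (\<Sum>k<n. ennreal (2 ^ k / 2) * indicator (B k) x) \<partial>lebesgue_on Q0)"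
    by (simp add: nn_integral_restrict_space[OF Q0s] nn_integral_completion)
  also have "\<dots> \<le> (\<integral>\<^sup>+x. ?M x \<partial>lebesgue_on Q0)"
  proof (intro nn_integral_mono)
    fix x
    show "(\<Sum>k<n. ennreal (2 ^ k / 2) * indicator (B k) x) \<le> ?M x"
      using dyadic_sum_le[of n "\<lambda>k. x \<in> B k" "?M x"] B(3)[of x] by (simp add: indicator_def)
  qed
  also have "\<dots> \<le> ennreal j" by fact
  finally have le3: "(\<integral>\<^sup>+x. (\<Sum>k<n. ennreal (2 ^ k / 2) * indicator (B k) x) \<partial>lborel) \<le> ennreal j" .
  have "(\<integral>\<^sup>+x. ennreal (f x * max 0 (ln (f x))) \<partial>lborel) \<le> I + ennreal (2 * N) * ennreal j"
    using le1 add_left_mono[OF order.trans[OF le2 mult_left_mono[OF le3]], of I] by (auto intro: order.trans)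
  also have "\<dots> \<le> ennreal j + ennreal (2 * N) * ennreal j"
    by (intro add_right_mono) fact
  also have "\<dots> = ennreal ((1 + 2 * N) * j)"
    using J(3) by (simp add: N_def ennreal_mult[symmetric] ennreal_plus[symmetric] distrib_right del: ennreal_plus)
  finally have *: "(\<integral>\<^sup>+x. ennreal (f x * max 0 (ln (f x))) \<partial>lborel) \<le> ennreal ((1 + 2 * N) * j)" .
  show i: "integrable lborel (\<lambda>x. f x * max 0 (ln (f x)))"
    by (rule integrableI_nonneg) (use f0 * in \<open>auto simp: le_less_trans[OF *]\<close>)
  have "(\<integral>\<^sup>+x. ennreal (f x * max 0 (ln (f x))) \<partial>lborel) = ennreal (LBINT x. f x * max 0 (ln (f x)))"
    by (rule nn_integral_eq_integral[OF i]) (simp add: f0)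
  with * show "(LBINT x. f x * max 0 (ln (f x))) \<le> (1 + 2 * 2 ^ DIM('a)) * j"
    using J(3) by (simp add: N_def ennreal_le_iff)
qed

text \<open>The convex conjugate of \<open>exp a - 1\<close> is \<open>b ln b - b + 1\<close>, which for \<open>b \<ge> 1\<close> is at most \<open>b ln b\<close>.\<close>

lemma Young_exp:
  fixes a b :: real
  assumes "0 \<le> a" "0 \<le> b"
  shows "a * b \<le> exp a - 1 + b * max 0 (ln b)"
proof (cases "b \<le> 1")
  case True
  have "a * b \<le> a * 1" using assms True by (intro mult_left_mono) auto
  also have "\<dots> \<le> exp a - 1" using exp_ge_add_one_self[of a] by linarith
  finally show ?thesis using assms by (smt (verit) mult_nonneg_nonneg)
next
  case False
  then have b: "b > 0" "ln b > 0" by auto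
  have "1 + (a - ln b) \<le> exp (a - ln b)" by (rule exp_ge_add_one_self)
  also have "\<dots> = exp a / b" using b by (simp add: exp_diff)
  finally have "b * (1 + (a - ln b)) \<le> exp a" using b by (simp add: field_simps)
  then show ?thesis using False b by (simp add: algebra_simps)
qed

section \<open>Classical test functions in the weak formulation\<close>

lemma integral_lebesgue_on_eq_lborel:
  fixes g :: "'a::euclidean_space \<Rightarrow> real"
  assumes "g \<in> borel_measurable borel" "\<Omega> \<in> sets borel" "\<And>x. x \<notin> \<Omega> \<Longrightarrow> g x = 0"
  shows "(\<integral>x. g x \<partial>lebesgue_on \<Omega>) = (LBINT x. g x)"
proof -
  have "(\<integral>x. g x \<partial>lebesgue_on \<Omega>) = (\<integral>x. indicator \<Omega> x *\<^sub>R g x \<partial>lebesgue)"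
    using assms(2) by (intro integral_restrict_space) auto
  also have "\<dots> = (\<integral>x. g x \<partial>lebesgue)"
    using assms(3) by (intro Bochner_Integration.integral_cong) (auto simp: indicator_def)
  also have "\<dots> = (LBINT x. g x)"
    using assms(1) by (intro integral_completion) simp
  finally show ?thesis .
qed

lemma Linf_cc:
  fixes f :: "'a::euclidean_space \<Rightarrow> real"
  assumes "continuous_on UNIV f" "compact K" "\<And>x. x \<notin> K \<Longrightarrow> f x = 0"
  shows "f \<in> Linf \<Omega>"
proof -
  obtain B where "\<And>x. \<bar>f x\<bar> \<le> B" using continuous_cc_bounded[OF assms] by blast
  moreover have "f \<in> borel_measurable (lebesgue_on \<Omega>)"
    using borel_measurable_continuous_onI[OF assms(1)]
    by (intro measurable_restrict_space1 measurable_completion) simp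
  ultimately show ?thesis unfolding Linf_def by blast
qed

lemma locally_integrable_cc:
  fixes f :: "'a::euclidean_space \<Rightarrow> real"
  assumes "continuous_on UNIV f" "compact K" "\<And>x. x \<notin> K \<Longrightarrow> f x = 0"
  shows "locally_integrable_on \<Omega> f"
  unfolding locally_integrable_on_def
proof (intro allI impI)
  fix S :: "'a set" assume S: "compact S"
  have Sl: "S \<in> sets lebesgue" using lmeasurable_compact[OF S] by auto
  have "integrable lebesgue f"
    using integrable_cc[OF assms] by (subst integrable_completion) auto
  then have "integrable lebesgue (\<lambda>x. indicator S x *\<^sub>R f x)"
    using Sl by (intro integrable_mult_indicator)
  then show "integrable (lebesgue_on S) f"
    using Sl by (subst integrable_restrict_space) auto
qed

lemma weak_partial_cc:
  fixes f :: "'a::euclidean_space \<Rightarrow> real"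
  assumes f: "Ck_on 1 UNIV f" "compact K" "\<And>x. x \<notin> K \<Longrightarrow> f x = 0" and i: "i \<in> Basis" and \<Omega>: "open \<Omega>"
  shows "has_weak_partial \<Omega> i f (partial_deriv i f)"
  unfolding has_weak_partial_def
proof (intro conjI ballI)
  have cf: "continuous_on UNIV f" and cp: "continuous_on UNIV (partial_deriv i f)"
    using f(1) i Ck_on_imp_continuous[OF f(1)] by auto
  have p0: "partial_deriv i f x = 0" if "x \<notin> K" for x
    using partial_deriv_outside(1)[where f=f, OF compact_imp_closed[OF f(2)] f(3) that] .
  show "locally_integrable_on \<Omega> f" by (rule locally_integrable_cc[OF cf f(2,3)])
  show "locally_integrable_on \<Omega> (partial_deriv i f)" by (rule locally_integrable_cc[OF cp f(2) p0])
  fix \<phi> assume "\<phi> \<in> Cinf_0 \<Omega>"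
  then have "\<phi> \<in> C2_0 \<Omega>" unfolding Cinf_0_def C2_0_def smooth_on_def by blast
  note C = C2_0_D[OF this \<Omega>]
  obtain S where S: "compact S" "S \<subseteq> \<Omega>" "\<And>x. x \<notin> S \<Longrightarrow> \<phi> x = 0" using C(2) by blast
  have \<phi>1: "Ck_on 1 UNIV \<phi>" by (rule Ck_on_2_1[OF C(1)])
  have c\<phi>: "continuous_on UNIV \<phi>" and cp\<phi>: "continuous_on UNIV (partial_deriv i \<phi>)"
    using \<phi>1 i Ck_on_imp_continuous[OF \<phi>1] by auto
  have p\<phi>0: "partial_deriv i \<phi> x = 0" if "x \<notin> S" for x
    using partial_deriv_outside(1)[where f=\<phi>, OF compact_imp_closed[OF S(1)] S(3) that] .
  have "(\<integral>x. f x * partial_deriv i \<phi> x \<partial>lebesgue_on \<Omega>) = (LBINT x. f x * partial_deriv i \<phi> x)"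
    using S(2) p\<phi>0 \<Omega>
    by (intro integral_lebesgue_on_eq_lborel borel_measurable_continuous_onI continuous_intros cf cp\<phi>) auto
  also have "\<dots> = - (LBINT x. partial_deriv i f x * \<phi> x)"
    by (rule integration_by_parts_cc[OF f(1) \<phi>1 i S(1,3)])
  also have "(LBINT x. partial_deriv i f x * \<phi> x) = (\<integral>x. partial_deriv i f x * \<phi> x \<partial>lebesgue_on \<Omega>)"
    using S(2,3) \<Omega>
    by (intro integral_lebesgue_on_eq_lborel[symmetric] borel_measurable_continuous_onI continuous_intros cp c\<phi>) auto
  finally show "(\<integral>x. f x * partial_deriv i \<phi> x \<partial>lebesgue_on \<Omega>) = - (\<integral>x. partial_deriv i f x * \<phi> x \<partial>lebesgue_on \<Omega>)" .
qed

lemma C2_0_test_function: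
  fixes \<zeta> :: "'a::euclidean_space \<Rightarrow> real"
  assumes \<zeta>: "\<zeta> \<in> C2_0 \<Omega>" and \<Omega>: "open \<Omega>"
  shows "\<zeta> \<in> W1_inf_0 \<Omega> \<inter> W_inf 2 \<Omega>" and "has_weak_laplacian \<Omega> \<zeta> (laplacian \<zeta>)"
proof -
  have 2: "Ck_on 2 UNIV \<zeta>" by (rule C2_0_D(1)[OF \<zeta> \<Omega>])
  have 1: "Ck_on 1 UNIV \<zeta>" by (rule Ck_on_2_1[OF 2])
  obtain K where K: "compact K" "K \<subseteq> \<Omega>" "\<And>x. x \<notin> K \<Longrightarrow> \<zeta> x = 0" using C2_0_D(2)[OF \<zeta> \<Omega>] by blast
  have p1: "Ck_on 1 UNIV (partial_deriv i \<zeta>)" if "i \<in> Basis" for i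
    using 2 that unfolding Ck_on_2_iff by blast
  have p0: "partial_deriv i \<zeta> x = 0" if "x \<notin> K" for x i
    using partial_deriv_outside(1)[where f=\<zeta>, OF compact_imp_closed[OF K(1)] K(3) that] .
  have p00: "partial_deriv j (partial_deriv i \<zeta>) x = 0" if "x \<notin> K" for x i j
    using partial_deriv_outside(1)[where f="partial_deriv i \<zeta>", OF compact_imp_closed[OF K(1)] p0 that] .
  have cpp: "continuous_on UNIV (partial_deriv j (partial_deriv i \<zeta>))" if "i \<in> Basis" "j \<in> Basis" for i j
    using p1[OF that(1)] that(2) by auto
  have w1: "has_weak_partial \<Omega> i \<zeta> (partial_deriv i \<zeta>)" if "i \<in> Basis" for i
    by (rule weak_partial_cc[OF 1 K(1,3) that \<Omega>])
  have w2: "has_weak_partial \<Omega> j (partial_deriv i \<zeta>) (partial_deriv j (partial_deriv i \<zeta>))"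
    if "i \<in> Basis" "j \<in> Basis" for i j
    by (rule weak_partial_cc[OF p1[OF that(1)] K(1) p0 that(2) \<Omega>])
  have L0: "\<zeta> \<in> Linf \<Omega>" by (rule Linf_cc[OF Ck_on_imp_continuous[OF 1] K(1,3)])
  have L1: "partial_deriv i \<zeta> \<in> Linf \<Omega>" if "i \<in> Basis" for i
    by (rule Linf_cc[OF Ck_on_imp_continuous[OF p1[OF that]] K(1) p0])
  have L2: "partial_deriv j (partial_deriv i \<zeta>) \<in> Linf \<Omega>" if "i \<in> Basis" "j \<in> Basis" for i j
    by (rule Linf_cc[OF cpp[OF that] K(1) p00])
  have W1: "partial_deriv i \<zeta> \<in> W_inf (Suc 0) \<Omega>" if "i \<in> Basis" for i
    using L1[OF that] L2[OF that] w2[OF that] by auto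
  have "\<zeta> \<in> W_inf 1 \<Omega>" using L0 L1 w1 by auto
  moreover have "\<zeta> \<in> W_inf 2 \<Omega>"
    unfolding numeral_2_eq_2 W_inf.simps(2)[of "Suc 0"] using L0 W1 w1 by blast
  moreover have "continuous_on (closure \<Omega>) \<zeta>"
    using continuous_on_subset[OF Ck_on_imp_continuous[OF 1]] by blast
  moreover have "\<zeta> x = 0" if "x \<in> frontier \<Omega>" for x
    using that K(2,3) \<Omega> by (auto simp: frontier_def interior_open)
  ultimately show "\<zeta> \<in> W1_inf_0 \<Omega> \<inter> W_inf 2 \<Omega>" unfolding W1_inf_0_def by blast
  show "has_weak_laplacian \<Omega> \<zeta> (laplacian \<zeta>)"
    unfolding has_weak_laplacian_def
    by (rule exI[of _ "\<lambda>i. partial_deriv i \<zeta>"], rule exI[of _ "\<lambda>i. partial_deriv i (partial_deriv i \<zeta>)"])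
       (use w1 w2 in \<open>auto simp: laplacian_def[abs_def]\<close>)
qed

text \<open>\<open>U\<close> is a Borel representative of \<open>u\<close>, extended by zero, so that all later integrals are
  over the whole space with respect to Lebesgue-Borel measure.\<close>

lemma weak_solution_lborel:
  fixes u :: "'a::euclidean_space \<Rightarrow> real"
  assumes u: "weak_solution \<Omega> \<mu> u" and \<Omega>: "open \<Omega>" "bounded \<Omega>"
  obtains U where "integrable lborel U" "integrable lborel (\<lambda>x. indicator \<Omega> x * exp (U x))"
    "\<And>x. x \<notin> \<Omega> \<Longrightarrow> U x = 0"
    "\<And>\<zeta>. \<zeta> \<in> C2_0 \<Omega> \<Longrightarrow>
      (LBINT x. - U x * laplacian \<zeta> x + indicator \<Omega> x * (exp (U x) - 1) * \<zeta> x) = (\<integral>x. \<zeta> x \<partial>\<mu>)"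
proof -
  have \<Omega>m[measurable]: "\<Omega> \<in> sets borel" using \<Omega> by auto
  have \<Omega>l: "\<Omega> \<inter> space lebesgue \<in> sets lebesgue" by simp
  have iu: "integrable (lebesgue_on \<Omega>) u" "integrable (lebesgue_on \<Omega>) (\<lambda>x. exp (u x))"
    using u unfolding weak_solution_def by auto
  then have iu': "integrable lebesgue (\<lambda>x. indicator \<Omega> x *\<^sub>R u x)" "integrable lebesgue (\<lambda>x. indicator \<Omega> x *\<^sub>R exp (u x))"
    by (simp_all only: integrable_restrict_space[OF \<Omega>l])
  obtain g where g: "g \<in> borel_measurable lborel" "AE x in lborel. indicator \<Omega> x *\<^sub>R u x = g x"
    using completion_ex_borel_measurable_real[OF borel_measurable_integrable[OF iu'(1)]] by blast
  define U where "U = (\<lambda>x. indicator \<Omega> x * g x)"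
  have Um[measurable]: "U \<in> borel_measurable borel" unfolding U_def using g(1) by auto
  have AEU: "AE x in lborel. x \<in> \<Omega> \<longrightarrow> u x = U x"
    using g(2) by eventually_elim (auto simp: U_def)
  have AEU': "AE x in lebesgue. x \<in> \<Omega> \<longrightarrow> u x = U x"
    using AEU by (rule AE_completion)
  have meas: "f \<in> borel_measurable lebesgue" if "f \<in> borel_measurable borel" for f :: "'a \<Rightarrow> real"
    using that by (intro measurable_completion) simp
  have i1: "integrable lborel U"
  proof -
    have "integrable lebesgue U"
      by (rule integrable_cong_AE_imp[OF iu'(1) meas[OF Um]])
        (use AEU' in \<open>eventually_elim, auto simp: U_def indicator_def\<close>)
    then show ?thesis by (subst (asm) integrable_completion) auto
  qed
  have i2: "integrable lborel (\<lambda>x. indicator \<Omega> x * exp (U x))"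
  proof -
    have m: "(\<lambda>x. indicator \<Omega> x * exp (U x)) \<in> borel_measurable borel" by measurable
    have "integrable lebesgue (\<lambda>x. indicator \<Omega> x * exp (U x))"
      by (rule integrable_cong_AE_imp[OF iu'(2) meas[OF m]])
        (use AEU' in \<open>eventually_elim, auto simp: indicator_def\<close>)
    then show ?thesis by (subst (asm) integrable_completion) auto
  qed
  have "(LBINT x. - U x * laplacian \<zeta> x + indicator \<Omega> x * (exp (U x) - 1) * \<zeta> x) = (\<integral>x. \<zeta> x \<partial>\<mu>)"
    if \<zeta>: "\<zeta> \<in> C2_0 \<Omega>" for \<zeta>
  proof -
    have 2: "Ck_on 2 UNIV \<zeta>" by (rule C2_0_D(1)[OF \<zeta> \<Omega>(1)])
    note [measurable] = borel_measurable_continuous_onI[OF Ck_on_imp_continuous[OF 2]]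
      borel_measurable_continuous_onI[OF continuous_on_laplacian[OF 2]]
    have "(\<integral>x. \<zeta> x \<partial>\<mu>) = (\<integral>x. - u x * laplacian \<zeta> x + (exp (u x) - 1) * \<zeta> x \<partial>lebesgue_on \<Omega>)"
      using u C2_0_test_function[OF \<zeta> \<Omega>(1)] unfolding weak_solution_def by auto
    also have "\<dots> = (\<integral>x. - U x * laplacian \<zeta> x + indicator \<Omega> x * (exp (U x) - 1) * \<zeta> x \<partial>lebesgue_on \<Omega>)"
    proof (rule integral_cong_AE)
      have um: "u \<in> borel_measurable (lebesgue_on \<Omega>)" using iu(1) by auto
      have r: "f \<in> borel_measurable (lebesgue_on \<Omega>)" if "f \<in> borel_measurable borel" for f :: "'a \<Rightarrow> real"
        using meas[OF that] by (rule measurable_restrict_space1)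
      show "(\<lambda>x. - u x * laplacian \<zeta> x + (exp (u x) - 1) * \<zeta> x) \<in> borel_measurable (lebesgue_on \<Omega>)"
        using um r[of \<zeta>] r[of "laplacian \<zeta>"] by simp
      show "(\<lambda>x. - U x * laplacian \<zeta> x + indicator \<Omega> x * (exp (U x) - 1) * \<zeta> x) \<in> borel_measurable (lebesgue_on \<Omega>)"
        by (rule r) measurable
      have "AE x in lebesgue_on \<Omega>. x \<in> \<Omega> \<and> u x = U x"
        using AEU' by (subst AE_restrict_space_iff[OF \<Omega>l]) auto
      then show "AE x in lebesgue_on \<Omega>. - u x * laplacian \<zeta> x + (exp (u x) - 1) * \<zeta> x =
          - U x * laplacian \<zeta> x + indicator \<Omega> x * (exp (U x) - 1) * \<zeta> x"
        by eventually_elim auto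
    qed
    also have "\<dots> = (LBINT x. - U x * laplacian \<zeta> x + indicator \<Omega> x * (exp (U x) - 1) * \<zeta> x)"
    proof (rule integral_lebesgue_on_eq_lborel[OF _ \<Omega>m])
      show "(\<lambda>x. - U x * laplacian \<zeta> x + indicator \<Omega> x * (exp (U x) - 1) * \<zeta> x) \<in> borel_measurable borel"
        by measurable
      show "- U x * laplacian \<zeta> x + indicator \<Omega> x * (exp (U x) - 1) * \<zeta> x = 0" if "x \<notin> \<Omega>" for x
        using that by (simp add: U_def)
    qed
    finally show ?thesis by simp
  qed
  moreover have "U x = 0" if "x \<notin> \<Omega>" for x using that by (simp add: U_def)
  ultimately show ?thesis using that i1 i2 by blast
qed

lemma inner_regular_null:
  fixes \<mu> :: "'a::euclidean_space measure"
  assumes \<mu>: "\<mu> \<in> bounded_radon_measures \<Omega>" and \<Omega>: "\<Omega> \<in> sets borel" and E: "E \<in> sets borel" "E \<subseteq> \<Omega>"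
    and K: "\<And>K. compact K \<Longrightarrow> K \<subseteq> E \<Longrightarrow> measure \<mu> K = 0"
  shows "measure \<mu> E = 0"
proof -
  have s: "sets \<mu> = sets (restrict_space borel \<Omega>)" and fin: "finite_measure \<mu>"
    using \<mu> unfolding bounded_radon_measures_def by auto
  interpret finite_measure \<mu> by fact
  have sp: "space \<mu> = \<Omega>" using sets_eq_imp_space_eq[OF s] by (simp add: space_restrict_space)
  have id: "(\<lambda>x. x) \<in> \<mu> \<rightarrow>\<^sub>M borel"
    unfolding measurable_cong_sets[OF s refl] by (rule measurable_restrict_space1) simp
  let ?D = "distr \<mu> borel (\<lambda>x. x)"
  have D: "emeasure ?D A = emeasure \<mu> A" if "A \<in> sets borel" "A \<subseteq> \<Omega>" for A
    using that id by (subst emeasure_distr) (auto simp: sp Int_absorb2)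
  have "emeasure ?D E = (SUP K\<in>{K. K \<subseteq> E \<and> compact K}. emeasure ?D K)"
  proof (rule inner_regular)
    show "emeasure ?D (space ?D) \<noteq> \<infinity>"
      using finite_measure.emeasure_finite[OF finite_measure_distr[OF id], of UNIV] by simp
  qed (use E in auto)
  also have "\<dots> = 0"
  proof -
    have "emeasure ?D K = 0" if "K \<subseteq> E" "compact K" for K
      using D[of K] K[OF that(2,1)] that E by (auto simp: emeasure_eq_measure compact_imp_closed)
    then show ?thesis by (auto intro!: SUP_eq_const simp: bot_ennreal intro: exI[of _ "{}"])
  qed
  finally show ?thesis using D[OF E] by (simp add: emeasure_eq_measure)
qed

section \<open>Good measures and sets of zero capacity\<close>

lemma integral_mult_AMGM:
  fixes a b :: "'a \<Rightarrow> real"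
  assumes s: "s > 0" and i: "integrable M (\<lambda>x. (a x)\<^sup>2)" "integrable M (\<lambda>x. (b x)\<^sup>2)"
    and m: "a \<in> borel_measurable M" "b \<in> borel_measurable M"
  shows "integrable M (\<lambda>x. \<bar>a x\<bar> * \<bar>b x\<bar>)"
    and "(\<integral>x. \<bar>a x\<bar> * \<bar>b x\<bar> \<partial>M) \<le> s * (\<integral>x. (a x)\<^sup>2 \<partial>M) + (\<integral>x. (b x)\<^sup>2 \<partial>M) / s"
proof -
  have le: "\<bar>a x\<bar> * \<bar>b x\<bar> \<le> s * (a x)\<^sup>2 + (b x)\<^sup>2 / s" for x
  proof -
    have "0 \<le> (s * \<bar>a x\<bar> - \<bar>b x\<bar>)\<^sup>2" by simp
    then have "2 * (s * (\<bar>a x\<bar> * \<bar>b x\<bar>)) \<le> s\<^sup>2 * (a x)\<^sup>2 + (b x)\<^sup>2"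
      by (simp add: power2_eq_square algebra_simps)
    moreover have "0 \<le> s * (\<bar>a x\<bar> * \<bar>b x\<bar>)" using s by simp
    ultimately have "s * (\<bar>a x\<bar> * \<bar>b x\<bar>) \<le> s\<^sup>2 * (a x)\<^sup>2 + (b x)\<^sup>2" by linarith
    also have "\<dots> = s * (s * (a x)\<^sup>2 + (b x)\<^sup>2 / s)" using s by (simp add: field_simps power2_eq_square)
    finally show ?thesis using s by simp
  qed
  have i': "integrable M (\<lambda>x. s * (a x)\<^sup>2 + (b x)\<^sup>2 / s)" using i by auto
  show 1: "integrable M (\<lambda>x. \<bar>a x\<bar> * \<bar>b x\<bar>)"
    by (rule Bochner_Integration.integrable_bound[OF i']) (use m le in \<open>auto intro!: AE_I2 order.trans[OF le abs_ge_self]\<close>)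
  have "(\<integral>x. \<bar>a x\<bar> * \<bar>b x\<bar> \<partial>M) \<le> (\<integral>x. s * (a x)\<^sup>2 + (b x)\<^sup>2 / s \<partial>M)"
    by (rule integral_mono[OF 1 i' le])
  also have "\<dots> = s * (\<integral>x. (a x)\<^sup>2 \<partial>M) + (\<integral>x. (b x)\<^sup>2 \<partial>M) / s"
    using i by (subst Bochner_Integration.integral_add) auto
  finally show "(\<integral>x. \<bar>a x\<bar> * \<bar>b x\<bar> \<partial>M) \<le> s * (\<integral>x. (a x)\<^sup>2 \<partial>M) + (\<integral>x. (b x)\<^sup>2 \<partial>M) / s" .
qed

lemma exp_tail_small:
  fixes U :: "'a::euclidean_space \<Rightarrow> real"
  assumes U: "U \<in> borel_measurable borel" "integrable lborel (\<lambda>x. indicator \<Omega> x * exp (U x))"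
    and \<Omega>: "\<Omega> \<in> sets borel" and U0: "\<And>x. x \<notin> \<Omega> \<Longrightarrow> U x = 0" and \<delta>: "\<delta> > 0"
  shows "\<exists>A>0. integrable lborel (\<lambda>x. exp (max 0 (U x - A)) - 1) \<and> (LBINT x. exp (max 0 (U x - A)) - 1) \<le> \<delta>"
proof -
  note [measurable] = U(1) \<Omega>
  let ?h = "\<lambda>n x. exp (max 0 (U x - real (Suc n))) - 1"
  have le: "norm (?h n x) \<le> indicator \<Omega> x * exp (U x)" for n x
  proof (cases "U x > real (Suc n)")
    case True
    then have "x \<in> \<Omega>" using U0[of x] by (cases "x \<in> \<Omega>") auto
    moreover have "exp (U x - real (Suc n)) \<le> exp (U x)" by simp
    moreover have "1 \<le> exp (U x - real (Suc n))" using True by simp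
    ultimately show ?thesis using True by (simp add: max_def del: of_nat_Suc one_le_exp_iff exp_le_cancel_iff)
  qed (simp add: max_def)
  have i: "integrable lborel (?h n)" for n
    by (rule Bochner_Integration.integrable_bound[OF U(2)]) (use le in \<open>auto intro!: AE_I2 order.trans[OF le abs_ge_self]\<close>)
  have "(\<lambda>n. \<integral>x. ?h n x \<partial>lborel) \<longlonglongrightarrow> integral\<^sup>L lborel (\<lambda>x::'a. 0::real)"
  proof (rule integral_dominated_convergence[OF _ _ U(2)])
    show "AE x in lborel. (\<lambda>n. ?h n x) \<longlonglongrightarrow> 0"
    proof (intro AE_I2 tendsto_eventually)
      fix x
      obtain m :: nat where "U x \<le> m" using real_arch_simple by blast
      then show "eventually (\<lambda>n. ?h n x = 0) sequentially"
        by (intro eventually_sequentiallyI[of m]) auto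
    qed
  qed (use le in auto)
  then have "(\<lambda>n. \<integral>x. ?h n x \<partial>lborel) \<longlonglongrightarrow> 0" by simp
  from order_tendstoD(2)[OF this \<delta>] obtain n where n: "(LBINT x. ?h n x) < \<delta>"
    by (auto simp: eventually_sequentially)
  then show ?thesis using i[of n] by (intro exI[of _ "real (Suc n)"]) auto
qed

lemma pos_part_square_le_exp:
  fixes a :: real
  shows "(max 0 a)\<^sup>2 \<le> 2 * exp a"
proof (cases "a \<ge> 0")
  case True
  have "1 + a + a\<^sup>2 / 2 \<le> exp a" by (rule exp_lower_Taylor_quadratic[OF True])
  then show ?thesis using True by simp
qed simp

text \<open>Everything needed about an admissible function is controlled by the norm \<open>j\<close> of the maximal
  function of its Laplacian.\<close>

lemma capacity_function_estimates:
  fixes \<eta> :: "'a::euclidean_space \<Rightarrow> real"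
  assumes \<eta>: "\<eta> \<in> C2_0 \<Omega>" "\<And>x. 0 \<le> \<eta> x" "\<And>x. \<eta> x \<le> 1" and \<Omega>: "open \<Omega>" "\<Omega> \<subseteq> Q0"
    and Q0: "Q0 = cbox a0 (a0 + r0 *\<^sub>R One)" "r0 > 0"
    and J: "(\<integral>\<^sup>+x. maximal_function Q0 \<Omega> (laplacian \<eta>) x \<partial>lebesgue_on Q0) \<le> ennreal j" "j \<le> r0 ^ DIM('a)" "0 \<le> j"
  shows "(LBINT x. \<bar>laplacian \<eta> x\<bar>) \<le> j"
    and "integrable lborel (\<lambda>x. \<bar>laplacian \<eta> x\<bar> * max 0 (ln \<bar>laplacian \<eta> x\<bar>))"
    and "(LBINT x. \<bar>laplacian \<eta> x\<bar> * max 0 (ln \<bar>laplacian \<eta> x\<bar>)) \<le> (1 + 2 * 2 ^ DIM('a)) * j"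
    and "i \<in> Basis \<Longrightarrow> (LBINT x. (partial_deriv i \<eta> x)\<^sup>2) \<le> j"
    and "0 \<le> R \<Longrightarrow> \<Omega> \<subseteq> cball 0 R \<Longrightarrow> (LBINT x. (\<eta> x)\<^sup>2) \<le> 4 * R\<^sup>2 * j"
proof -
  have 2: "Ck_on 2 UNIV \<eta>" by (rule C2_0_D(1)[OF \<eta>(1) \<Omega>(1)])
  obtain K where K: "compact K" "K \<subseteq> \<Omega>" "\<And>x. x \<notin> K \<Longrightarrow> \<eta> x = 0" using C2_0_D(2)[OF \<eta>(1) \<Omega>(1)] by blast
  have l0: "laplacian \<eta> x = 0" if "x \<notin> K" for x
    using laplacian_outside[where f=\<eta>, OF compact_imp_closed[OF K(1)] K(3) that] .
  have cf: "continuous_on UNIV (\<lambda>x. \<bar>laplacian \<eta> x\<bar>)"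
    using continuous_on_laplacian[OF 2] by (intro continuous_intros)
  have f0: "\<bar>laplacian \<eta> x\<bar> = 0" if "x \<notin> K" for x using l0[OF that] by simp
  have fg: "\<bar>laplacian \<eta> y\<bar> = \<bar>indicator \<Omega> y * laplacian \<eta> y\<bar>" for y
    using l0[of y] K(2) by (cases "y \<in> \<Omega>") auto
  note S = LlogL_le_maximal[OF cf K(1) f0 K(2) \<Omega> fg Q0 J]
  show 1: "(LBINT x. \<bar>laplacian \<eta> x\<bar>) \<le> j" by (rule S(1))
  show "integrable lborel (\<lambda>x. \<bar>laplacian \<eta> x\<bar> * max 0 (ln \<bar>laplacian \<eta> x\<bar>))" by (rule S(2))
  show "(LBINT x. \<bar>laplacian \<eta> x\<bar> * max 0 (ln \<bar>laplacian \<eta> x\<bar>)) \<le> (1 + 2 * 2 ^ DIM('a)) * j" by (rule S(3))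
  have E: "(\<Sum>i\<in>Basis. \<integral>x. (partial_deriv i \<eta> x)\<^sup>2 \<partial>lborel) \<le> j"
    using energy_le[OF 2 K(1,3) \<eta>(2,3)] 1 by linarith
  have Ei: "(LBINT x. (partial_deriv i \<eta> x)\<^sup>2) \<le> j" if "i \<in> Basis" for i
    using member_le_sum[OF that, of "\<lambda>i. \<integral>x. (partial_deriv i \<eta> x)\<^sup>2 \<partial>lborel"] E by simp
  then show "i \<in> Basis \<Longrightarrow> (LBINT x. (partial_deriv i \<eta> x)\<^sup>2) \<le> j" .
  assume R: "0 \<le> R" "\<Omega> \<subseteq> cball 0 R"
  define i where "i = (SOME i::'a. i \<in> Basis)"
  have i: "i \<in> Basis" unfolding i_def by (rule SOME_Basis)
  have "(LBINT x. (\<eta> x)\<^sup>2) \<le> 4 * R\<^sup>2 * (LBINT x. (partial_deriv i \<eta> x)\<^sup>2)"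
    by (rule Poincare[OF Ck_on_2_1[OF 2] K(1,3) i _ R(1)]) (use K(2) R(2) in auto)
  also have "\<dots> \<le> 4 * R\<^sup>2 * j" using Ei[OF i] by (intro mult_left_mono) auto
  finally show "(LBINT x. (\<eta> x)\<^sup>2) \<le> 4 * R\<^sup>2 * j" .
qed

lemma integrable_C2_0:
  assumes "\<eta> \<in> C2_0 \<Omega>" "open \<Omega>"
  shows "integrable lborel \<eta>" "integrable lborel (\<lambda>x. (\<eta> x)\<^sup>2)" "integrable lborel (laplacian \<eta>)"
    "i \<in> Basis \<Longrightarrow> integrable lborel (\<lambda>x. (partial_deriv i \<eta> x)\<^sup>2)"
proof -
  have 2: "Ck_on 2 UNIV \<eta>" by (rule C2_0_D(1)[OF assms])
  obtain K where K: "compact K" "K \<subseteq> \<Omega>" "\<And>x. x \<notin> K \<Longrightarrow> \<eta> x = 0" using C2_0_D(2)[OF assms] by blast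
  have l0: "laplacian \<eta> x = 0" if "x \<notin> K" for x
    using laplacian_outside[where f=\<eta>, OF compact_imp_closed[OF K(1)] K(3) that] .
  have p0: "partial_deriv i \<eta> x = 0" if "x \<notin> K" for x i
    using partial_deriv_outside(1)[where f=\<eta>, OF compact_imp_closed[OF K(1)] K(3) that] .
  note c = Ck_on_imp_continuous[OF 2] continuous_on_laplacian[OF 2] continuous_on_partial[OF 2]
  show "integrable lborel \<eta>" by (rule integrable_cc[OF c(1) K(1,3)])
  show "integrable lborel (\<lambda>x. (\<eta> x)\<^sup>2)"
    by (rule integrable_cc[OF _ K(1)]) (auto intro!: continuous_intros c simp: K(3))
  show "integrable lborel (laplacian \<eta>)" by (rule integrable_cc[OF c(2) K(1) l0])
  show "integrable lborel (\<lambda>x. (partial_deriv i \<eta> x)\<^sup>2)" if "i \<in> Basis"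
    by (rule integrable_cc[OF _ K(1)]) (auto intro!: continuous_intros c that simp: p0)
qed

text \<open>The weak formulation is tested with \<open>\<theta>\<eta>\<close>, where \<open>\<theta>\<close> is a fixed admissible function and \<open>\<eta>\<close> an
  admissible one whose maximal function has norm at most \<open>s\<^sup>2\<close>. With the square as parameter, Young's
  inequality with weight \<open>s\<close> makes all gradient terms linear in \<open>s\<close>. The result is
  \<open>\<mu>(K) \<le> 2 * \<delta> + s * B\<close> with \<open>B\<close> independent of \<open>s\<close>.\<close>

lemma capacity_zero_compact_null:
  fixes \<Omega> Q0 K :: "'a::euclidean_space set" and \<mu> :: "'a measure"
  assumes \<Omega>: "open \<Omega>" "bounded \<Omega>" "\<Omega> \<subseteq> Q0" and Q0: "Q0 = cbox a0 (a0 + r0 *\<^sub>R One)" "r0 > 0"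
    and \<mu>: "\<mu> \<in> bounded_radon_measures \<Omega>" and u: "weak_solution \<Omega> \<mu> u"
    and K: "compact K" "K \<subseteq> \<Omega>" and cap: "capacity_LlnL Q0 \<Omega> K = 0"
  shows "measure \<mu> K = 0"
proof -
  have \<Omega>m[measurable]: "\<Omega> \<in> sets borel" using \<Omega>(1) by auto
  obtain U where iU: "integrable lborel U" and iE: "integrable lborel (\<lambda>x. indicator \<Omega> x * exp (U x))"
    and U0: "\<And>x. x \<notin> \<Omega> \<Longrightarrow> U x = 0"
    and weak: "\<And>\<zeta>. \<zeta> \<in> C2_0 \<Omega> \<Longrightarrow>
      (LBINT x. - U x * laplacian \<zeta> x + indicator \<Omega> x * (exp (U x) - 1) * \<zeta> x) = (\<integral>x. \<zeta> x \<partial>\<mu>)"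
    using weak_solution_lborel[OF u \<Omega>(1,2)] by blast
  have Um[measurable]: "U \<in> borel_measurable borel" using iU by auto
  have fin\<Omega>: "emeasure lborel \<Omega> < \<infinity>" by (rule emeasure_bounded_finite[OF \<Omega>(2)])
  have i\<Omega>: "integrable lborel (indicator \<Omega> :: 'a \<Rightarrow> real)" using fin\<Omega> by simp
  have ind2: "(indicator \<Omega> x)\<^sup>2 = (indicator \<Omega> x :: real)" for x :: 'a by (simp add: indicator_def)
  define H where "H = (\<lambda>x. indicator \<Omega> x * (exp (U x) - 1))"
  have iH: "integrable lborel H"
  proof -
    have "integrable lborel (\<lambda>x. indicator \<Omega> x * exp (U x) - indicator \<Omega> x)"
      using iE i\<Omega> by (rule Bochner_Integration.integrable_diff)
    then show ?thesis unfolding H_def by (simp add: right_diff_distrib)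
  qed
  have Hm[measurable]: "H \<in> borel_measurable borel" using iH by auto
  have i\<zeta>: "integrable lborel (\<lambda>x. - U x * laplacian \<zeta> x)" "integrable lborel (\<lambda>x. H x * \<zeta> x)"
    if \<zeta>: "\<zeta> \<in> C2_0 \<Omega>" for \<zeta>
  proof -
    have 2: "Ck_on 2 UNIV \<zeta>" by (rule C2_0_D(1)[OF \<zeta> \<Omega>(1)])
    obtain S where S: "compact S" "S \<subseteq> \<Omega>" "\<And>x. x \<notin> S \<Longrightarrow> \<zeta> x = 0" using C2_0_D(2)[OF \<zeta> \<Omega>(1)] by blast
    have l0: "laplacian \<zeta> x = 0" if "x \<notin> S" for x
      using laplacian_outside[where f=\<zeta>, OF compact_imp_closed[OF S(1)] S(3) that] .
    note c = Ck_on_imp_continuous[OF 2] continuous_on_laplacian[OF 2]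
    obtain B where B: "\<And>x. \<bar>\<zeta> x\<bar> \<le> B" using continuous_cc_bounded[OF c(1) S(1,3)] by blast
    obtain L where L: "\<And>x. \<bar>laplacian \<zeta> x\<bar> \<le> L" using continuous_cc_bounded[OF c(2) S(1) l0] by blast
    note [measurable] = c[THEN borel_measurable_continuous_onI]
    show "integrable lborel (\<lambda>x. - U x * laplacian \<zeta> x)"
      by (rule integrable_mult_bounded[where B=L]) (use iU L in auto)
    show "integrable lborel (\<lambda>x. H x * \<zeta> x)"
      by (rule integrable_mult_bounded[where B=B]) (use iH B in auto)
  qed
  \<comment> \<open>The negative part of U is at most \<open>w + 1\<close>, and w is weakly subharmonic.\<close>
  define v where "v = (\<lambda>x. - U x)"
  define w where "w = (\<lambda>x. soft_pos (v x))"
  have iv: "integrable lborel v" unfolding v_def using iU by auto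
  have iw: "integrable lborel w"
  proof (rule Bochner_Integration.integrable_bound[OF iv])
    show "AE x in lborel. norm (w x) \<le> norm (v x)"
      unfolding w_def using soft_pos_Lipschitz[of "v _" 0] soft_pos_0[of 0] by (intro AE_I2) auto
  qed (simp add: w_def v_def)
  have w0: "0 \<le> w x" for x unfolding w_def by (rule soft_pos_nonneg)
  have subw: "0 \<le> (LBINT x. w x * laplacian \<zeta> x)" if \<zeta>: "\<zeta> \<in> C2_0 \<Omega>" "\<And>x. 0 \<le> \<zeta> x" for \<zeta>
    unfolding w_def
  proof (rule Kato_inequality[where h="\<lambda>x. - H x", OF iv _ \<Omega>(1) _ _ \<zeta>])
    show "integrable lborel (\<lambda>x. - H x)" using iH by auto
    show "0 \<le> - H x" if "0 \<le> v x" for x using that unfolding v_def H_def by (auto simp: indicator_def)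
    fix \<xi> :: "'a \<Rightarrow> real" assume \<xi>: "\<xi> \<in> C2_0 \<Omega>" "\<And>x. 0 \<le> \<xi> x"
    have "0 \<le> (\<integral>x. \<xi> x \<partial>\<mu>)" using \<xi>(2) by simp
    also have "\<dots> = (LBINT x. - U x * laplacian \<xi> x + H x * \<xi> x)"
      using weak[OF \<xi>(1)] unfolding H_def by simp
    also have "\<dots> = (LBINT x. - U x * laplacian \<xi> x) + (LBINT x. H x * \<xi> x)"
      by (rule Bochner_Integration.integral_add[OF i\<zeta>[OF \<xi>(1)]])
    finally show "(LBINT x. - H x * \<xi> x) \<le> (LBINT x. v x * laplacian \<xi> x)"
      unfolding v_def by simp
  qed
  \<comment> \<open>Zero capacity provides admissible functions with arbitrarily small norm; the first one
    obtained, with norm at most 1, serves as the cutoff.\<close>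
  have adm: "\<exists>\<eta>\<in>C2_0 \<Omega>. (\<forall>x. 0 \<le> \<eta> x \<and> \<eta> x \<le> 1) \<and> (\<exists>V. open V \<and> K \<subseteq> V \<and> (\<forall>x\<in>V. \<eta> x = 1)) \<and>
     (\<integral>\<^sup>+x. maximal_function Q0 \<Omega> (laplacian \<eta>) x \<partial>lebesgue_on Q0) \<le> ennreal j" if "j > 0" for j
  proof -
    have "capacity_LlnL Q0 \<Omega> K < ennreal j" using cap that by simp
    then show ?thesis unfolding capacity_LlnL_def INF_less_iff by (auto intro: less_imp_le)
  qed
  obtain \<theta> V where \<theta>: "\<theta> \<in> C2_0 \<Omega>" "\<And>x. 0 \<le> \<theta> x" "\<And>x. \<theta> x \<le> 1" and V: "K \<subseteq> V" "\<And>x. x \<in> V \<Longrightarrow> \<theta> x = 1"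
    using adm[of 1] by auto
  have \<theta>2: "Ck_on 2 UNIV \<theta>" by (rule C2_0_D(1)[OF \<theta>(1) \<Omega>(1)])
  obtain S where S: "compact S" "S \<subseteq> \<Omega>" "\<And>x. x \<notin> S \<Longrightarrow> \<theta> x = 0" using C2_0_D(2)[OF \<theta>(1) \<Omega>(1)] by blast
  have \<theta>l0: "laplacian \<theta> x = 0" if "x \<notin> S" for x
    using laplacian_outside[where f=\<theta>, OF compact_imp_closed[OF S(1)] S(3) that] .
  have \<theta>p0: "partial_deriv i \<theta> x = 0" if "x \<notin> S" for x i
    using partial_deriv_outside(1)[where f=\<theta>, OF compact_imp_closed[OF S(1)] S(3) that] .
  note c\<theta> = Ck_on_imp_continuous[OF \<theta>2] continuous_on_laplacian[OF \<theta>2] continuous_on_partial[OF \<theta>2]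
  obtain L where L: "L > 0" "\<And>x. \<bar>laplacian \<theta> x\<bar> \<le> L" using continuous_cc_bounded[OF c\<theta>(2) S(1) \<theta>l0] by blast
  have "\<forall>i\<in>Basis. \<exists>G>0. \<forall>x. \<bar>partial_deriv i \<theta> x\<bar> \<le> G"
    using continuous_cc_bounded[OF c\<theta>(3) S(1) \<theta>p0] by auto
  then obtain Gi where Gi: "\<And>i. i \<in> Basis \<Longrightarrow> Gi i > (0::real)" "\<And>i x. i \<in> Basis \<Longrightarrow> \<bar>partial_deriv i \<theta> x\<bar> \<le> Gi i"
    by metis
  define G where "G = (\<Sum>i\<in>(Basis::'a set). Gi i)"
  have G: "G \<ge> 0" "\<And>i x. i \<in> Basis \<Longrightarrow> \<bar>partial_deriv i \<theta> x\<bar> \<le> G"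
  proof -
    show "G \<ge> 0" unfolding G_def using Gi(1) by (intro sum_nonneg less_imp_le)
    show "\<bar>partial_deriv i \<theta> x\<bar> \<le> G" if "i \<in> Basis" for i x
      using Gi(2)[OF that, of x] member_le_sum[OF that, of Gi] Gi(1) unfolding G_def by (force intro: less_imp_le)
  qed
  obtain C0 where C0: "C0 \<ge> 0" "\<And>g. continuous_on UNIV g \<Longrightarrow> (\<And>x. 0 \<le> g x) \<Longrightarrow> (\<And>x. x \<notin> S \<Longrightarrow> g x = 0) \<Longrightarrow>
     (LBINT x. w x * g x) \<le> C0 * (LBINT x. g x)"
    using subharmonic_locally_bounded[OF iw w0 \<Omega>(1) subw S(1,2)] by blast
  obtain R where R': "0 < R" "\<forall>x\<in>\<Omega>. norm x \<le> R"
    using \<Omega>(2) unfolding bounded_pos by blast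
  then have R: "0 \<le> R" "\<Omega> \<subseteq> cball 0 R" by auto
  define X where "X = (LBINT x. indicator \<Omega> x * exp (U x))"
  define m where "m = measure lborel \<Omega>"
  have X0: "X \<ge> 0" unfolding X_def by simp
  have m0: "m \<ge> 0" unfolding m_def by simp
  let ?N = "real DIM('a)"
  define P where "P = (\<lambda>x. max 0 (U x))"
  have iP: "integrable lborel P" unfolding P_def using iU by (intro integrable_max) auto
  have Pm[measurable]: "P \<in> borel_measurable borel" using iP by auto
  have P0: "0 \<le> P x" for x unfolding P_def by simp
  have P2le: "(P x)\<^sup>2 \<le> 2 * (indicator \<Omega> x * exp (U x))" for x
    using pos_part_square_le_exp[of "U x"] U0[of x] unfolding P_def by (cases "x \<in> \<Omega>") auto
  have iP2: "integrable lborel (\<lambda>x. (P x)\<^sup>2)"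
    by (rule Bochner_Integration.integrable_bound[of _ "\<lambda>x. 2 * (indicator \<Omega> x * exp (U x))"])
      (use iE P2le in \<open>auto intro!: AE_I2 order.trans[OF P2le abs_ge_self]\<close>)
  have P2X: "(LBINT x. (P x)\<^sup>2) \<le> 2 * X"
    using integral_mono[OF iP2 _ P2le] iE unfolding X_def by simp
  have Ule: "\<bar>U x\<bar> \<le> P x + (w x + 1)" for x
  proof -
    have "\<bar>U x\<bar> = max 0 (U x) + max 0 (- U x)" by (simp add: max_def)
    with pos_part_le_soft_pos[of "- U x"] show ?thesis unfolding P_def w_def v_def by linarith
  qed
  \<comment> \<open>Z collects the coefficients of the terms that contain \<eta> without derivatives.\<close>
  define Z where "Z = (\<lambda>x. L * \<bar>U x\<bar> + \<bar>H x\<bar>)"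
  have iZ: "integrable lborel Z" unfolding Z_def using iU iH by auto
  have Z0: "0 \<le> Z x" for x unfolding Z_def using L by simp

  have estimate: "\<exists>B\<ge>0. \<forall>s. 0 < s \<longrightarrow> s \<le> 1 \<longrightarrow> s\<^sup>2 \<le> r0 ^ DIM('a) \<longrightarrow> measure \<mu> K \<le> 2 * \<delta> + s * B" if \<delta>: "\<delta> > 0" for \<delta>
  proof -
    obtain A where A: "A > 0" "integrable lborel (\<lambda>x. exp (max 0 (U x - A)) - 1)" "(LBINT x. exp (max 0 (U x - A)) - 1) \<le> \<delta>"
      using exp_tail_small[OF Um iE \<Omega>m U0 \<delta>] by blast
    obtain A' where A': "A' > 0" "\<And>f. integrable lborel f \<Longrightarrow> (\<And>x. 0 \<le> f x \<and> f x \<le> 1) \<Longrightarrow>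
       (LBINT x. \<bar>Z x\<bar> * f x) \<le> \<delta> + A' * (LBINT x. f x)"
      using integrable_times_small[OF iZ \<delta>] by blast
    define B where "B = A + (1 + 2 * 2 ^ DIM('a)) + (C0 + 1) + A' * (m + 4 * R\<^sup>2) + 2 * (?N * G * (2 * X + 1)) + 2 * ((C0 + 1) * (?N * G * (m + 1)))"
    have B: "B \<ge> 0" unfolding B_def using A(1) A'(1) C0(1) m0 X0 G(1) by (intro add_nonneg_nonneg mult_nonneg_nonneg) auto
    have "measure \<mu> K \<le> 2 * \<delta> + s * B" if s: "0 < s" "s \<le> 1" "s\<^sup>2 \<le> r0 ^ DIM('a)" for s
    proof -
      have j: "s\<^sup>2 > 0" "s\<^sup>2 \<le> s" using s mult_left_mono[of s 1 s] by (auto simp: power2_eq_square)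
      obtain \<eta> V' where \<eta>: "\<eta> \<in> C2_0 \<Omega>" "\<And>x. 0 \<le> \<eta> x" "\<And>x. \<eta> x \<le> 1" and V': "K \<subseteq> V'" "\<And>x. x \<in> V' \<Longrightarrow> \<eta> x = 1"
        and J: "(\<integral>\<^sup>+x. maximal_function Q0 \<Omega> (laplacian \<eta>) x \<partial>lebesgue_on Q0) \<le> ennreal (s\<^sup>2)"
        using adm[OF j(1)] by auto
      note est = capacity_function_estimates[OF \<eta> \<Omega>(1,3) Q0 J s(3) zero_le_power2]
      have \<eta>2: "Ck_on 2 UNIV \<eta>" by (rule C2_0_D(1)[OF \<eta>(1) \<Omega>(1)])
      obtain T where T: "compact T" "T \<subseteq> \<Omega>" "\<And>x. x \<notin> T \<Longrightarrow> \<eta> x = 0" using C2_0_D(2)[OF \<eta>(1) \<Omega>(1)] by blast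
      note c\<eta> = Ck_on_imp_continuous[OF \<eta>2] continuous_on_laplacian[OF \<eta>2] continuous_on_partial[OF \<eta>2]
      note i\<eta> = integrable_C2_0[OF \<eta>(1) \<Omega>(1)]
      note [measurable] = c\<eta>(1,2)[THEN borel_measurable_continuous_onI]
      have pm: "partial_deriv i \<eta> \<in> borel_measurable borel" if "i \<in> Basis" for i
        using c\<eta>(3)[OF _ that] by (intro borel_measurable_continuous_onI) auto
      define \<zeta> where "\<zeta> = (\<lambda>x. \<theta> x * \<eta> x)"
      define f where "f = (\<lambda>x. \<bar>laplacian \<eta> x\<bar>)"
      define g where "g = (\<lambda>x. \<Sum>i\<in>Basis. \<bar>partial_deriv i \<theta> x\<bar> * \<bar>partial_deriv i \<eta> x\<bar>)"
      have \<zeta>: "\<zeta> \<in> C2_0 \<Omega>"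
        unfolding \<zeta>_def by (rule C2_0_I[OF Ck_on_2_mult[OF \<theta>2 \<eta>2] S(1,2)]) (simp add: S(3))
      have f: "0 \<le> f x" for x unfolding f_def by simp
      have iF: "integrable lborel f" unfolding f_def using i\<eta>(3) by auto
      have fm[measurable]: "f \<in> borel_measurable borel" unfolding f_def by measurable
      have cg: "continuous_on UNIV g" unfolding g_def using c\<theta>(3) c\<eta>(3) by (intro continuous_intros) auto
      have g: "0 \<le> g x" "x \<notin> S \<Longrightarrow> g x = 0" for x unfolding g_def by (auto intro!: sum_nonneg simp: \<theta>p0)
      have gm[measurable]: "g \<in> borel_measurable borel" by (rule borel_measurable_continuous_onI[OF cg])
      have cf: "continuous_on UNIV (\<lambda>x. \<theta> x * f x)" unfolding f_def by (intro continuous_intros c\<theta> c\<eta>)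
      obtain bf where bf: "\<And>x. \<bar>f x\<bar> \<le> bf"
      proof -
        have "continuous_on UNIV f" unfolding f_def by (intro continuous_intros c\<eta>)
        moreover have "f x = 0" if "x \<notin> T" for x
          unfolding f_def using laplacian_outside[where f=\<eta>, OF compact_imp_closed[OF T(1)] T(3) that] by simp
        ultimately show ?thesis using continuous_cc_bounded[OF _ T(1)] that by metis
      qed
      obtain bg where bg: "\<And>x. \<bar>g x\<bar> \<le> bg" using continuous_cc_bounded[OF cg S(1) g(2)] by blast
      have \<theta>f: "0 \<le> \<theta> x * f x" "\<theta> x * f x \<le> f x" "x \<notin> S \<Longrightarrow> \<theta> x * f x = 0" for x
        using \<theta>(2,3)[of x] f[of x] mult_right_mono[of "\<theta> x" 1 "f x"] S(3)[of x] by auto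
      have i\<theta>f: "integrable lborel (\<lambda>x. \<theta> x * f x)" by (rule integrable_cc[OF cf S(1) \<theta>f(3)])
      have ig: "integrable lborel g" by (rule integrable_cc[OF cg S(1) g(2)])
      have iPf: "integrable lborel (\<lambda>x. P x * f x)" by (rule integrable_mult_bounded[OF iP _ bf]) simp
      have iPg: "integrable lborel (\<lambda>x. P x * g x)" by (rule integrable_mult_bounded[OF iP _ bg]) simp
      have iwg: "integrable lborel (\<lambda>x. w x * g x)" by (rule integrable_mult_bounded[OF iw _ bg]) simp
      have iwf: "integrable lborel (\<lambda>x. w x * (\<theta> x * f x))"
      proof (rule integrable_mult_bounded[OF iw, where B=bf])
        show "(\<lambda>x. \<theta> x * f x) \<in> borel_measurable lborel" using borel_measurable_continuous_onI[OF cf] by simp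
        show "\<bar>\<theta> x * f x\<bar> \<le> bf" for x using \<theta>f(1,2)[of x] bf[of x] by linarith
      qed
      have iZ\<eta>: "integrable lborel (\<lambda>x. Z x * \<eta> x)"
        by (rule integrable_mult_bounded[OF iZ, where B=1]) (use \<eta> in auto)

      \<comment> \<open>The positive part of U against the Laplacian of \<eta>: the duality of exponential and L ln L.
        Below the level A only the \<open>L^1\<close> norm of the Laplacian enters.\<close>
      have I1: "(LBINT x. P x * f x) \<le> \<delta> + s * (A + (1 + 2 * 2 ^ DIM('a)))"
      proof -
        have ii: "integrable lborel (\<lambda>x. A * f x + (exp (max 0 (U x - A)) - 1))"
          using iF A(2) by auto
        have iL: "integrable lborel (\<lambda>x. f x * max 0 (ln (f x)))" unfolding f_def by (rule est(2))
        have "(LBINT x. P x * f x) \<le> (LBINT x. (A * f x + (exp (max 0 (U x - A)) - 1)) + f x * max 0 (ln (f x)))"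
        proof (rule integral_mono[OF iPf Bochner_Integration.integrable_add[OF ii iL]])
          fix x
          have "P x \<le> A + max 0 (U x - A)" unfolding P_def using A(1) by auto
          then have "P x * f x \<le> (A + max 0 (U x - A)) * f x" by (rule mult_right_mono) (rule f)
          also have "\<dots> = A * f x + max 0 (U x - A) * f x" by (rule distrib_right)
          also have "max 0 (U x - A) * f x \<le> exp (max 0 (U x - A)) - 1 + f x * max 0 (ln (f x))"
            using f by (intro Young_exp) auto
          finally show "P x * f x \<le> (A * f x + (exp (max 0 (U x - A)) - 1)) + f x * max 0 (ln (f x))" by simp
        qed
        also have "\<dots> = (LBINT x. A * f x + (exp (max 0 (U x - A)) - 1)) + (LBINT x. f x * max 0 (ln (f x)))"
          by (rule Bochner_Integration.integral_add[OF ii iL])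
        also have "(LBINT x. A * f x + (exp (max 0 (U x - A)) - 1)) = A * (LBINT x. f x) + (LBINT x. exp (max 0 (U x - A)) - 1)"
          using iF A(2) by (subst Bochner_Integration.integral_add) auto
        also have "A * (LBINT x. f x) \<le> A * s"
          using est(1) j(2) A(1) unfolding f_def by (intro mult_left_mono) auto
        also have "(LBINT x. f x * max 0 (ln (f x))) \<le> (1 + 2 * 2 ^ DIM('a)) * s"
          using est(3) mult_left_mono[OF j(2), of "1 + 2 * 2 ^ DIM('a)"] unfolding f_def by simp
        finally show ?thesis using A(3) by (simp add: algebra_simps)
      qed
      \<comment> \<open>The negative part of U: w is bounded on the support of the cutoff.\<close>
      have I2: "(LBINT x. (w x + 1) * (\<theta> x * f x)) \<le> s * (C0 + 1)"
      proof -
        have "(LBINT x. (w x + 1) * (\<theta> x * f x)) = (LBINT x. w x * (\<theta> x * f x)) + (LBINT x. \<theta> x * f x)"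
          using iwf i\<theta>f by (simp add: distrib_right)
        also have "\<dots> \<le> (C0 + 1) * (LBINT x. \<theta> x * f x)"
          using C0(2)[OF cf \<theta>f(1,3)] by (simp add: distrib_right)
        also have "(LBINT x. \<theta> x * f x) \<le> (LBINT x. f x)"
          by (rule integral_mono[OF i\<theta>f iF \<theta>f(2)])
        also have "(LBINT x. f x) \<le> s" using est(1) j(2) unfolding f_def by simp
        finally show ?thesis using C0(1) by (simp add: mult.commute mult_left_mono)
      qed
      \<comment> \<open>Poincare's inequality makes \<eta> small in the mean.\<close>
      have I3: "(LBINT x. Z x * \<eta> x) \<le> \<delta> + s * (A' * (m + 4 * R\<^sup>2))"
      proof -
        have "(LBINT x. \<eta> x) = (LBINT x. \<bar>indicator \<Omega> x\<bar> * \<bar>\<eta> x\<bar>)"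
          using \<eta>(2) T(2,3) by (intro Bochner_Integration.integral_cong) (auto simp: indicator_def)
        also have "\<dots> \<le> s * (LBINT x. (indicator \<Omega> x)\<^sup>2) + (LBINT x. (\<eta> x)\<^sup>2) / s"
          by (rule integral_mult_AMGM(2)[OF s(1)]) (use i\<Omega> i\<eta> in \<open>auto simp: ind2\<close>)
        also have "(LBINT x. (indicator \<Omega> x :: real)\<^sup>2) = m" unfolding m_def by (simp add: ind2)
        also have "(LBINT x. (\<eta> x)\<^sup>2) / s \<le> 4 * R\<^sup>2 * s\<^sup>2 / s"
          using est(5)[OF R] s(1) by (intro divide_right_mono) auto
        also have "4 * R\<^sup>2 * s\<^sup>2 / s = s * (4 * R\<^sup>2)" using s(1) by (simp add: power2_eq_square)
        finally have "(LBINT x. \<eta> x) \<le> s * (m + 4 * R\<^sup>2)" by (simp add: distrib_left)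
        then have "A' * (LBINT x. \<eta> x) \<le> A' * (s * (m + 4 * R\<^sup>2))" using A'(1) by (intro mult_left_mono) auto
        moreover have "(LBINT x. Z x * \<eta> x) \<le> \<delta> + A' * (LBINT x. \<eta> x)"
          using A'(2)[OF i\<eta>(1)] \<eta> Z0 by simp
        ultimately show ?thesis by (simp add: mult_ac)
      qed
      \<comment> \<open>Gradient terms: Young's inequality with weight s, and the energy bound \<open>s\<^sup>2\<close>.\<close>
      have grad: "(LBINT x. a x * g x) \<le> ?N * G * (s * (Y + 1))"
        if a: "a \<in> borel_measurable borel" "\<And>x. 0 \<le> a x" "integrable lborel (\<lambda>x. (a x)\<^sup>2)" "(LBINT x. (a x)\<^sup>2) \<le> Y"
          "integrable lborel (\<lambda>x. a x * g x)" for a Y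
      proof -
        have am: "a \<in> borel_measurable lborel" using a(1) by simp
        have pm': "partial_deriv i \<eta> \<in> borel_measurable lborel" if "i \<in> Basis" for i using pm[OF that] by simp
        note AG = integral_mult_AMGM[OF s(1) a(3) i\<eta>(4) am pm']
        have "(LBINT x. a x * g x) \<le> (LBINT x. (\<Sum>i\<in>Basis. G * (\<bar>a x\<bar> * \<bar>partial_deriv i \<eta> x\<bar>)))"
        proof (rule integral_mono[OF a(5)])
          show "integrable lborel (\<lambda>x. \<Sum>i\<in>Basis. G * (\<bar>a x\<bar> * \<bar>partial_deriv i \<eta> x\<bar>))"
            using AG(1) by (intro Bochner_Integration.integrable_sum integrable_mult_right) auto
          fix x
          have "a x * g x = (\<Sum>i\<in>Basis. \<bar>partial_deriv i \<theta> x\<bar> * (\<bar>a x\<bar> * \<bar>partial_deriv i \<eta> x\<bar>))"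
            unfolding g_def using a(2)[of x] by (simp add: sum_distrib_left mult_ac)
          also have "\<dots> \<le> (\<Sum>i\<in>Basis. G * (\<bar>a x\<bar> * \<bar>partial_deriv i \<eta> x\<bar>))"
            using G(2) by (intro sum_mono mult_right_mono) auto
          finally show "a x * g x \<le> (\<Sum>i\<in>Basis. G * (\<bar>a x\<bar> * \<bar>partial_deriv i \<eta> x\<bar>))" .
        qed
        also have "\<dots> = (\<Sum>i\<in>Basis. G * (LBINT x. \<bar>a x\<bar> * \<bar>partial_deriv i \<eta> x\<bar>))"
          using AG(1) by (subst Bochner_Integration.integral_sum) auto
        also have "\<dots> \<le> (\<Sum>i\<in>(Basis::'a set). G * (s * (Y + 1)))"
        proof (intro sum_mono mult_left_mono G(1))
          fix i :: 'a assume i: "i \<in> Basis"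
          have "(LBINT x. \<bar>a x\<bar> * \<bar>partial_deriv i \<eta> x\<bar>) \<le> s * (LBINT x. (a x)\<^sup>2) + (LBINT x. (partial_deriv i \<eta> x)\<^sup>2) / s"
            by (rule AG(2)[OF i i])
          also have "\<dots> \<le> s * Y + s\<^sup>2 / s"
            using a(4) est(4)[OF i] s(1) by (intro add_mono mult_left_mono divide_right_mono) auto
          also have "\<dots> = s * (Y + 1)" using s(1) by (simp add: power2_eq_square distrib_left)
          finally show "(LBINT x. \<bar>a x\<bar> * \<bar>partial_deriv i \<eta> x\<bar>) \<le> s * (Y + 1)" .
        qed
        also have "\<dots> = ?N * G * (s * (Y + 1))" by simp
        finally show ?thesis .
      qed
      have I4: "(LBINT x. P x * g x) \<le> s * (?N * G * (2 * X + 1))"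
        using grad[OF Pm P0 iP2 P2X iPg] by (simp only: mult_ac)
      have I5: "(LBINT x. (w x + 1) * g x) \<le> s * ((C0 + 1) * (?N * G * (m + 1)))"
      proof -
        have gi: "indicator \<Omega> x * g x = g x" for x using g(2)[of x] S(2) by (auto simp: indicator_def)
        have "(LBINT x. g x) \<le> ?N * G * (s * (m + 1))"
          using grad[of "indicator \<Omega>" m] i\<Omega> ig unfolding gi by (simp add: ind2 m_def)
        then have *: "(C0 + 1) * (LBINT x. g x) \<le> (C0 + 1) * (?N * G * (s * (m + 1)))"
          using C0(1) by (intro mult_left_mono) auto
        have "(LBINT x. (w x + 1) * g x) = (LBINT x. w x * g x) + (LBINT x. g x)"
          using iwg ig by (simp add: distrib_right)
        also have "\<dots> \<le> (C0 + 1) * (LBINT x. g x)"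
          using C0(2)[OF cg g] by (simp add: distrib_right)
        also note *
        finally show ?thesis by (simp only: mult_ac)
      qed
      \<comment> \<open>The product rule for the Laplacian of \<open>\<theta>\<eta>\<close>, with U split by Ule.\<close>
      have \<zeta>le: "- U x * laplacian \<zeta> x + H x * \<zeta> x \<le>
         P x * f x + (w x + 1) * (\<theta> x * f x) + Z x * \<eta> x + 2 * (P x * g x) + 2 * ((w x + 1) * g x)" for x
      proof -
        let ?D = "\<Sum>i\<in>Basis. partial_deriv i \<theta> x * partial_deriv i \<eta> x"
        have lz: "laplacian \<zeta> x = \<theta> x * laplacian \<eta> x + \<eta> x * laplacian \<theta> x + 2 * ?D"
          unfolding \<zeta>_def by (rule laplacian_mult[OF \<theta>2 \<eta>2])
        have D: "\<bar>?D\<bar> \<le> g x" unfolding g_def by (rule order.trans[OF sum_abs]) (simp add: abs_mult)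
        have lz': "\<bar>laplacian \<zeta> x\<bar> \<le> \<theta> x * f x + \<eta> x * L + 2 * g x"
        proof -
          have "\<bar>laplacian \<zeta> x\<bar> \<le> \<bar>\<theta> x * laplacian \<eta> x\<bar> + \<bar>\<eta> x * laplacian \<theta> x\<bar> + \<bar>2 * ?D\<bar>"
            unfolding lz by linarith
          moreover have "\<bar>\<theta> x * laplacian \<eta> x\<bar> = \<theta> x * f x" unfolding f_def abs_mult using \<theta>(2)[of x] by simp
          moreover have "\<bar>\<eta> x * laplacian \<theta> x\<bar> \<le> \<eta> x * L"
            unfolding abs_mult using \<eta>(2)[of x] L(2)[of x] by (simp add: mult_left_mono)
          ultimately show ?thesis using D by (simp add: abs_mult)
        qed
        have "- U x * laplacian \<zeta> x \<le> \<bar>U x\<bar> * \<bar>laplacian \<zeta> x\<bar>" by (metis abs_ge_self abs_minus_cancel abs_mult)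
        also have "\<dots> \<le> \<bar>U x\<bar> * (\<theta> x * f x + \<eta> x * L + 2 * g x)" using lz' by (rule mult_left_mono) simp
        also have "\<dots> = \<bar>U x\<bar> * (\<theta> x * f x + 2 * g x) + L * \<bar>U x\<bar> * \<eta> x" by (simp add: algebra_simps)
        also have "\<bar>U x\<bar> * (\<theta> x * f x + 2 * g x) \<le> (P x + (w x + 1)) * (\<theta> x * f x + 2 * g x)"
          using Ule[of x] \<theta>f(1)[of x] g(1)[of x] by (intro mult_right_mono) auto
        also have "\<dots> = P x * (\<theta> x * f x) + (w x + 1) * (\<theta> x * f x) + 2 * (P x * g x) + 2 * ((w x + 1) * g x)"
          by (simp add: algebra_simps)
        also have "P x * (\<theta> x * f x) \<le> P x * f x" using \<theta>f(2)[of x] P0[of x] by (rule mult_left_mono)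
        finally have 1: "- U x * laplacian \<zeta> x \<le> P x * f x + (w x + 1) * (\<theta> x * f x) + 2 * (P x * g x) + 2 * ((w x + 1) * g x) + L * \<bar>U x\<bar> * \<eta> x"
          by simp
        have "H x * \<zeta> x \<le> \<bar>H x\<bar> * \<bar>\<zeta> x\<bar>" by (metis abs_ge_self abs_mult)
        also have "\<dots> \<le> \<bar>H x\<bar> * \<eta> x"
          unfolding \<zeta>_def using \<theta>(2,3)[of x] \<eta>(2)[of x] mult_right_mono[of "\<theta> x" 1 "\<eta> x"]
          by (intro mult_left_mono) (auto simp: abs_mult)
        finally show ?thesis using 1 unfolding Z_def by (simp add: distrib_right)
      qed
      have "measure \<mu> K \<le> (\<integral>x. \<zeta> x \<partial>\<mu>)"
      proof -
        have sets\<mu>: "sets \<mu> = sets (restrict_space borel \<Omega>)" and fin: "finite_measure \<mu>"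
          using \<mu> unfolding bounded_radon_measures_def by auto
        interpret finite_measure \<mu> by fact
        have Kb: "K \<in> sets borel" using K(1) by (simp add: compact_imp_closed borel_closed)
        have K\<mu>: "K \<in> sets \<mu>" unfolding sets\<mu> using Kb K(2) by (auto simp: sets_restrict_space)
        have "\<zeta> \<in> borel_measurable borel"
          using C2_0_D(1)[OF \<zeta> \<Omega>(1)] by (intro borel_measurable_continuous_onI Ck_on_imp_continuous)
        then have \<zeta>m: "\<zeta> \<in> borel_measurable \<mu>"
          unfolding measurable_cong_sets[OF sets\<mu> refl] by (rule measurable_restrict_space1)
        have \<zeta>b: "0 \<le> \<zeta> x" "\<zeta> x \<le> 1" for x
          unfolding \<zeta>_def using \<theta>(2,3)[of x] \<eta>(2,3)[of x] mult_mono[of "\<theta> x" 1 "\<eta> x" 1] by auto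
        have "measure \<mu> K = (\<integral>x. indicator K x \<partial>\<mu>)" using K\<mu> sets.sets_into_space[OF K\<mu>] by (simp add: Int_absorb2)
        also have "\<dots> \<le> (\<integral>x. \<zeta> x \<partial>\<mu>)"
        proof (rule integral_mono)
          show "integrable \<mu> (indicator K :: 'a \<Rightarrow> real)" using K\<mu> by (intro integrable_const_bound[where B=1]) auto
          show "integrable \<mu> \<zeta>" by (rule integrable_const_bound[where B=1]) (use \<zeta>b \<zeta>m in auto)
          show "indicator K x \<le> \<zeta> x" for x
          proof (cases "x \<in> K")
            case True
            then have "\<zeta> x = 1" unfolding \<zeta>_def using V(2)[OF subsetD[OF V(1) True]] V'(2)[OF subsetD[OF V'(1) True]] by simp
            then show ?thesis using True by simp
          qed (use \<zeta>b in auto)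
        qed
        finally show ?thesis .
      qed
      also have "\<dots> = (LBINT x. - U x * laplacian \<zeta> x + H x * \<zeta> x)"
        using weak[OF \<zeta>] unfolding H_def by simp
      also have "\<dots> \<le> (LBINT x. P x * f x + (w x + 1) * (\<theta> x * f x) + Z x * \<eta> x + 2 * (P x * g x) + 2 * ((w x + 1) * g x))"
      proof (rule integral_mono[OF Bochner_Integration.integrable_add[OF i\<zeta>[OF \<zeta>]] _ \<zeta>le])
        show "integrable lborel (\<lambda>x. P x * f x + (w x + 1) * (\<theta> x * f x) + Z x * \<eta> x + 2 * (P x * g x) + 2 * ((w x + 1) * g x))"
          using iPf iwf i\<theta>f iZ\<eta> iPg iwg ig by (simp add: distrib_right)
      qed
      also have "\<dots> = (LBINT x. P x * f x) + (LBINT x. (w x + 1) * (\<theta> x * f x)) + (LBINT x. Z x * \<eta> x)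
          + 2 * (LBINT x. P x * g x) + 2 * (LBINT x. (w x + 1) * g x)"
      proof -
        have w1f: "integrable lborel (\<lambda>x. (w x + 1) * (\<theta> x * f x))" using iwf i\<theta>f by (simp add: distrib_right)
        have w1g: "integrable lborel (\<lambda>x. (w x + 1) * g x)" using iwg ig by (simp add: distrib_right)
        show ?thesis
          by (simp only: Bochner_Integration.integral_add Bochner_Integration.integrable_add iPf w1f iZ\<eta> iPg w1g
              integrable_mult_right integral_mult_right_zero)
      qed
      also have "\<dots> \<le> (\<delta> + s * (A + (1 + 2 * 2 ^ DIM('a)))) + s * (C0 + 1) + (\<delta> + s * (A' * (m + 4 * R\<^sup>2)))
          + 2 * (s * (?N * G * (2 * X + 1))) + 2 * (s * ((C0 + 1) * (?N * G * (m + 1))))"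
        using I1 I2 I3 I4 I5 by linarith
      also have "\<dots> = 2 * \<delta> + s * B" unfolding B_def by (simp add: algebra_simps)
      finally show ?thesis .
    qed
    with B show ?thesis by blast
  qed
  have "measure \<mu> K \<le> e" if e: "e > 0" for e
  proof -
    from e have "e / 4 > 0" by simp
    then obtain B where B: "B \<ge> 0" "\<And>s. 0 < s \<Longrightarrow> s \<le> 1 \<Longrightarrow> s\<^sup>2 \<le> r0 ^ DIM('a) \<Longrightarrow> measure \<mu> K \<le> 2 * (e / 4) + s * B"
      using estimate by blast
    define s where "s = min (min 1 (r0 ^ DIM('a))) (e / (2 * (B + 1)))"
    have s: "0 < s" "s \<le> 1" "s \<le> r0 ^ DIM('a)" "s \<le> e / (2 * (B + 1))"
      unfolding s_def using Q0(2) e B(1) by auto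
    have "s\<^sup>2 \<le> s" using s mult_left_mono[of s 1 s] by (simp add: power2_eq_square)
    then have "measure \<mu> K \<le> 2 * (e / 4) + s * B" using s by (intro B(2)) auto
    also have "s * B \<le> s * (B + 1)" using s by simp
    also have "\<dots> \<le> e / 2" using s(4) B(1) by (simp add: field_simps)
    finally show ?thesis by simp
  qed
  then have "measure \<mu> K \<le> 0" by (rule field_le_epsilon[of _ 0, simplified])
  then show ?thesis by (simp add: measure_le_0_iff)
qed

theorem theoremD:
  fixes \<Omega> Q0 E :: "'a::euclidean_space set" and \<mu> :: "'a measure"
  assumes "bounded_smooth_domain \<Omega>"
    and "is_cube Q0" and "closure \<Omega> \<subseteq> Q0"
    and "\<mu> \<in> bounded_radon_measures \<Omega>"
    and "good_measure \<Omega> \<mu>"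
    and "E \<in> sets borel" and "E \<subseteq> \<Omega>"
    and "zero_capacity_LlnL Q0 \<Omega> E"
  shows "measure \<mu> E = 0"
proof -
  have \<Omega>: "open \<Omega>" "bounded \<Omega>" using assms(1) by (auto simp: bounded_smooth_domain_def)
  have sub: "\<Omega> \<subseteq> Q0" using assms(3) closure_subset by blast
  obtain a0 r0 where Q0: "Q0 = cbox a0 (a0 + r0 *\<^sub>R One)" "r0 > 0"
    using assms(2) unfolding is_cube_def by blast
  obtain u where u: "weak_solution \<Omega> \<mu> u" using assms(5) unfolding good_measure_def by blast
  show ?thesis
  proof (rule inner_regular_null[OF assms(4) _ assms(6,7)])
    show "\<Omega> \<in> sets borel" using \<Omega>(1) by auto
    fix K assume K: "compact K" "K \<subseteq> E"
    have "capacity_LlnL Q0 \<Omega> K = 0" using assms(8) K unfolding zero_capacity_LlnL_def by blast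
    then show "measure \<mu> K = 0"
      using K assms(7) by (intro capacity_zero_compact_null[OF \<Omega> sub Q0 assms(4) u]) auto
  qed
qed

end
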